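(* Let $A\in\mathbb{R}^{n\times n}$, $B\in\mathbb{R}^{n\times m}$, let $\{Q_t\}_{t\ge 1}\subset\mathbb{R}^{n\times n}$, $\{R_t\}_{t\ge1}\subset\mathbb{R}^{m\times m}$ be sequences of cost matrices and let $W\in\mathbb{R}^{n\times n}$ be the noise covariance matrix. Suppose that: (i) the pair $(A,B)$ is stabilizable; (ii) $Q_t$ and $R_t$ are (symmetric) positive-definite with $\mu I\preceq Q_t$, $\mu I\preceq R_t$, $\mathrm{Tr}(Q_t)\le\sigma$, $\mathrm{Tr}(R_t)\le\sigma$ for all $t\ge 1$, for some $\sigma>\mu>0$; (iii) $\omega=\mathrm{Tr}(W)<\infty$. Let $\{K_t\}_{t\ge1}$ and $\{P_t\}_{t\ge1}$ be the matrices generated by the Online Riccati Update algorithm (described in the context) with parameters $\nu,\mu,\sigma$, $\kappa=\sqrt{\nu/\mu}$, $\gamma=1/(2\kappa^2)$, started from a stable policy $K_1$, and suppose that the matrices $P_t$ are uniformly bounded, i.e. $P_t\preceq \nu I$ for all $t\ge1$. Then the regret $$R(T)=\sum_{t=1}^T J_t(K_t)-\min_{K\in\mathcal{K}}\sum_{t=1}^T J_t(K)$$ satisfies $R(T)=\mathcal{O}(\log T)$; that is, there is a constant $C>0$ independent of $T$ such that $R(T)\le C\log T$ for all $T\ge 2$.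
   Context: Control system: $x_{t+1}=Ax_t+Bu_t+w_t$, $t\ge 1$, with state $x_t\in\mathbb{R}^n$, action $u_t\in\mathbb{R}^m$, where $w_t$ are i.i.d. $\mathcal{N}(0,W)$ and $x_1$ is a Gaussian vector independent of $\{w_t\}_{t\ge1}$. $\|\cdot\|$ is the Euclidean norm / operator norm, $\rho$ is the spectral radius, and $M\succeq N$ means $M-N$ is positive semi-definite. A policy is a matrix $K\in\mathbb{R}^{m\times n}$, used as $u=-Kx$; it is stable if $\rho(A-BK)<1$. $(A,B)$ is stabilizable if a stable policy exists. $\mathcal{K}$ is the set of stable policies. Costs: $J_t(K_t)=\mathbb{E}[x_t^\top Q_tx_t+u_t^\top R_tu_t]$, where $x_t$ is the state of the system run with $u_s=-K_sx_s$ at every time $s$; $J_t(K)$ for a fixed $K$ is the same expectation when the system is run, from the same initial state $x_1$, with $u_s=-Kx_s$ at every time $s$. Online Riccati Update algorithm. Initialize $K_1$ stable. For each $t=1,2,\dots$: (1) observe $x_t$, apply $u_t=-K_tx_t$, then receive $Q_t,R_t$; (2) set $\bar R_t=\frac{t-1}{t}\bar R_{t-1}+\frac1tR_t$, $\bar Q_t=\frac{t-1}{t}\bar Q_{t-1}+\frac1tQ_t$ (so $\bar Q_t,\bar R_t$ are the running averages); (3) let $P_t$ be the solution of $P_t=(A-BK_t)^\top P_t(A-BK_t)+\bar Q_t+K_t^\top\bar R_tK_t$; (4) (Reset) only if $t=t^\star:=\Big\lceil\frac{4\kappa^3\|B\|}{\gamma\mu}\Big(2\sigma\kappa+\frac{2\kappa^3\|B\|\sigma(1+\kappa^2)}{\gamma}\Big)+1\Big\rceil$: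 set $\widehat P_0=P_{t^\star}$, $\widehat K_0=K_{t^\star}$, and for $\ell=1,2,\dots$ compute $\widehat K_\ell=(B^\top\widehat P_{\ell-1}B+\bar R_{t^\star})^{-1}B^\top\widehat P_{\ell-1}A$ and $\widehat P_\ell$ as the solution of $\widehat P_\ell=(A-B\widehat K_\ell)^\top\widehat P_\ell(A-B\widehat K_\ell)+\bar Q_{t^\star}+\widehat K_\ell^\top\bar R_{t^\star}\widehat K_\ell$, stopping at the first $\ell\ge1$ with $\|\widehat P_\ell-\widehat P_{\ell-1}\|\le\big(\frac{2\sigma}{\|B\|}+\frac{4\kappa^2\sigma(1+\kappa^2)}{\gamma}\big)/t^\star$; then redefine $P_{t^\star}:=\widehat P_\ell$ for this $\ell$; (5) set $K_{t+1}=(B^\top P_tB+\bar R_t)^{-1}B^\top P_tA$. (It is implicit that $B\ne0$.) *)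

theory Defs
  imports "HOL-Probability.Probability"
begin

section \<open>Matrices\<close>

text \<open>An \<open>m \<times> n\<close> matrix has type \<^typ>\<open>real ^ 'n ^ 'm\<close>. The library \<^const>\<open>norm\<close> on this type is the
  Frobenius norm, hence the separate operator norm.\<close>

definition op_norm :: "real ^ 'n ^ 'm \<Rightarrow> real" where
  "op_norm M = onorm (\<lambda>x. M *v x)"

definition complex_eigenvalues :: "real ^ 'n ^ 'n \<Rightarrow> complex set" where
  "complex_eigenvalues M =
     {z. \<exists>v :: complex ^ 'n. v \<noteq> 0 \<and> map_matrix complex_of_real M *v v = z *s v}"

definition spectral_radius :: "real ^ 'n ^ 'n \<Rightarrow> real" where
  "spectral_radius M = Max (cmod ` complex_eigenvalues M)"

definition pos_semidef :: "real ^ 'n ^ 'n \<Rightarrow> bool" where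
  "pos_semidef M \<longleftrightarrow> transpose M = M \<and> (\<forall>x. 0 \<le> x \<bullet> (M *v x))"

definition pos_def :: "real ^ 'n ^ 'n \<Rightarrow> bool" where
  "pos_def M \<longleftrightarrow> transpose M = M \<and> (\<forall>x. x \<noteq> 0 \<longrightarrow> 0 < x \<bullet> (M *v x))"

definition loewner_le :: "real ^ 'n ^ 'n \<Rightarrow> real ^ 'n ^ 'n \<Rightarrow> bool"  (infix "\<preceq>" 50) where
  "N \<preceq> M \<longleftrightarrow> pos_semidef (M - N)"


section \<open>Gaussian vectors\<close>

text \<open>Covariance matrices may be singular, so a normal law of variance 0 is a point mass, and Gaussian
  vectors are defined through their one-dimensional projections rather than by a density.\<close>

definition normal_law :: "real \<Rightarrow> real \<Rightarrow> real measure" where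
  "normal_law m v =
     (if v = 0 then return borel m else density lborel (\<lambda>x. ennreal (normal_density m (sqrt v) x)))"

definition gaussian_vector ::
    "'s measure \<Rightarrow> ('s \<Rightarrow> real ^ 'n) \<Rightarrow> real ^ 'n \<Rightarrow> real ^ 'n ^ 'n \<Rightarrow> bool" where
  "gaussian_vector M X m S \<longleftrightarrow>
     X \<in> borel_measurable M \<and> pos_semidef S \<and>
     (\<forall>a. distr M borel (\<lambda>s. a \<bullet> X s) = normal_law (a \<bullet> m) (a \<bullet> (S *v a)))"


section \<open>The control system\<close>

definition stable_policy :: "real ^ 'n ^ 'n \<Rightarrow> real ^ 'm ^ 'n \<Rightarrow> real ^ 'n ^ 'm \<Rightarrow> bool" where
  "stable_policy A B K \<longleftrightarrow> spectral_radius (A - B ** K) < 1"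

definition stable_policies :: "real ^ 'n ^ 'n \<Rightarrow> real ^ 'm ^ 'n \<Rightarrow> (real ^ 'n ^ 'm) set" where
  "stable_policies A B = {K. stable_policy A B K}"

definition stabilizable :: "real ^ 'n ^ 'n \<Rightarrow> real ^ 'm ^ 'n \<Rightarrow> bool" where
  "stabilizable A B \<longleftrightarrow> (\<exists>K. stable_policy A B K)"

text \<open>Time starts at 1: the value at 0 is a dummy.\<close>

primrec state ::
    "real ^ 'n ^ 'n \<Rightarrow> real ^ 'm ^ 'n \<Rightarrow> (nat \<Rightarrow> real ^ 'n ^ 'm) \<Rightarrow> real ^ 'n \<Rightarrow> (nat \<Rightarrow> real ^ 'n)
      \<Rightarrow> nat \<Rightarrow> real ^ 'n" where
  "state A B K x1 w 0 = x1"
| "state A B K x1 w (Suc t) =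
     (if t = 0 then x1
      else A *v state A B K x1 w t + B *v (- (K t *v state A B K x1 w t)) + w t)"

definition stage_cost ::
    "'s measure \<Rightarrow> real ^ 'n ^ 'n \<Rightarrow> real ^ 'm ^ 'n \<Rightarrow> ('s \<Rightarrow> real ^ 'n) \<Rightarrow> (nat \<Rightarrow> 's \<Rightarrow> real ^ 'n)
      \<Rightarrow> (nat \<Rightarrow> real ^ 'n ^ 'n) \<Rightarrow> (nat \<Rightarrow> real ^ 'm ^ 'm) \<Rightarrow> (nat \<Rightarrow> real ^ 'n ^ 'm) \<Rightarrow> nat \<Rightarrow> real" where
  "stage_cost M A B x1 w Q R K t =
     (LINT s|M.
       (let x = state A B K (x1 s) (\<lambda>i. w i s) t; u = - (K t *v x)
        in x \<bullet> (Q t *v x) + u \<bullet> (R t *v u)))"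

text \<open>The minimum over the stable policies is taken as an infimum: these form an open set, on which
  the finite-horizon cost need not attain its infimum.\<close>

definition regret ::
    "'s measure \<Rightarrow> real ^ 'n ^ 'n \<Rightarrow> real ^ 'm ^ 'n \<Rightarrow> ('s \<Rightarrow> real ^ 'n) \<Rightarrow> (nat \<Rightarrow> 's \<Rightarrow> real ^ 'n)
      \<Rightarrow> (nat \<Rightarrow> real ^ 'n ^ 'n) \<Rightarrow> (nat \<Rightarrow> real ^ 'm ^ 'm) \<Rightarrow> (nat \<Rightarrow> real ^ 'n ^ 'm) \<Rightarrow> nat \<Rightarrow> real" where
  "regret M A B x1 w Q R K T =
     (\<Sum>t=1..T. stage_cost M A B x1 w Q R K t)
     - (INF K'\<in>stable_policies A B. \<Sum>t=1..T. stage_cost M A B x1 w Q R (\<lambda>_. K') t)"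


section \<open>The online Riccati update\<close>

primrec running_average :: "(nat \<Rightarrow> 'a :: real_vector) \<Rightarrow> nat \<Rightarrow> 'a" where
  "running_average F 0 = 0"
| "running_average F (Suc t) =
     (real t / real (Suc t)) *\<^sub>R running_average F t + (1 / real (Suc t)) *\<^sub>R F (Suc t)"

definition solves_lyapunov ::
    "real ^ 'n ^ 'n \<Rightarrow> real ^ 'm ^ 'n \<Rightarrow> real ^ 'n ^ 'n \<Rightarrow> real ^ 'm ^ 'm \<Rightarrow> real ^ 'n ^ 'm
      \<Rightarrow> real ^ 'n ^ 'n \<Rightarrow> bool" where
  "solves_lyapunov A B Q R K P \<longleftrightarrow>
     P = transpose (A - B ** K) ** P ** (A - B ** K) + Q + transpose K ** R ** K"

definition improved_policy ::
    "real ^ 'n ^ 'n \<Rightarrow> real ^ 'm ^ 'n \<Rightarrow> real ^ 'm ^ 'm \<Rightarrow> real ^ 'n ^ 'n \<Rightarrow> real ^ 'n ^ 'm" where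
  "improved_policy A B R P = matrix_inv (transpose B ** P ** B + R) ** transpose B ** P ** A"

definition reset_time :: "real ^ 'm ^ 'n \<Rightarrow> real \<Rightarrow> real \<Rightarrow> real \<Rightarrow> real \<Rightarrow> nat" where
  "reset_time B \<mu> \<sigma> \<kappa> \<gamma> =
     nat \<lceil>4 * \<kappa> ^ 3 * op_norm B / (\<gamma> * \<mu>)
          * (2 * \<sigma> * \<kappa> + 2 * \<kappa> ^ 3 * op_norm B * \<sigma> * (1 + \<kappa> ^ 2) / \<gamma>) + 1\<rceil>"

definition reset_tolerance :: "real ^ 'm ^ 'n \<Rightarrow> real \<Rightarrow> real \<Rightarrow> real \<Rightarrow> real \<Rightarrow> real" where
  "reset_tolerance B \<mu> \<sigma> \<kappa> \<gamma> =
     (2 * \<sigma> / op_norm B + 4 * \<kappa> ^ 2 * \<sigma> * (1 + \<kappa> ^ 2) / \<gamma>) / real (reset_time B \<mu> \<sigma> \<kappa> \<gamma>)"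

text \<open>\<open>policy_iteration A B Q R \<epsilon> K\<^sub>0 P\<close>: policy iteration for the fixed costs \<open>Q\<close>, \<open>R\<close>, started from
  \<open>K\<^sub>0\<close> and stopped at the first index \<open>l \<ge> 1\<close> at which consecutive values differ by at most \<open>\<epsilon>\<close>,
  returns \<open>P\<close>.\<close>

definition policy_iteration ::
    "real ^ 'n ^ 'n \<Rightarrow> real ^ 'm ^ 'n \<Rightarrow> real ^ 'n ^ 'n \<Rightarrow> real ^ 'm ^ 'm \<Rightarrow> real \<Rightarrow> real ^ 'n ^ 'm
      \<Rightarrow> real ^ 'n ^ 'n \<Rightarrow> bool" where
  "policy_iteration A B Q R \<epsilon> K\<^sub>0 P \<longleftrightarrow>
     (\<exists>Kh Ph (l :: nat). Kh 0 = K\<^sub>0 \<and> solves_lyapunov A B Q R (Kh 0) (Ph 0) \<and>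
        (\<forall>j\<in>{1..l}. Kh j = improved_policy A B R (Ph (j - 1)) \<and>
                     solves_lyapunov A B Q R (Kh j) (Ph j)) \<and>
        l \<ge> 1 \<and> op_norm (Ph l - Ph (l - 1)) \<le> \<epsilon> \<and>
        (\<forall>j\<in>{1..<l}. \<not> op_norm (Ph j - Ph (j - 1)) \<le> \<epsilon>) \<and>
        P = Ph l)"

text \<open>At the reset time, \<open>P t\<close> is the redefined matrix. Indices start at 1. For positive definite costs,
  all policies occurring in a run are stable, as \<open>K 1\<close> is, so the Lyapunov equations determine their
  solutions uniquely.\<close>

definition online_riccati_update ::
    "real ^ 'n ^ 'n \<Rightarrow> real ^ 'm ^ 'n \<Rightarrow> (nat \<Rightarrow> real ^ 'n ^ 'n) \<Rightarrow> (nat \<Rightarrow> real ^ 'm ^ 'm)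
      \<Rightarrow> real \<Rightarrow> real \<Rightarrow> real \<Rightarrow> real \<Rightarrow> (nat \<Rightarrow> real ^ 'n ^ 'm) \<Rightarrow> (nat \<Rightarrow> real ^ 'n ^ 'n) \<Rightarrow> bool" where
  "online_riccati_update A B Q R \<mu> \<sigma> \<kappa> \<gamma> K P \<longleftrightarrow>
     stable_policy A B (K 1) \<and>
     (\<forall>t\<ge>1.
        (if t = reset_time B \<mu> \<sigma> \<kappa> \<gamma>
         then policy_iteration A B (running_average Q t) (running_average R t)
                (reset_tolerance B \<mu> \<sigma> \<kappa> \<gamma>) (K t) (P t)
         else solves_lyapunov A B (running_average Q t) (running_average R t) (K t) (P t)) \<and>
        K (t + 1) = improved_policy A B (running_average R t) (P t))"

end

theory Submission
  imports Defs "HOL-Computational_Algebra.Fundamental_Theorem_Algebra"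
begin

text \<open>
  All costs are quadratic forms paired with second moment matrices of the state, and these obey
  \<open>X (t + 1) = L X t L\<^sup>T + W\<close> with the closed loop \<open>L = A - B K\<close>. The proof compares both the cost of the
  run and the cost of every fixed stable policy with the number \<open>T \<langle>P T, W\<rangle>\<close>: the former exceeds it by at
  most \<open>O(log T)\<close>, the latter falls short of it by at most \<open>O(1)\<close>, uniformly in the policy.

  \<^emph>\<open>Tracking.\<close> One step of the update is a step of policy improvement for the running averages of the
  costs. It contracts the excess of \<open>P t\<close> over the optimal (Riccati) value of these averages by the factor
  \<open>1 - \<mu> / \<nu>\<close> (\<open>gap_contraction\<close>), while the averages change only by factors \<open>1 + O(1 / t)\<close>. Hence \<open>P t\<close> is
  optimal up to a factor \<open>1 + O(1 / t)\<close> (\<open>value_near_optimal\<close>), so \<open>P t\<close> and \<open>K t\<close> move by \<open>O(1 / t)\<close>. The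
  Bellman loss of an improvement step is quadratic in the change of the policy, thus \<open>O(1 / t\<^sup>2)\<close>
  (\<open>improvement_gap\<close>). The reset happens at a single time and preserves stability, so the analysis
  starts after it.

  \<^emph>\<open>The run\<close> (\<open>run_cost_upper\<close>). Put \<open>N t = t P t - (t - 1) P (t - 1)\<close>. By the Lyapunov equations at
  \<open>t\<close> and \<open>t - 1\<close>, the stage cost at time \<open>t\<close> is \<open>N t - L\<^sup>T (N t) L\<close> up to \<open>t\<close> times the improvement loss.
  Paired with the moments, the noise part of this telescopes to \<open>T \<langle>P T, W\<rangle>\<close>, and there remain errors of size
  \<open>1 / t\<close> and the pairings of the bounded forms \<open>N t\<close> with the increments of the moments. The increments
  have size \<open>1 / t\<close> in a summed sense, because the closed loops are stable with the slowly varying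
  Lyapunov functions \<open>P t\<close> (\<open>increments_dominated\<close>).

  \<^emph>\<open>Fixed policies\<close> (\<open>fixed_policy_lower\<close>). A competing policy may be arbitrarily close to instability,
  and its moments may drift during the whole horizon. The moments are therefore expanded by the age of
  the noise. For the noise of age below some \<open>m\<close>, at most a fixed fraction of \<open>T\<close>, the costs can be averaged over time,
  with an error that is absorbed by the suboptimality of the policy; the value remaining at age \<open>m\<close> is
  \<open>O(1 / T)\<close> for a suitable \<open>m\<close>, unless the policy already costs at least \<open>T \<langle>P T, W\<rangle>\<close>.

  Probability enters only through the recursion of the second moments (\<open>second_moment_step\<close>).
\<close>

section \<open>Quadratic forms\<close>

definition qf :: "real ^ 'n ^ 'n \<Rightarrow> real ^ 'n \<Rightarrow> real" where
  "qf S x = x \<bullet> (S *v x)"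

lemma inner_transpose_matrix: "x \<bullet> (transpose L *v y) = (L *v x) \<bullet> y"
  for L :: "real ^ 'n ^ 'm"
  by (metis dot_lmul_matrix inner_commute transpose_matrix_vector)

lemma inner_matrix_sym: "transpose S = S \<Longrightarrow> x \<bullet> (S *v y) = y \<bullet> (S *v x)"
  for S :: "real ^ 'n ^ 'n"
  by (metis inner_transpose_matrix inner_commute)

lemma qf_add: "qf (S + S') x = qf S x + qf S' x"
  by (simp add: qf_def matrix_vector_mult_add_rdistrib inner_add_right)

lemma qf_diff: "qf (S - S') x = qf S x - qf S' x"
  by (simp add: qf_def matrix_vector_mult_diff_rdistrib inner_diff_right)

lemma qf_scaleR: "qf (c *\<^sub>R S) x = c * qf S x"
  by (simp add: qf_def scaleR_matrix_vector_assoc[symmetric])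

lemma qf_mat_1: "qf (mat 1) x = (norm x)\<^sup>2"
  by (simp add: qf_def power2_norm_eq_inner)

lemma qf_scaleR_right: "qf S (c *\<^sub>R x) = c\<^sup>2 * qf S x"
  by (simp add: qf_def matrix_vector_mult_scaleR power2_eq_square)

lemma qf_congruence: "qf (transpose L ** S ** L) x = qf S (L *v x)"
  for L :: "real ^ 'n ^ 'm"
  by (simp add: qf_def matrix_vector_mul_assoc[symmetric] inner_transpose_matrix del: transpose_matrix_vector)

lemma qf_add_right:
  "transpose S = S \<Longrightarrow> qf S (x + y) = qf S x + 2 * (y \<bullet> (S *v x)) + qf S y"
  by (simp add: qf_def matrix_vector_right_distrib inner_add_left inner_add_right
      inner_matrix_sym[of S x y])

lemma norm_matrix_vector_mult_le: "norm (L *v x) \<le> norm L * norm x"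
  for L :: "real ^ 'n ^ 'm"
proof -
  have "norm (L *v x) \<le> L2_set (\<lambda>i. norm (L $ i) * norm x) UNIV"
    unfolding norm_vec_def[of "L *v x"]
    by (intro L2_set_mono) (auto simp: matrix_vector_mul_component Cauchy_Schwarz_ineq2)
  also have "\<dots> = norm L * norm x"
    by (simp add: norm_vec_def[of L] L2_set_left_distrib)
  finally show ?thesis .
qed

lemma qf_sum_entries: "qf S x = (\<Sum>i\<in>UNIV. \<Sum>j\<in>UNIV. x $ i * x $ j * S $ i $ j)"
  by (simp add: qf_def inner_vec_def matrix_vector_mult_def sum_distrib_left mult_ac)

lemma inner_axis_matrix: "axis i 1 \<bullet> (S *v axis j 1) = S $ i $ j"
  for S :: "real ^ 'n ^ 'm"
  by (simp add: inner_axis' matrix_vector_mult_basis column_def)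

lemma trace_eq_sum_qf: "trace S = (\<Sum>i\<in>UNIV. qf S (axis i 1))"
  by (simp add: trace_def qf_def inner_axis_matrix)

text \<open>The off-diagonal terms of a nonnegative form are dominated by its diagonal, by evaluating the form
  at differences of two coordinate vectors.\<close>

lemma qf_le_trace:
  fixes S :: "real ^ 'n ^ 'n"
  assumes "\<And>x. 0 \<le> qf S x"
  shows "qf S x \<le> CARD('n) * trace S * (norm x)\<^sup>2"
proof -
  have diag: "0 \<le> S $ i $ i" for i
    using assms[of "axis i 1"] by (simp add: qf_def inner_axis_matrix)
  have off: "x $ i * x $ j * S $ i $ j + x $ j * x $ i * S $ j $ i
      \<le> (x $ i)\<^sup>2 * S $ i $ i + (x $ j)\<^sup>2 * S $ j $ j" for i j
    using assms[of "x $ i *\<^sub>R axis i 1 - x $ j *\<^sub>R axis j 1"]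
    by (simp add: qf_def matrix_vector_mult_diff_distrib matrix_vector_mult_scaleR inner_diff_left
        inner_diff_right inner_axis_matrix power2_eq_square algebra_simps)
  have "2 * qf S x = (\<Sum>i\<in>UNIV. \<Sum>j\<in>UNIV. x $ i * x $ j * S $ i $ j)
      + (\<Sum>i\<in>UNIV. \<Sum>j\<in>UNIV. x $ j * x $ i * S $ j $ i)"
    unfolding qf_sum_entries by (subst (3) sum.swap) simp
  also have "\<dots> \<le> (\<Sum>i\<in>UNIV. \<Sum>j\<in>(UNIV::'n set). (x $ i)\<^sup>2 * S $ i $ i + (x $ j)\<^sup>2 * S $ j $ j)"
    unfolding sum.distrib[symmetric] by (intro sum_mono off)
  also have "\<dots> = 2 * (CARD('n) * (\<Sum>i\<in>UNIV. (x $ i)\<^sup>2 * S $ i $ i))"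
    by (simp add: sum.distrib sum_distrib_left)
  also have "(\<Sum>i\<in>UNIV. (x $ i)\<^sup>2 * S $ i $ i) \<le> (\<Sum>i\<in>UNIV. (norm x)\<^sup>2 * S $ i $ i)"
    by (intro sum_mono mult_right_mono diag)
      (metis component_le_norm_cart abs_norm_cancel power2_le_iff_abs_le norm_ge_zero)
  also have "(\<Sum>i\<in>UNIV. (norm x)\<^sup>2 * S $ i $ i) = trace S * (norm x)\<^sup>2"
    by (simp add: trace_def sum_distrib_left mult_ac)
  finally show ?thesis
    by (simp add: mult_left_mono mult_ac)
qed

text \<open>Polarization with two coordinate vectors recovers each entry of a symmetric matrix from its form.\<close>

lemma norm_le_of_qf_bound:
  fixes S :: "real ^ 'n ^ 'n"
  assumes sym: "transpose S = S" and bd: "\<And>x. \<bar>qf S x\<bar> \<le> c * (norm x)\<^sup>2"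
  shows "norm S \<le> (real CARD('n))\<^sup>2 * c"
proof -
  have entry: "\<bar>S $ i $ j\<bar> \<le> c" for i j
  proof -
    let ?p = "axis i 1 + axis j 1 :: real ^ 'n" and ?m = "axis i 1 + (- axis j 1) :: real ^ 'n"
    have "4 * S $ i $ j = qf S ?p - qf S ?m"
      unfolding qf_add_right[OF sym]
      using qf_scaleR_right[of S "-1" "axis j 1"] inner_axis_matrix[of j S i]
        inner_matrix_sym[OF sym, of "axis i 1" "axis j 1"] inner_axis_matrix[of i S j]
      by simp
    moreover have "(norm ?p)\<^sup>2 + (norm ?m)\<^sup>2 = 4"
      unfolding power2_norm_eq_inner
      by (simp add: inner_add_left inner_add_right inner_diff_left inner_diff_right inner_commute)
    ultimately show ?thesis
      using bd[of ?p] bd[of ?m] distrib_left[of c "(norm ?p)\<^sup>2" "(norm ?m)\<^sup>2"] by simp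
  qed
  have "norm S \<le> (\<Sum>i\<in>UNIV. norm (S $ i))"
    unfolding norm_vec_def[of S] by (rule L2_set_le_sum) simp
  also have "\<dots> \<le> (\<Sum>i\<in>(UNIV::'n set). CARD('n) * c)"
  proof (rule sum_mono)
    fix i
    have "norm (S $ i) \<le> (\<Sum>j\<in>UNIV. \<bar>S $ i $ j\<bar>)" by (rule norm_le_l1_cart)
    also have "\<dots> \<le> (\<Sum>j\<in>(UNIV::'n set). c)" by (intro sum_mono entry)
    finally show "norm (S $ i) \<le> CARD('n) * c" by simp
  qed
  finally show ?thesis by (simp add: power2_eq_square mult_ac)
qed

lemma invertible_of_qf_ge:
  fixes H :: "real ^ 'n ^ 'n"
  assumes "\<mu> > 0" "\<And>x. \<mu> * (norm x)\<^sup>2 \<le> qf H x"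
  shows "H ** matrix_inv H = mat 1"
proof -
  have "x = 0" if "H *v x = 0" for x
    using assms(2)[of x] assms(1) that
    by (simp add: qf_def) (metis mult_pos_pos norm_eq_zero not_less zero_less_power zero_less_norm_iff)
  then have "invertible H"
    using invertible_left_inverse matrix_left_invertible_ker by blast
  then have "H ** matrix_inv H = mat 1 \<and> matrix_inv H ** H = mat 1"
    unfolding matrix_inv_def invertible_def by (rule someI_ex)
  then show ?thesis ..
qed

lemma coercive_norm_le:
  fixes H :: "real ^ 'n ^ 'n"
  assumes "\<And>x. \<mu> * (norm x)\<^sup>2 \<le> qf H x"
  shows "\<mu> * norm x \<le> norm (H *v x)"
proof (cases "x = 0")
  case False
  have "\<mu> * (norm x)\<^sup>2 \<le> norm x * norm (H *v x)"
    using assms[of x] norm_cauchy_schwarz[of x "H *v x"] unfolding qf_def by linarith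
  with False show ?thesis by (simp add: power2_eq_square mult.left_commute)
qed simp


lemma matrix_mult_add_middle: "L ** (X + Y) ** N = L ** X ** N + L ** Y ** N"
  for L :: "real ^ 'n ^ 'm"
  by (simp add: matrix_matrix_mult_def vec_eq_iff sum.distrib algebra_simps)

lemma matrix_mult_diff_middle: "L ** (X - Y) ** N = L ** X ** N - L ** Y ** N"
  for L :: "real ^ 'n ^ 'm"
  by (simp add: matrix_matrix_mult_def vec_eq_iff sum_subtractf algebra_simps)


section \<open>Pairing forms with second moments\<close>

text \<open>If \<open>X\<close> is the second moment matrix of a random vector, pairing \<open>S\<close> with \<open>X\<close> is the mean of the
  quadratic form of \<open>S\<close>.\<close>

definition pairing :: "real ^ 'n ^ 'n \<Rightarrow> real ^ 'n ^ 'n \<Rightarrow> real" where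
  "pairing S X = trace (S ** X)"

text \<open>The cone dual to the nonnegative forms. It contains all second moment matrices; being defined by
  duality, it makes monotonicity of the pairing immediate, without a factorization of the matrices.\<close>

definition moment_cone :: "(real ^ 'n ^ 'n) set" where
  "moment_cone = {X. \<forall>S. (\<forall>x. 0 \<le> qf S x) \<longrightarrow> 0 \<le> pairing S X}"

lemma trace_scaleR: "trace (c *\<^sub>R S) = c * trace (S :: real ^ 'n ^ 'n)"
  by (simp add: trace_def sum_distrib_left)

lemma pairing_add_left: "pairing (S + S') X = pairing S X + pairing S' X"
  by (simp add: pairing_def trace_def matrix_matrix_mult_def sum.distrib distrib_right)
lemma pairing_add_right: "pairing S (X + X') = pairing S X + pairing S X'"
  by (simp add: pairing_def matrix_add_ldistrib trace_add)
lemma pairing_scaleR_left: "pairing (c *\<^sub>R S) X = c * pairing S X"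
  by (simp add: pairing_def scalar_matrix_assoc[symmetric] trace_scaleR)
lemma pairing_scaleR_right: "pairing S (c *\<^sub>R X) = c * pairing S X"
  by (simp add: pairing_def matrix_scalar_ac scalar_matrix_assoc[symmetric] trace_scaleR)
lemma pairing_diff_left: "pairing (S - S') X = pairing S X - pairing S' X"
  using pairing_add_left[of S "(-1) *\<^sub>R S'" X] pairing_scaleR_left[of "-1" S' X] by simp
lemma pairing_diff_right: "pairing S (X - X') = pairing S X - pairing S X'"
  using pairing_add_right[of S X "(-1) *\<^sub>R X'"] pairing_scaleR_right[of S "-1" X'] by simp
lemmas pairing_linear = pairing_add_left pairing_add_right pairing_scaleR_left
  pairing_scaleR_right pairing_diff_left pairing_diff_right

lemma pairing_sum_left: "pairing (sum S I) X = (\<Sum>i\<in>I. pairing (S i) X)"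
  using pairing_scaleR_left[of 0 0 X]
  by (induction I rule: infinite_finite_induct) (auto simp: pairing_add_left)
lemma pairing_sum_right: "pairing S (sum X I) = (\<Sum>i\<in>I. pairing S (X i))"
  using pairing_scaleR_right[of S 0 0]
  by (induction I rule: infinite_finite_induct) (auto simp: pairing_add_right)

lemma pairing_congruence:
  "pairing S (L ** X ** transpose L) = pairing (transpose L ** S ** L) X"
  unfolding pairing_def
  by (metis matrix_mul_assoc trace_mul_sym)

lemma pairing_identity: "pairing S (mat 1) = trace S"
  by (simp add: pairing_def)

lemma pairing_nonneg: "X \<in> moment_cone \<Longrightarrow> (\<And>x. 0 \<le> qf S x) \<Longrightarrow> 0 \<le> pairing S X"
  by (simp add: moment_cone_def)

lemma pairing_mono:
  assumes "X \<in> moment_cone" "\<And>x. qf S x \<le> qf S' x"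
  shows "pairing S X \<le> pairing S' X"
  using pairing_nonneg[OF assms(1), of "S' - S"] assms(2) by (simp add: qf_diff pairing_diff_left)

lemma pairing_le_trace:
  assumes "X \<in> moment_cone" "\<And>x. qf S x \<le> c * (norm x)\<^sup>2"
  shows "pairing S X \<le> c * trace X"
proof -
  have "pairing S X \<le> pairing (c *\<^sub>R mat 1) X"
    using assms by (intro pairing_mono) (auto simp: qf_scaleR qf_mat_1)
  then show ?thesis by (simp add: pairing_scaleR_left) (simp add: pairing_def)
qed

lemma trace_le_pairing:
  assumes "X \<in> moment_cone" "\<And>x. c * (norm x)\<^sup>2 \<le> qf S x"
  shows "c * trace X \<le> pairing S X"
proof -
  have "pairing (c *\<^sub>R mat 1) X \<le> pairing S X"
    using assms by (intro pairing_mono) (auto simp: qf_scaleR qf_mat_1)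
  then show ?thesis by (simp add: pairing_scaleR_left) (simp add: pairing_def)
qed

lemma moment_cone_add: "X \<in> moment_cone \<Longrightarrow> Y \<in> moment_cone \<Longrightarrow> X + Y \<in> moment_cone"
  by (simp add: moment_cone_def pairing_add_right)

lemma moment_cone_scaleR: "X \<in> moment_cone \<Longrightarrow> 0 \<le> c \<Longrightarrow> c *\<^sub>R X \<in> moment_cone"
  by (simp add: moment_cone_def pairing_scaleR_right)

lemma moment_cone_congruence: "X \<in> moment_cone \<Longrightarrow> L ** X ** transpose L \<in> moment_cone"
  by (simp add: moment_cone_def pairing_congruence qf_congruence)

lemma trace_nonneg: "X \<in> moment_cone \<Longrightarrow> 0 \<le> trace X"
  using trace_le_pairing[of X 0 "mat 1"] pairing_nonneg[of X "mat 1"]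
  by (simp add: qf_mat_1) (simp add: pairing_def)


section \<open>Spectral radius below one\<close>

text \<open>\<open>poly_at C p\<close> is the value of the polynomial \<open>p\<close> at the matrix \<open>C\<close>, acting on vectors.\<close>

definition poly_at :: "complex ^ 'n ^ 'n \<Rightarrow> complex poly \<Rightarrow> complex ^ 'n \<Rightarrow> complex ^ 'n" where
  "poly_at C p = fold_coeffs (\<lambda>a f v. a *s v + C *v f v) p (\<lambda>_. 0)"

lemma poly_at_0 [simp]: "poly_at C 0 v = 0"
  by (simp add: poly_at_def)

lemma poly_at_pCons [simp]: "poly_at C (pCons a p) v = a *s v + C *v poly_at C p v"
  by (cases "a = 0 \<and> p = 0") (auto simp: poly_at_def)

lemma poly_at_add: "poly_at C (p + q) v = poly_at C p v + poly_at C q v"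
  by (induction p q rule: poly_induct2)
    (simp_all add: matrix_vector_right_distrib vector_sadd_rdistrib)

lemma poly_at_smult: "poly_at C (smult c p) v = c *s poly_at C p v"
  by (induction p) (simp_all add: vector_scalar_commute vector_add_ldistrib vector_smult_assoc)

lemma poly_at_diff_arg: "poly_at C p (v - u) = poly_at C p v - poly_at C p u"
  by (induction p) (simp_all add: matrix_vector_mult_diff_distrib vector_ssub_ldistrib)

lemma poly_at_scale_arg: "poly_at C p (c *s v) = c *s poly_at C p v"
  by (induction p) (simp_all add: vector_scalar_commute vector_add_ldistrib vector_smult_assoc mult.commute)

lemma poly_at_mult_arg: "poly_at C p (C *v v) = C *v poly_at C p v"
  by (induction p) (simp_all add: vector_scalar_commute matrix_vector_right_distrib)

lemma poly_at_linear_factor: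
  "poly_at C ([:- c, 1:] * q) v = C *v poly_at C q v - c *s poly_at C q v"
proof -
  have "[:- c, 1:] * q = smult (- c) q + pCons 0 q" by simp
  then have "poly_at C ([:- c, 1:] * q) v = (- c) *s poly_at C q v + C *v poly_at C q v"
    by (simp only: poly_at_add poly_at_smult poly_at_pCons vector_smult_lzero add_0_left)
  then show ?thesis by (simp add: vec_eq_iff)
qed

lemma poly_at_eigenvector: "C *v v = c *s v \<Longrightarrow> poly_at C p v = poly p c *s v"
  by (induction p) (simp_all add: vector_scalar_commute vector_sadd_rdistrib vector_smult_assoc mult.commute)

lemma poly_at_monom: "poly_at C (monom a k) v = a *s (((*v) C ^^ k) v)"
  by (induction k) (simp_all add: monom_0 monom_Suc vector_scalar_commute)

lemma poly_at_sum: "poly_at C (sum p I) v = (\<Sum>i\<in>I. poly_at C (p i) v)"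
  by (induction I rule: infinite_finite_induct) (simp_all add: poly_at_add)

text \<open>The powers of a matrix lie in a finite-dimensional space, so some power depends linearly on the
  preceding ones.\<close>

lemma annihilating_polynomial:
  fixes C :: "complex ^ 'n ^ 'n"
  obtains p where "p \<noteq> 0" "\<And>v. poly_at C p v = 0"
proof -
  define f where "f k = ((\<lambda>X. C ** X) ^^ k) (mat 1)" for k
  have f: "f k *v v = ((*v) C ^^ k) v" for k v
  proof (induction k)
    case (Suc k)
    have "f (Suc k) = C ** f k" by (simp add: f_def)
    then show ?case
      unfolding funpow.simps o_apply Suc.IH[symmetric] by (metis matrix_vector_mul_assoc)
  qed (simp add: f_def)
  have "\<exists>k. f k \<in> span (f ` {..<k})"
  proof (rule ccontr)
    assume not: "\<nexists>k. f k \<in> span (f ` {..<k})"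
    have "independent (f ` {..<k}) \<and> card (f ` {..<k}) = k" for k
    proof (induction k)
      case (Suc k)
      have ns: "f k \<notin> span (f ` {..<k})" using not by simp
      then have "f k \<notin> f ` {..<k}" by (metis span_base)
      with Suc ns show ?case
        by (simp add: lessThan_Suc independent_insert)
    qed (simp add: independent_empty)
    from this[of "Suc (DIM(complex ^ 'n ^ 'n))"] show False
      using independent_bound[of "f ` {..<Suc (DIM(complex ^ 'n ^ 'n))}"] by simp
  qed
  then obtain k where k: "f k \<in> span (f ` {..<k})" by blast
  have sub: "subspace (range (\<lambda>c. \<Sum>i<k. c i *\<^sub>R f i))"
  proof (rule subspaceI)
    show "0 \<in> range (\<lambda>c. \<Sum>i<k. c i *\<^sub>R f i)"
      by (rule range_eqI[of _ _ "\<lambda>_. 0"]) simp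
  next
    fix x y assume "x \<in> range (\<lambda>c. \<Sum>i<k. c i *\<^sub>R f i)" "y \<in> range (\<lambda>c. \<Sum>i<k. c i *\<^sub>R f i)"
    then obtain c d where "x = (\<Sum>i<k. c i *\<^sub>R f i)" "y = (\<Sum>i<k. d i *\<^sub>R f i)" by blast
    then show "x + y \<in> range (\<lambda>c. \<Sum>i<k. c i *\<^sub>R f i)"
      by (intro range_eqI[of _ _ "\<lambda>i. c i + d i"]) (simp add: scaleR_add_left sum.distrib)
  next
    fix a x assume "x \<in> range (\<lambda>c. \<Sum>i<k. c i *\<^sub>R f i)"
    then obtain c where "x = (\<Sum>i<k. c i *\<^sub>R f i)" by blast
    then show "a *\<^sub>R x \<in> range (\<lambda>c. \<Sum>i<k. c i *\<^sub>R f i)"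
      by (intro range_eqI[of _ _ "\<lambda>i. a * c i"]) (simp add: scaleR_sum_right)
  qed
  have "span (f ` {..<k}) \<subseteq> range (\<lambda>c. \<Sum>i<k. c i *\<^sub>R f i)"
  proof (rule span_minimal[OF _ sub], safe)
    fix j assume "j < k"
    then show "f j \<in> range (\<lambda>c. \<Sum>i<k. c i *\<^sub>R f i)"
      by (intro range_eqI[of _ _ "\<lambda>i. if i = j then 1 else 0"]) (simp add: if_distrib[of "\<lambda>c. c *\<^sub>R _"] cong: if_cong)
  qed
  with k obtain c where c: "f k = (\<Sum>i<k. c i *\<^sub>R f i)" by blast
  define p where "p = monom 1 k + (\<Sum>i<k. monom (- complex_of_real (c i)) i)"
  have "coeff p k = 1"
    by (simp add: p_def coeff_sum)
  then have "p \<noteq> 0" by auto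
  moreover have "poly_at C p v = 0" for v
  proof -
    have smul: "(a *\<^sub>R X) *v v = complex_of_real a *s (X *v v)" for a and X :: "complex ^ 'n ^ 'n"
      by (simp add: vec_eq_iff matrix_vector_mult_def sum_distrib_left scaleR_conv_of_real[where 'a = complex] mult_ac)
    have sm: "(\<Sum>i\<in>I. g i) *v v = (\<Sum>i\<in>I. g i *v v)" for I and g :: "nat \<Rightarrow> complex ^ 'n ^ 'n"
      by (induction I rule: infinite_finite_induct) (simp_all add: matrix_vector_mult_add_rdistrib)
    have "f k *v v = (\<Sum>i<k. complex_of_real (c i) *s (f i *v v))"
      by (simp add: c sm smul)
    then show ?thesis
      by (simp add: p_def poly_at_add poly_at_sum poly_at_monom f sum_negf)
  qed
  ultimately show thesis by (rule that)
qed

text \<open>The spectral radius is a maximum over a set, so that it bounds the eigenvalues only once this set is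
  known to be finite: all eigenvalues are roots of an annihilating polynomial.\<close>

lemma finite_complex_eigenvalues: "finite (complex_eigenvalues L)"
proof -
  obtain p where p: "p \<noteq> 0" "\<And>v. poly_at (map_matrix complex_of_real L) p v = 0"
    using annihilating_polynomial by blast
  have "complex_eigenvalues L \<subseteq> {z. poly p z = 0}"
  proof
    fix z assume "z \<in> complex_eigenvalues L"
    then obtain v where "v \<noteq> 0" "map_matrix complex_of_real L *v v = z *s v"
      by (auto simp: complex_eigenvalues_def)
    with p(2)[of v] show "z \<in> {z. poly p z = 0}" by (simp add: poly_at_eigenvector)
  qed
  then show ?thesis using poly_roots_finite[OF p(1)] finite_subset by blast
qed

lemma cmod_eigenvalue_le_spectral_radius: "z \<in> complex_eigenvalues L \<Longrightarrow> cmod z \<le> spectral_radius L"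
  unfolding spectral_radius_def by (intro Max_ge finite_imageI finite_complex_eigenvalues imageI)

lemma norm_vector_scalar_mult: "norm (c *s v) = cmod c * norm v" for v :: "complex ^ 'n"
  by (simp add: norm_vec_def L2_set_def norm_mult power_mult_distrib sum_distrib_left[symmetric] real_sqrt_mult)

text \<open>Factor the annihilating polynomial. A root that is an eigenvalue has modulus below 1, and peeling
  it off gives a scalar recursion with a contracting coefficient and a summable input; a root that is not
  an eigenvalue can be cancelled.\<close>

lemma summable_powers_of_poly_at:
  fixes C :: "complex ^ 'n ^ 'n"
  assumes ev: "\<And>c v. v \<noteq> 0 \<Longrightarrow> C *v v = c *s v \<Longrightarrow> cmod c < 1"
  assumes "p \<noteq> 0" "poly_at C p v = 0"
  shows "summable (\<lambda>k. norm (((*v) C ^^ k) v))"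
  using assms(2,3)
proof (induction "degree p" arbitrary: p v)
  case 0
  then obtain a where "p = [:a:]" "a \<noteq> 0" by (metis degree_eq_zeroE pCons_eq_0_iff)
  with 0 have "v = 0" by (simp add: vec_eq_iff)
  moreover have "((*v) C ^^ k) 0 = 0" for k by (induction k) auto
  ultimately show ?case by simp
next
  case (Suc d)
  obtain c where "poly p c = 0"
    using fundamental_theorem_of_algebra[of p] Suc.hyps(2) constant_degree[of p] by auto
  then obtain q where q: "p = [:- c, 1:] * q" using poly_eq_0_iff_dvd by (auto simp: dvd_def)
  have "q \<noteq> 0" using Suc.prems q by auto
  have deg: "d = degree q" using Suc.hyps(2) \<open>q \<noteq> 0\<close> unfolding q by (subst (asm) degree_mult_eq) auto
  have eq: "C *v poly_at C q v = c *s poly_at C q v"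
    using Suc.prems(2) unfolding q poly_at_linear_factor by simp
  show ?case
  proof (cases "poly_at C q v = 0")
    case True
    then show ?thesis using Suc.hyps(1)[OF deg \<open>q \<noteq> 0\<close>] by blast
  next
    case False
    have c1: "cmod c < 1" using ev[OF False eq] .
    define x where "x k = ((*v) C ^^ k) v" for k
    define u where "u = C *v v - c *s v"
    have "poly_at C q u = 0"
      using eq by (simp add: u_def poly_at_diff_arg poly_at_scale_arg poly_at_mult_arg)
    from Suc.hyps(1)[OF deg \<open>q \<noteq> 0\<close> this]
    have sm: "summable (\<lambda>k. norm (((*v) C ^^ k) u))" .
    define U where "U = (\<Sum>k. norm (((*v) C ^^ k) u))"
    have step: "x (Suc k) = c *s x k + ((*v) C ^^ k) u" for k
    proof -
      have "((*v) C ^^ k) (C *v v) = c *s ((*v) C ^^ k) v + ((*v) C ^^ k) (C *v v - c *s v)"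
        by (induction k) (simp_all add: matrix_vector_right_distrib[symmetric] vector_scalar_commute[symmetric])
      then show ?thesis by (simp add: x_def u_def funpow_swap1)
    qed
    have bound: "(\<Sum>k<n. norm (x k)) \<le> (norm (x 0) + U) / (1 - cmod c)" for n
    proof -
      have "(\<Sum>k<n. norm (x k)) \<le> (\<Sum>k<Suc n. norm (x k))" by simp
      also have "\<dots> = norm (x 0) + (\<Sum>k<n. norm (x (Suc k)))" by (rule sum.lessThan_Suc_shift)
      also have "(\<Sum>k<n. norm (x (Suc k))) \<le> (\<Sum>k<n. cmod c * norm (x k) + norm (((*v) C ^^ k) u))"
        unfolding step norm_vector_scalar_mult[symmetric] by (intro sum_mono norm_triangle_ineq)
      also have "\<dots> = cmod c * (\<Sum>k<n. norm (x k)) + (\<Sum>k<n. norm (((*v) C ^^ k) u))"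
        by (simp add: sum.distrib sum_distrib_left)
      also have "(\<Sum>k<n. norm (((*v) C ^^ k) u)) \<le> U"
        unfolding U_def by (intro sum_le_suminf sm) auto
      finally have "(\<Sum>k<n. norm (x k)) * (1 - cmod c) \<le> norm (x 0) + U" by (simp add: algebra_simps)
      then show ?thesis using c1 by (simp add: pos_le_divide_eq)
    qed
    show ?thesis
      using bounded_imp_summable[of "\<lambda>k. norm (x k)" "(norm (x 0) + U) / (1 - cmod c)"] bound[of "Suc _"]
      unfolding x_def by (simp add: lessThan_Suc_atMost)
  qed
qed

text \<open>Stability in the form in which it is used: all trajectories of the linear system converge to 0.\<close>

definition power_stable :: "real ^ 'n ^ 'n \<Rightarrow> bool" where
  "power_stable L \<longleftrightarrow> (\<forall>x. (\<lambda>k. ((*v) L ^^ k) x) \<longlonglongrightarrow> 0)"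

lemma spectral_radius_less_one_imp_power_stable:
  fixes L :: "real ^ 'n ^ 'n"
  assumes "spectral_radius L < 1"
  shows "power_stable L"
  unfolding power_stable_def
proof
  fix x :: "real ^ 'n"
  define C where "C = map_matrix complex_of_real L"
  define \<iota> where "\<iota> y = (\<chi> i. complex_of_real (y $ i))" for y :: "real ^ 'n"
  have mult: "C *v \<iota> y = \<iota> (L *v y)" for y
    by (simp add: C_def \<iota>_def vec_eq_iff matrix_vector_mult_def map_matrix_def)
  have pow: "((*v) C ^^ k) (\<iota> y) = \<iota> (((*v) L ^^ k) y)" for k y
    by (induction k) (simp_all add: mult)
  have norm: "norm (\<iota> y) = norm y" for y
    by (simp add: \<iota>_def norm_vec_def)
  have ev: "cmod c < 1" if "v \<noteq> 0" "C *v v = c *s v" for c v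
    using that cmod_eigenvalue_le_spectral_radius[of c L] assms
    by (force simp: complex_eigenvalues_def C_def)
  obtain p where "p \<noteq> 0" "\<And>v. poly_at C p v = 0" using annihilating_polynomial by blast
  then have "summable (\<lambda>k. norm (((*v) C ^^ k) (\<iota> x)))"
    using summable_powers_of_poly_at[of C p "\<iota> x"] ev by blast
  then have "(\<lambda>k. norm (((*v) L ^^ k) x)) \<longlonglongrightarrow> 0"
    unfolding pow norm by (rule summable_LIMSEQ_zero)
  then show "(\<lambda>k. ((*v) L ^^ k) x) \<longlonglongrightarrow> 0" by (rule tendsto_norm_zero_cancel)
qed


section \<open>Lyapunov equations and policy improvement\<close>

lemma power_stable_nonneg:
  fixes L :: "real ^ 'n ^ 'n"
  assumes "power_stable L" "\<And>x. qf D (L *v x) \<le> qf D x"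
  shows "0 \<le> qf D x"
proof -
  have dec: "qf D (((*v) L ^^ k) x) \<le> qf D x" for k
  proof (induction k)
    case (Suc k)
    with assms(2)[of "((*v) L ^^ k) x"] show ?case by simp
  qed simp
  have "(\<lambda>k. ((*v) L ^^ k) x) \<longlonglongrightarrow> 0" using assms(1) by (simp add: power_stable_def)
  then have "(\<lambda>k. qf D (((*v) L ^^ k) x)) \<longlonglongrightarrow> 0 \<bullet> (D *v 0)"
    unfolding qf_def
    by (intro tendsto_inner bounded_linear.tendsto[OF matrix_vector_mul_bounded_linear])
  then have "(\<lambda>k. qf D (((*v) L ^^ k) x)) \<longlonglongrightarrow> 0" by simp
  then show ?thesis by (rule LIMSEQ_le_const2) (use dec in blast)
qed

text \<open>The decrements of the Lyapunov function along a trajectory have a bounded sum, so the squared norms of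
  the states are summable.\<close>

lemma power_stable_of_lyapunov_function:
  fixes L :: "real ^ 'n ^ 'n"
  assumes "\<mu> > 0" and nonneg: "\<And>x. 0 \<le> qf P x"
    and dec: "\<And>x. qf P (L *v x) + \<mu> * (norm x)\<^sup>2 \<le> qf P x"
  shows "power_stable L"
  unfolding power_stable_def
proof
  fix x
  let ?x = "\<lambda>k. ((*v) L ^^ k) x"
  have "(\<Sum>k<n. \<mu> * (norm (?x k))\<^sup>2) \<le> qf P x - qf P (?x n)" for n
  proof (induction n)
    case (Suc n)
    with dec[of "?x n"] show ?case by simp
  qed simp
  then have "(\<Sum>k\<le>n. \<mu> * (norm (?x k))\<^sup>2) \<le> qf P x" for n
    unfolding lessThan_Suc_atMost[symmetric]
    by (rule order_trans) (use nonneg[of "?x (Suc n)"] in simp)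
  then have "summable (\<lambda>k. \<mu> * (norm (?x k))\<^sup>2)"
    using assms(1) by (intro bounded_imp_summable[of _ "qf P x"]) auto
  then have "(\<lambda>k. \<mu> * (norm (?x k))\<^sup>2) \<longlonglongrightarrow> 0" by (rule summable_LIMSEQ_zero)
  from tendsto_mult_left[OF this, of "1 / \<mu>"] have "(\<lambda>k. (norm (?x k))\<^sup>2) \<longlonglongrightarrow> 0"
    using assms(1) by simp
  from tendsto_real_sqrt[OF this] have "(\<lambda>k. norm (?x k)) \<longlonglongrightarrow> 0" by simp
  then show "?x \<longlonglongrightarrow> 0" by (rule tendsto_norm_zero_cancel)
qed

text \<open>The antisymmetric part of a solution is invariant under the congruence by the stable closed loop, so it
  equals its limit 0.\<close>

lemma lyapunov_solution_symmetric:
  fixes L :: "real ^ 'n ^ 'n"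
  assumes "power_stable L" and eq: "P = transpose L ** P ** L + C" and "transpose C = C"
  shows "transpose P = P"
proof -
  define D where "D = transpose P - P"
  have tr: "transpose P = transpose L ** transpose P ** L + C"
  proof -
    have "transpose P = transpose (transpose L ** P ** L) + transpose C"
      by (subst eq) (simp add: transpose_def vec_eq_iff)
    then show ?thesis using assms(3) by (simp add: matrix_transpose_mul matrix_mul_assoc)
  qed
  have D: "D = transpose L ** D ** L"
  proof -
    have "transpose L ** D ** L = transpose L ** transpose P ** L - transpose L ** P ** L"
      unfolding D_def by (rule matrix_mult_diff_middle)
    moreover have "transpose P - P
        = (transpose L ** transpose P ** L + C) - (transpose L ** P ** L + C)"
      by (rule arg_cong2[OF tr eq])
    ultimately show ?thesis unfolding D_def by simp
  qed
  have inv: "u \<bullet> (D *v v) = ((*v) L ^^ k) u \<bullet> (D *v ((*v) L ^^ k) v)" for u v k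
  proof (induction k)
    case (Suc k)
    have "a \<bullet> (D *v b) = (L *v a) \<bullet> (D *v (L *v b))" for a b
      by (subst D) (simp add: matrix_vector_mul_assoc[symmetric] inner_transpose_matrix del: transpose_matrix_vector)
    with Suc show ?case by simp
  qed simp
  have "u \<bullet> (D *v v) = 0" for u v
  proof -
    have "(\<lambda>k. ((*v) L ^^ k) u \<bullet> (D *v ((*v) L ^^ k) v)) \<longlonglongrightarrow> 0 \<bullet> (D *v 0)"
      using assms(1) unfolding power_stable_def
      by (intro tendsto_inner bounded_linear.tendsto[OF matrix_vector_mul_bounded_linear]) auto
    then show ?thesis
      unfolding inv[of u v, symmetric] by (simp add: LIMSEQ_const_iff)
  qed
  then have "D = 0" by (metis inner_axis_matrix vec_eq_iff zero_index)
  then show ?thesis by (simp add: D_def)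
qed

text \<open>The cost of playing \<open>- k x\<close> for one step and then paying the quadratic terminal cost \<open>P\<close>.\<close>

definition bellman ::
  "real ^ 'n ^ 'n \<Rightarrow> real ^ 'm ^ 'n \<Rightarrow> real ^ 'n ^ 'n \<Rightarrow> real ^ 'm ^ 'm \<Rightarrow> real ^ 'n ^ 'n \<Rightarrow> real ^ 'n ^ 'm
    \<Rightarrow> real ^ 'n \<Rightarrow> real" where
  "bellman A B Q R P k x = qf P ((A - B ** k) *v x) + qf Q x + qf R (k *v x)"

lemma solves_lyapunov_bellman:
  assumes "solves_lyapunov A B Q R k P"
  shows "qf P x = bellman A B Q R P k x"
  by (subst assms[unfolded solves_lyapunov_def]) (simp add: bellman_def qf_add qf_congruence)

lemma transpose_add: "transpose (X + Y) = transpose X + transpose Y"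
  by (simp add: transpose_def vec_eq_iff)

lemma transpose_congruence:
  "transpose S = S \<Longrightarrow> transpose (transpose L ** S ** L) = transpose L ** S ** L"
  for L :: "real ^ 'n ^ 'm"
  by (simp add: matrix_transpose_mul matrix_mul_assoc)

lemma qf_bellman_hessian:
  "qf (transpose B ** P ** B + R) u = qf P (B *v u) + qf R u"
  by (simp add: qf_add qf_congruence)

lemma improved_policy_stationary:
  assumes "\<mu> > 0" "\<And>x. 0 \<le> qf P x" "\<And>u. \<mu> * (norm u)\<^sup>2 \<le> qf R u"
  shows "(transpose B ** P ** B + R) *v (improved_policy A B R P *v x) = transpose B *v (P *v (A *v x))"
proof -
  have "(transpose B ** P ** B + R) ** matrix_inv (transpose B ** P ** B + R) = mat 1"
    using assms by (intro invertible_of_qf_ge[of \<mu>]) (auto simp: qf_bellman_hessian add_increasing)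
  then have "(transpose B ** P ** B + R) ** improved_policy A B R P = transpose B ** P ** A"
    unfolding improved_policy_def by (metis matrix_mul_assoc matrix_mul_lid)
  then show ?thesis by (metis matrix_vector_mul_assoc)
qed

text \<open>The one-step cost is a quadratic function of the control whose stationary point is the improved
  policy, so it equals its minimum plus the Hessian at the deviation.\<close>

lemma bellman_complete_square:
  assumes "\<mu> > 0" "transpose P = P" "transpose R = R" "\<And>x. 0 \<le> qf P x" "\<And>u. \<mu> * (norm u)\<^sup>2 \<le> qf R u"
  shows "bellman A B Q R P k x = bellman A B Q R P (improved_policy A B R P) x
    + qf (transpose B ** P ** B + R) ((k - improved_policy A B R P) *v x)"
proof -
  let ?K = "improved_policy A B R P" and ?H = "transpose B ** P ** B + R"
  let ?u = "?K *v x" and ?d = "(k - ?K) *v x"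
  have k: "k *v x = ?u + ?d" by (simp add: matrix_vector_mult_diff_rdistrib)
  have Lk: "(A - B ** k) *v x = (A - B ** ?K) *v x + (- (B *v ?d))"
    by (simp add: matrix_vector_mult_diff_rdistrib matrix_vector_mult_diff_distrib
        matrix_vector_mul_assoc[symmetric])
  have stat: "?d \<bullet> (transpose B *v (P *v (A *v x))) = ?d \<bullet> (?H *v ?u)"
    by (simp only: improved_policy_stationary[OF assms(1,4,5)])
  have 1: "?d \<bullet> (transpose B *v (P *v (A *v x))) = (B *v ?d) \<bullet> (P *v (A *v x))"
    by (rule inner_transpose_matrix)
  have 2: "?d \<bullet> (?H *v ?u) = (B *v ?d) \<bullet> (P *v (B *v ?u)) + ?d \<bullet> (R *v ?u)"
    by (simp add: matrix_vector_mult_add_rdistrib matrix_vector_mul_assoc[symmetric] inner_add_right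
        inner_transpose_matrix del: transpose_matrix_vector)
  have cross: "(B *v ?d) \<bullet> (P *v ((A - B ** ?K) *v x)) = ?d \<bullet> (R *v ?u)"
    using stat unfolding 1 2
    by (simp add: matrix_vector_mult_diff_rdistrib matrix_vector_mult_diff_distrib
        matrix_vector_mul_assoc[symmetric] inner_diff_right)
  have "qf P ((A - B ** k) *v x) = qf P ((A - B ** ?K) *v x) - 2 * (?d \<bullet> (R *v ?u)) + qf P (B *v ?d)"
    unfolding Lk qf_add_right[OF assms(2)] using cross qf_scaleR_right[of P "-1" "B *v ?d"] by simp
  moreover have "qf R (k *v x) = qf R ?u + 2 * (?d \<bullet> (R *v ?u)) + qf R ?d"
    unfolding k by (rule qf_add_right[OF assms(3)])
  ultimately show ?thesis by (simp add: bellman_def qf_bellman_hessian)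
qed

lemma improved_policy_minimizes:
  assumes "\<mu> > 0" "transpose P = P" "transpose R = R" "\<And>x. 0 \<le> qf P x" "\<And>u. \<mu> * (norm u)\<^sup>2 \<le> qf R u"
  shows "bellman A B Q R P (improved_policy A B R P) x \<le> bellman A B Q R P k x"
proof -
  have "0 \<le> qf R u" for u
    using assms(5)[of u] assms(1) by (smt (verit) mult_nonneg_nonneg zero_le_power2)
  then show ?thesis
    unfolding bellman_complete_square[OF assms, of A B Q k x] by (simp add: qf_bellman_hessian assms(4))
qed

text \<open>For a stable policy the Lyapunov equation determines a symmetric solution, and summing the costs along
  the closed loop shows that it dominates the cost of the first step.\<close>

lemma policy_value_coercive:
  fixes A :: "real ^ 'n ^ 'n" and B :: "real ^ 'm ^ 'n"
  assumes "\<mu> > 0" "power_stable (A - B ** k)" "solves_lyapunov A B Q R k P"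
    and "transpose Q = Q" "transpose R = R" "\<And>x. \<mu> * (norm x)\<^sup>2 \<le> qf Q x" "\<And>u. 0 \<le> qf R u"
  shows "transpose P = P" "\<mu> * (norm x)\<^sup>2 \<le> qf P x"
proof -
  have "P = transpose (A - B ** k) ** P ** (A - B ** k) + (Q + transpose k ** R ** k)"
    using assms(3) unfolding solves_lyapunov_def by (simp only: add.assoc)
  then show "transpose P = P"
    by (rule lyapunov_solution_symmetric[OF assms(2)])
      (simp add: transpose_add transpose_congruence assms(4,5))
  have pos: "0 \<le> \<mu> * (norm y)\<^sup>2" for y :: "real ^ 'n" using assms(1) by simp
  have eq: "qf P x = qf P ((A - B ** k) *v x) + qf Q x + qf R (k *v x)" for x
    using solves_lyapunov_bellman[OF assms(3), of x] by (simp only: bellman_def)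
  have "0 \<le> qf P x" for x
  proof (rule power_stable_nonneg[OF assms(2)])
    fix y show "qf P ((A - B ** k) *v y) \<le> qf P y"
      using eq[of y] assms(6)[of y] assms(7)[of "k *v y"] pos[of y] by linarith
  qed
  from this[of "(A - B ** k) *v x"] show "\<mu> * (norm x)\<^sup>2 \<le> qf P x"
    using eq[of x] assms(6)[of x] assms(7)[of "k *v x"] by linarith
qed

text \<open>The value of the old policy is a Lyapunov function for the improved one.\<close>

lemma improved_policy_power_stable:
  assumes "\<mu> > 0" "transpose P = P" "transpose R = R" "\<And>x. 0 \<le> qf P x"
    and "\<And>u. \<mu> * (norm u)\<^sup>2 \<le> qf R u" "\<And>x. \<mu> * (norm x)\<^sup>2 \<le> qf Q x"
    and sol: "solves_lyapunov A B Q R k P"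
  shows "power_stable (A - B ** improved_policy A B R P)"
proof (rule power_stable_of_lyapunov_function[OF assms(1,4)])
  fix x
  let ?K = "improved_policy A B R P"
  have "0 \<le> qf R (?K *v x)"
    using assms(5)[of "?K *v x"] assms(1) by (smt (verit) mult_nonneg_nonneg zero_le_power2)
  moreover have "bellman A B Q R P ?K x \<le> qf P x"
    using improved_policy_minimizes[OF assms(1-5), of A B Q x k] solves_lyapunov_bellman[OF sol, of x]
    by simp
  ultimately show "qf P ((A - B ** ?K) *v x) + \<mu> * (norm x)\<^sup>2 \<le> qf P x"
    using assms(6)[of x] by (simp add: bellman_def)
qed

lemma policy_iteration_stable:
  fixes A :: "real ^ 'n ^ 'n" and B :: "real ^ 'm ^ 'n"
  assumes \<mu>: "\<mu> > 0" and Q: "transpose Q = Q" "\<And>x. \<mu> * (norm x)\<^sup>2 \<le> qf Q x"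
    and R: "transpose R = R" "\<And>u. \<mu> * (norm u)\<^sup>2 \<le> qf R u"
    and it: "policy_iteration A B Q R e k0 P" and k0: "power_stable (A - B ** k0)"
  obtains k where "power_stable (A - B ** k)" "solves_lyapunov A B Q R k P"
proof -
  have R0: "0 \<le> qf R u" for u
    using R(2)[of u] \<mu> by (smt (verit) mult_nonneg_nonneg zero_le_power2)
  have pos: "0 \<le> \<mu> * (norm y)\<^sup>2" for y :: "real ^ 'n" using \<mu> by simp
  obtain Kh Ph and l :: nat where h: "Kh 0 = k0" "solves_lyapunov A B Q R (Kh 0) (Ph 0)"
    "\<forall>j\<in>{1..l}. Kh j = improved_policy A B R (Ph (j - 1)) \<and> solves_lyapunov A B Q R (Kh j) (Ph j)"
    and P: "P = Ph l"
    using it unfolding policy_iteration_def by blast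
  have "j \<le> l \<Longrightarrow> power_stable (A - B ** Kh j) \<and> solves_lyapunov A B Q R (Kh j) (Ph j)" for j
  proof (induction j)
    case 0 then show ?case using h k0 by simp
  next
    case (Suc j)
    then have IH: "power_stable (A - B ** Kh j)" "solves_lyapunov A B Q R (Kh j) (Ph j)" by auto
    note val = policy_value_coercive[OF \<mu> IH Q(1) R(1) Q(2) R0]
    have "0 \<le> qf (Ph j) x" for x using val(2)[of x] pos[of x] by linarith
    from improved_policy_power_stable[OF \<mu> val(1) R(1) this R(2) Q(2) IH(2)]
    show ?case using bspec[OF h(3), of "Suc j"] Suc.prems by force
  qed
  from this[of l] show thesis using P that by blast
qed

lemma running_average_qf:
  assumes "\<And>t. t \<ge> 1 \<Longrightarrow> a \<le> qf (F t) x \<and> qf (F t) x \<le> b" "t \<ge> 1"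
  shows "a \<le> qf (running_average F t) x \<and> qf (running_average F t) x \<le> b"
  using assms(2)
proof (induction t)
  case (Suc t)
  have eq: "qf (running_average F (Suc t)) x
      = (real t / real (Suc t)) * qf (running_average F t) x + (1 / real (Suc t)) * qf (F (Suc t)) x"
    by (simp add: qf_add qf_scaleR)
  show ?case
  proof (cases "t = 0")
    case True then show ?thesis using assms(1)[of 1] eq by simp
  next
    case False
    with Suc have "a \<le> qf (running_average F t) x" "qf (running_average F t) x \<le> b" by auto
    moreover have "a \<le> qf (F (Suc t)) x" "qf (F (Suc t)) x \<le> b" using assms(1)[of "Suc t"] by auto
    moreover have "real t / real (Suc t) + 1 / real (Suc t) = 1" by (simp add: field_simps)
    ultimately show ?thesis
      unfolding eq
      using convex_bound_le[of "qf (running_average F t) x" b "qf (F (Suc t)) x" "real t / real (Suc t)" "1 / real (Suc t)"]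
        convex_bound_le[of "- qf (running_average F t) x" "-a" "- qf (F (Suc t)) x" "real t / real (Suc t)" "1 / real (Suc t)"]
      by simp
  qed
qed simp

lemma running_average_symmetric:
  assumes "\<And>t. t \<ge> 1 \<Longrightarrow> transpose (F t) = F t"
  shows "transpose (running_average F t) = running_average F t"
proof (induction t)
  case (Suc t)
  then show ?case using assms[of "Suc t"] by (simp add: transpose_add transpose_scalar)
qed (simp add: transpose_def vec_eq_iff)

lemma running_average_Suc: "real (Suc t) *\<^sub>R running_average F (Suc t) = real t *\<^sub>R running_average F t + F (Suc t)"
  by (simp add: scaleR_add_right)

lemma running_average_sum: "real t *\<^sub>R running_average F t = (\<Sum>s=1..t. F s)"
proof (induction t)
  case (Suc t) then show ?case unfolding running_average_Suc by simp
qed simp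


section \<open>The optimal value for fixed costs\<close>

lemma bounded_bilinear_matrix_vector_mult:
  "bounded_bilinear ((*v) :: real ^ 'n ^ 'm \<Rightarrow> real ^ 'n \<Rightarrow> real ^ 'm)"
proof
  show "\<exists>C. \<forall>(L :: real ^ 'n ^ 'm) x. norm (L *v x) \<le> norm L * norm x * C"
    by (intro exI[of _ 1]) (simp add: norm_matrix_vector_mult_le)
qed (simp_all add: matrix_vector_mult_add_rdistrib matrix_vector_right_distrib
    scaleR_matrix_vector_assoc[symmetric] matrix_vector_mult_scaleR)

lemmas continuous_on_matrix_vector_mult =
  bounded_bilinear.continuous_on[OF bounded_bilinear_matrix_vector_mult]

lemma continuous_on_qf:
  fixes S :: "'a :: topological_space \<Rightarrow> real ^ 'n ^ 'n"
  shows "continuous_on X S \<Longrightarrow> continuous_on X y \<Longrightarrow> continuous_on X (\<lambda>p. qf (S p) (y p))"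
  unfolding qf_def by (intro continuous_on_inner continuous_on_matrix_vector_mult)

lemma norm_matrix_le_of_bound:
  fixes k :: "real ^ 'n ^ 'm" and c :: real
  assumes "\<And>x. norm (k *v x) \<le> c * norm x"
  shows "norm k \<le> real CARD('m) * real CARD('n) * c"
proof -
  have entry: "\<bar>k $ i $ j\<bar> \<le> c" for i j
    using component_le_norm_cart[of "k *v axis j 1" i] assms[of "axis j 1"]
    by (simp add: matrix_vector_mult_basis column_def)
  have "norm k \<le> (\<Sum>i\<in>UNIV. norm (k $ i))"
    unfolding norm_vec_def[of k] by (rule L2_set_le_sum) simp
  also have "\<dots> \<le> (\<Sum>i\<in>(UNIV::'m set). real CARD('n) * c)"
  proof (rule sum_mono)
    fix i
    have "norm (k $ i) \<le> (\<Sum>j\<in>UNIV. \<bar>k $ i $ j\<bar>)" by (rule norm_le_l1_cart)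
    also have "\<dots> \<le> (\<Sum>j\<in>(UNIV::'n set). c)" by (intro sum_mono entry)
    finally show "norm (k $ i) \<le> CARD('n) * c" by simp
  qed
  finally show ?thesis by simp
qed

definition bellman_matrix ::
  "real ^ 'n ^ 'n \<Rightarrow> real ^ 'm ^ 'n \<Rightarrow> real ^ 'n ^ 'n \<Rightarrow> real ^ 'm ^ 'm \<Rightarrow> real ^ 'n ^ 'n \<Rightarrow> real ^ 'n ^ 'm
    \<Rightarrow> real ^ 'n ^ 'n" where
  "bellman_matrix A B Q R P k = transpose (A - B ** k) ** P ** (A - B ** k) + Q + transpose k ** R ** k"

lemma qf_bellman_matrix: "qf (bellman_matrix A B Q R P k) x = bellman A B Q R P k x"
  by (simp add: bellman_matrix_def bellman_def qf_add qf_congruence)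

lemma bellman_mono: "(\<And>x. qf P x \<le> qf P' x) \<Longrightarrow> bellman A B Q R P k x \<le> bellman A B Q R P' k x"
  by (simp add: bellman_def)

text \<open>A subsolution of a Bellman inequality lies below a supersolution for the same stable policy: the
  difference of the two forms decreases along the closed loop, which converges to 0. The factor \<open>r\<close> lets
  the two inequalities refer to different costs.\<close>

lemma bellman_comparison:
  assumes stab: "power_stable (A - B ** k)" and "0 \<le> r"
    and sub: "\<And>x. qf S x \<le> bellman A B Q R S k x"
    and super: "\<And>x. bellman A B Q' R' S' k x \<le> qf S' x"
    and cost: "\<And>x. qf Q x + qf R (k *v x) \<le> r * (qf Q' x + qf R' (k *v x))"
  shows "qf S x \<le> r * qf S' x"
proof -
  have "0 \<le> qf (r *\<^sub>R S' - S) x"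
  proof (rule power_stable_nonneg[OF stab])
    fix y
    have "r * bellman A B Q' R' S' k y \<le> r * qf S' y" by (intro mult_left_mono super assms(2))
    then show "qf (r *\<^sub>R S' - S) ((A - B ** k) *v y) \<le> qf (r *\<^sub>R S' - S) y"
      using sub[of y] cost[of y] by (simp add: bellman_def qf_diff qf_scaleR algebra_simps)
  qed
  then show ?thesis by (simp add: qf_diff qf_scaleR)
qed

text \<open>\<open>S\<close> solves the discrete algebraic Riccati equation: it is attained by \<open>k\<close> and optimal among all
  policies.\<close>

definition optimal_value ::
  "real ^ 'n ^ 'n \<Rightarrow> real ^ 'm ^ 'n \<Rightarrow> real ^ 'n ^ 'n \<Rightarrow> real ^ 'm ^ 'm \<Rightarrow> real ^ 'n ^ 'n \<Rightarrow> real ^ 'n ^ 'm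
    \<Rightarrow> bool" where
  "optimal_value A B Q R S k \<longleftrightarrow>
     (\<forall>x. 0 \<le> qf S x) \<and> (\<forall>x. qf S x = bellman A B Q R S k x) \<and> (\<forall>k' x. qf S x \<le> bellman A B Q R S k' x)"

lemma
  assumes "optimal_value A B Q R S k"
  shows optimal_value_nonneg: "0 \<le> qf S x"
    and optimal_value_attained: "qf S x = bellman A B Q R S k x"
    and optimal_value_le: "qf S x \<le> bellman A B Q R S k' x"
  using assms unfolding optimal_value_def by blast+

text \<open>Minimize the trace over the compact set of pairs of a bounded supersolution and a policy for it.
  One step of policy improvement leads from a minimizer to a smaller supersolution, which must therefore
  be the same.\<close>

lemma optimal_value_exists:
  fixes A :: "real ^ 'n ^ 'n" and B :: "real ^ 'm ^ 'n"
  assumes \<mu>: "\<mu> > 0" and sym: "transpose Q = Q" "transpose R = R"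
    and co: "\<And>x. \<mu> * (norm x)\<^sup>2 \<le> qf Q x" "\<And>u. \<mu> * (norm u)\<^sup>2 \<le> qf R u"
    and P: "transpose P = P" "\<And>x. 0 \<le> qf P x" "\<And>x. qf P x \<le> \<nu> * (norm x)\<^sup>2"
    and sol: "solves_lyapunov A B Q R k0 P"
  obtains S k where "optimal_value A B Q R S k" "\<And>x. qf S x \<le> \<nu> * (norm x)\<^sup>2"
proof -
  define F where "F = {(S, k). (\<forall>x y. x \<bullet> (S *v y) = y \<bullet> (S *v x)) \<and> (\<forall>x. 0 \<le> qf S x)
      \<and> (\<forall>x. qf S x \<le> \<nu> * (norm x)\<^sup>2) \<and> (\<forall>x. bellman A B Q R S k x \<le> qf S x)}"
  have sym_iff: "(\<forall>x y. x \<bullet> (S *v y) = y \<bullet> (S *v x)) \<longleftrightarrow> transpose S = S"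
    for S :: "real ^ 'n ^ 'n"
  proof
    assume "\<forall>x y. x \<bullet> (S *v y) = y \<bullet> (S *v x)"
    then have "S $ i $ j = S $ j $ i" for i j by (metis inner_axis_matrix)
    then show "transpose S = S" by (simp add: transpose_def vec_eq_iff)
  qed (use inner_matrix_sym in blast)
  have R0: "0 \<le> qf R u" for u
    using co(2)[of u] \<mu> by (smt (verit) mult_nonneg_nonneg zero_le_power2)
  have Q0: "0 \<le> qf Q x" for x
    using co(1)[of x] \<mu> by (smt (verit) mult_nonneg_nonneg zero_le_power2)
  have expand: "bellman A B Q R S k x = qf S (A *v x - B *v (k *v x)) + qf Q x + qf R (k *v x)" for S k x
    by (simp add: bellman_def matrix_vector_mult_diff_rdistrib matrix_vector_mul_assoc)
  have "closed F"
    unfolding F_def case_prod_beta expand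
    by (intro closed_Collect_conj closed_Collect_all closed_Collect_imp closed_Collect_le closed_Collect_eq
        continuous_on_qf continuous_on_inner continuous_on_matrix_vector_mult continuous_intros)
  moreover have "bounded F"
  proof -
    define b where "b = (real CARD('n))\<^sup>2 * \<nu>"
    define d where "d = real CARD('m) * real CARD('n) * sqrt (\<nu> / \<mu>)"
    have "F \<subseteq> cball 0 b \<times> cball 0 d"
    proof (rule subrelI)
      fix S k assume "(S, k) \<in> F"
      then have F: "transpose S = S" "\<And>x. 0 \<le> qf S x" "\<And>x. qf S x \<le> \<nu> * (norm x)\<^sup>2"
        "\<And>x. bellman A B Q R S k x \<le> qf S x"
        unfolding F_def sym_iff by auto
      have "norm S \<le> b" unfolding b_def by (rule norm_le_of_qf_bound) (use F in auto)
      moreover have "norm k \<le> d"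
        unfolding d_def
      proof (rule norm_matrix_le_of_bound)
        fix x
        have "\<mu> * (norm (k *v x))\<^sup>2 \<le> \<nu> * (norm x)\<^sup>2"
          using F(3)[of x] F(4)[of x] co(2)[of "k *v x"] F(2)[of "(A - B ** k) *v x"] Q0[of x]
          unfolding bellman_def by linarith
        then have "(norm (k *v x))\<^sup>2 \<le> \<nu> / \<mu> * (norm x)\<^sup>2" using \<mu> by (simp add: field_simps)
        from real_sqrt_le_mono[OF this] show "norm (k *v x) \<le> sqrt (\<nu> / \<mu>) * norm x"
          by (simp only: real_sqrt_mult real_sqrt_abs abs_norm_cancel)
      qed
      ultimately show "(S, k) \<in> cball 0 b \<times> cball 0 d" by simp
    qed
    then show ?thesis using bounded_subset bounded_Times bounded_cball by metis
  qed
  ultimately have "compact F" by (simp add: compact_eq_bounded_closed)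
  moreover have "(P, k0) \<in> F"
    unfolding F_def using P solves_lyapunov_bellman[OF sol] inner_matrix_sym[OF P(1)] by simp
  then have "F \<noteq> {}" by blast
  moreover have "continuous_on F (\<lambda>p. trace (fst p))"
    unfolding trace_def by (intro continuous_intros)
  ultimately have "\<exists>p\<in>F. \<forall>q\<in>F. trace (fst p) \<le> trace (fst q)"
    by (rule continuous_attains_inf)
  then obtain p where p: "p \<in> F" and min: "\<And>q. q \<in> F \<Longrightarrow> trace (fst p) \<le> trace (fst q)"
    by blast
  obtain S k where Sk: "p = (S, k)" by (cases p)
  have S: "transpose S = S" "\<And>x. 0 \<le> qf S x" "\<And>x. qf S x \<le> \<nu> * (norm x)\<^sup>2"
    "\<And>x. bellman A B Q R S k x \<le> qf S x"
    using p unfolding F_def Sk sym_iff by auto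
  define k' where "k' = improved_policy A B R S"
  define S' where "S' = bellman_matrix A B Q R S k'"
  have opt: "bellman A B Q R S k' x \<le> bellman A B Q R S l x" for l x
    unfolding k'_def by (rule improved_policy_minimizes[OF \<mu> S(1) sym(2) S(2) co(2)])
  have S'_le: "qf S' x \<le> qf S x" for x
    unfolding S'_def qf_bellman_matrix using opt[of x k] S(4)[of x] by linarith
  have "(S', k') \<in> F"
  proof -
    have "transpose S' = S'"
      by (simp add: S'_def bellman_matrix_def transpose_add transpose_congruence S(1) sym)
    moreover have "0 \<le> qf S' x" for x
      using S(2) Q0 R0 by (simp add: S'_def qf_bellman_matrix bellman_def)
    moreover have "bellman A B Q R S' k' x \<le> qf S' x" for x
      using bellman_mono[OF S'_le] unfolding S'_def[symmetric] by (metis S'_def qf_bellman_matrix)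
    ultimately show ?thesis
      unfolding F_def using S'_le S(3) order_trans inner_matrix_sym by blast
  qed
  from min[OF this] have "trace (S - S') \<le> 0" by (simp add: Sk trace_sub)
  then have "CARD('n) * trace (S - S') * (norm x)\<^sup>2 \<le> 0" for x :: "real ^ 'n"
    by (simp add: mult_nonneg_nonpos mult_nonpos_nonneg)
  then have "qf (S - S') x \<le> 0" for x
    using qf_le_trace[of "S - S'" x] S'_le by (simp add: qf_diff) (smt (verit))
  then have eq: "qf S x = bellman A B Q R S k' x" for x
    using S'_le[of x] unfolding S'_def by (simp add: qf_diff qf_bellman_matrix) (smt (verit))
  then have "optimal_value A B Q R S k'"
    using S(2) opt unfolding optimal_value_def by metis
  then show thesis using that S(3) by blast
qed


section \<open>Tracking the optimal values\<close>

text \<open>The average at time \<open>t + 1\<close> differs from the one at time \<open>t\<close> by \<open>(Q (t + 1) - average) / (t + 1)\<close>, and the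
  two-sided bounds on the costs turn this absolute difference into a relative one.\<close>

lemma running_average_drift:
  fixes Q :: "nat \<Rightarrow> real ^ 'n ^ 'n"
  assumes "0 < \<mu>" "\<mu> \<le> \<sigma>" "t \<ge> 1"
    and bd: "\<And>t x. t \<ge> 1 \<Longrightarrow> \<mu> * (norm x)\<^sup>2 \<le> qf (Q t) x \<and> qf (Q t) x \<le> \<sigma> * (norm x)\<^sup>2"
  shows "qf (running_average Q (Suc t)) x \<le> (1 + \<sigma> / \<mu> / t) * qf (running_average Q t) x"
    and "qf (running_average Q t) x \<le> (1 + \<sigma> / \<mu> / t) * qf (running_average Q (Suc t)) x"
    and "\<bar>qf (running_average Q (Suc t)) x - qf (running_average Q t) x\<bar> \<le> \<sigma> / t * (norm x)\<^sup>2"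
proof -
  define a where "a = qf (running_average Q t) x"
  define b where "b = qf (running_average Q (Suc t)) x"
  define q where "q = qf (Q (Suc t)) x"
  define y where "y = (norm x)\<^sup>2"
  have y: "0 \<le> y" by (simp add: y_def)
  have t: "real t > 0" using assms(3) by simp
  note avg = running_average_qf[of "\<mu> * (norm x)\<^sup>2" Q x "\<sigma> * (norm x)\<^sup>2", OF bd]
  have a: "\<mu> * y \<le> a" "a \<le> \<sigma> * y" and b: "\<mu> * y \<le> b" "b \<le> \<sigma> * y"
    using avg[OF _ assms(3)] avg[of "Suc t"]
    by (simp_all add: a_def b_def y_def del: running_average.simps)
  have q: "\<mu> * y \<le> q" "q \<le> \<sigma> * y" using bd[of "Suc t" x] by (auto simp: q_def y_def)
  have "qf (real (Suc t) *\<^sub>R running_average Q (Suc t)) x = qf (real t *\<^sub>R running_average Q t + Q (Suc t)) x"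
    by (simp only: running_average_Suc)
  then have eq: "(1 + real t) * b = real t * a + q"
    by (simp add: qf_add qf_scaleR a_def b_def q_def del: running_average.simps)
  have \<mu>y: "0 \<le> \<mu> * y" using assms(1) y by simp
  have ratio: "\<sigma> * y \<le> \<sigma> / \<mu> * z" if "\<mu> * y \<le> z" for z
  proof -
    have "\<sigma> / \<mu> * (\<mu> * y) \<le> \<sigma> / \<mu> * z" using assms that by (intro mult_left_mono) auto
    then show ?thesis using assms by simp
  qed
  have quot: "real t * z / real t = z" "(real t * z + \<sigma> / \<mu> * z) / real t = (1 + \<sigma> / \<mu> / t) * z" for z
    using t by (simp_all add: add_divide_distrib distrib_right)
  have "real t * b \<le> real t * a + \<sigma> / \<mu> * a"
    using eq q ratio[OF a(1)] \<mu>y b(1) by (simp add: algebra_simps)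
  from divide_right_mono[OF this, of "real t"] have "b \<le> (1 + \<sigma> / \<mu> / t) * a"
    by (simp only: quot)
  then show "qf (running_average Q (Suc t)) x \<le> (1 + \<sigma> / \<mu> / t) * qf (running_average Q t) x"
    by (simp only: a_def b_def)
  have "real t * a \<le> real t * b + \<sigma> / \<mu> * b"
    using eq q ratio[OF b(1)] \<mu>y b(2) by (simp add: algebra_simps)
  from divide_right_mono[OF this, of "real t"] have "a \<le> (1 + \<sigma> / \<mu> / t) * b"
    by (simp only: quot)
  then show "qf (running_average Q t) x \<le> (1 + \<sigma> / \<mu> / t) * qf (running_average Q (Suc t)) x"
    by (simp only: a_def b_def)
  have "real t * (b - a) = q - b" using eq by (simp add: algebra_simps)
  then have "\<bar>real t * (b - a)\<bar> \<le> \<sigma> * y" using q b \<mu>y by simp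
  then have "real t * \<bar>b - a\<bar> \<le> \<sigma> * y" by (simp only: abs_mult abs_of_nat)
  then have "\<bar>b - a\<bar> \<le> \<sigma> / t * y" using t by (simp add: field_simps)
  then show "\<bar>qf (running_average Q (Suc t)) x - qf (running_average Q t) x\<bar> \<le> \<sigma> / t * (norm x)\<^sup>2"
    by (simp only: a_def b_def y_def)
qed

text \<open>A run of the update, observed from a time \<open>t\<^sub>0\<close> after which no reset takes place.\<close>

locale value_tracking =
  fixes A :: "real ^ 'n ^ 'n" and B :: "real ^ 'm ^ 'n"
    and Q :: "nat \<Rightarrow> real ^ 'n ^ 'n" and R :: "nat \<Rightarrow> real ^ 'm ^ 'm"
    and K :: "nat \<Rightarrow> real ^ 'n ^ 'm" and P :: "nat \<Rightarrow> real ^ 'n ^ 'n"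
    and \<mu> \<sigma> \<nu> :: real and t\<^sub>0 :: nat
  assumes \<mu>_pos: "0 < \<mu>" and \<mu>_le_\<sigma>: "\<mu> \<le> \<sigma>" and t\<^sub>0_pos: "1 \<le> t\<^sub>0"
    and Q_sym: "\<And>t. t \<ge> 1 \<Longrightarrow> transpose (Q t) = Q t"
    and R_sym: "\<And>t. t \<ge> 1 \<Longrightarrow> transpose (R t) = R t"
    and Q_bounds: "\<And>t x. t \<ge> 1 \<Longrightarrow> \<mu> * (norm x)\<^sup>2 \<le> qf (Q t) x \<and> qf (Q t) x \<le> \<sigma> * (norm x)\<^sup>2"
    and R_bounds: "\<And>t u. t \<ge> 1 \<Longrightarrow> \<mu> * (norm u)\<^sup>2 \<le> qf (R t) u \<and> qf (R t) u \<le> \<sigma> * (norm u)\<^sup>2"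
    and P_sym: "\<And>t. t \<ge> t\<^sub>0 \<Longrightarrow> transpose (P t) = P t"
    and P_lower: "\<And>t x. t \<ge> t\<^sub>0 \<Longrightarrow> \<mu> * (norm x)\<^sup>2 \<le> qf (P t) x"
    and P_upper: "\<And>t x. t \<ge> t\<^sub>0 \<Longrightarrow> qf (P t) x \<le> \<nu> * (norm x)\<^sup>2"
    and P_value: "\<And>t. t \<ge> t\<^sub>0 \<Longrightarrow> solves_lyapunov A B (running_average Q t) (running_average R t) (K t) (P t)"
    and K_improved: "\<And>t. t \<ge> t\<^sub>0 \<Longrightarrow> K (Suc t) = improved_policy A B (running_average R t) (P t)"
begin

abbreviation "Qb \<equiv> running_average Q"
abbreviation "Rb \<equiv> running_average R"
abbreviation "L t \<equiv> A - B ** K t"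
abbreviation "\<Phi> t \<equiv> bellman A B (Qb t) (Rb t)"
abbreviation "r t \<equiv> 1 + \<sigma> / \<mu> / real t"

lemma \<mu>_norm_nonneg: "0 \<le> \<mu> * (norm x)\<^sup>2"
  using \<mu>_pos by simp

lemma Qb_bounds: "t \<ge> t\<^sub>0 \<Longrightarrow> \<mu> * (norm x)\<^sup>2 \<le> qf (Qb t) x \<and> qf (Qb t) x \<le> \<sigma> * (norm x)\<^sup>2"
  using running_average_qf[of "\<mu> * (norm x)\<^sup>2" Q x "\<sigma> * (norm x)\<^sup>2"] Q_bounds t\<^sub>0_pos by simp

lemma Rb_bounds: "t \<ge> t\<^sub>0 \<Longrightarrow> \<mu> * (norm u)\<^sup>2 \<le> qf (Rb t) u \<and> qf (Rb t) u \<le> \<sigma> * (norm u)\<^sup>2"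
  using running_average_qf[of "\<mu> * (norm u)\<^sup>2" R u "\<sigma> * (norm u)\<^sup>2"] R_bounds t\<^sub>0_pos by simp

lemma Qb_nonneg: "t \<ge> t\<^sub>0 \<Longrightarrow> 0 \<le> qf (Qb t) x"
  using Qb_bounds \<mu>_norm_nonneg order_trans by blast

lemma Rb_nonneg: "t \<ge> t\<^sub>0 \<Longrightarrow> 0 \<le> qf (Rb t) u"
  using Rb_bounds[of t u] \<mu>_pos by (smt (verit) mult_nonneg_nonneg zero_le_power2)

lemma P_nonneg: "t \<ge> t\<^sub>0 \<Longrightarrow> 0 \<le> qf (P t) x"
  using P_lower \<mu>_norm_nonneg order_trans by blast

lemma P_bellman: "t \<ge> t\<^sub>0 \<Longrightarrow> qf (P t) x = \<Phi> t (P t) (K t) x"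
  by (rule solves_lyapunov_bellman[OF P_value])

lemma \<mu>_le_\<nu>: "\<mu> \<le> \<nu>"
  using order_trans[OF P_lower[of t\<^sub>0 "axis undefined 1"] P_upper[of t\<^sub>0 "axis undefined 1"]] by simp

lemma stage_cost_drift:
  assumes "t \<ge> t\<^sub>0"
  shows "qf (Qb (Suc t)) x + qf (Rb (Suc t)) u \<le> r t * (qf (Qb t) x + qf (Rb t) u)"
    and "qf (Qb t) x + qf (Rb t) u \<le> r t * (qf (Qb (Suc t)) x + qf (Rb (Suc t)) u)"
proof -
  have t: "1 \<le> t" using assms t\<^sub>0_pos by simp
  note q = running_average_drift[OF \<mu>_pos \<mu>_le_\<sigma> t Q_bounds, where x = x]
    and r = running_average_drift[OF \<mu>_pos \<mu>_le_\<sigma> t R_bounds, where x = u]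
  show "qf (Qb (Suc t)) x + qf (Rb (Suc t)) u \<le> r t * (qf (Qb t) x + qf (Rb t) u)"
    unfolding distrib_left using q(1) r(1) by (rule add_mono)
  show "qf (Qb t) x + qf (Rb t) u \<le> r t * (qf (Qb (Suc t)) x + qf (Rb (Suc t)) u)"
    unfolding distrib_left using q(2) r(2) by (rule add_mono)
qed

lemma r_nonneg: "0 \<le> r t"
  using \<mu>_pos \<mu>_le_\<sigma> by simp

text \<open>A nonnegative supersolution of the Bellman inequality is a Lyapunov function.\<close>

lemma closed_loop_stable:
  assumes "t \<ge> t\<^sub>0" "\<And>x. 0 \<le> qf S x" "\<And>x. \<Phi> t S k x \<le> qf S x"
  shows "power_stable (A - B ** k)"
proof (rule power_stable_of_lyapunov_function[OF \<mu>_pos assms(2)])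
  fix x show "qf S ((A - B ** k) *v x) + \<mu> * (norm x)\<^sup>2 \<le> qf S x"
    using assms(3)[of x] Qb_bounds[OF assms(1), of x] Rb_nonneg[OF assms(1), of "k *v x"]
    by (simp add: bellman_def)
qed

lemma L_stable: "t \<ge> t\<^sub>0 \<Longrightarrow> power_stable (L t)"
  using closed_loop_stable[of t "P t" "K t"] P_nonneg P_bellman by simp

lemma K_minimizes: "t \<ge> t\<^sub>0 \<Longrightarrow> \<Phi> t (P t) (K (Suc t)) x \<le> \<Phi> t (P t) k x"
  unfolding K_improved
  by (rule improved_policy_minimizes[OF \<mu>_pos P_sym])
    (use running_average_symmetric[of R] R_sym P_nonneg Rb_bounds in auto)

text \<open>Evaluating the improved policy gains at least as much as one Bellman step; the factor accounts for the
  change of the averages.\<close>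

lemma value_step:
  assumes "t \<ge> t\<^sub>0"
  shows "qf (P (Suc t)) x \<le> r t * \<Phi> t (P t) (K (Suc t)) x"
proof -
  define S where "S = bellman_matrix A B (Qb t) (Rb t) (P t) (K (Suc t))"
  have S: "qf S y = \<Phi> t (P t) (K (Suc t)) y" for y by (simp add: S_def qf_bellman_matrix)
  have le: "qf S y \<le> qf (P t) y" for y
    unfolding S using K_minimizes[OF assms, of y "K t"] P_bellman[OF assms, of y] by simp
  have "qf (P (Suc t)) x \<le> r t * qf S x"
  proof (rule bellman_comparison)
    show "power_stable (A - B ** K (Suc t))" using L_stable[of "Suc t"] assms by simp
    show "qf (P (Suc t)) y \<le> \<Phi> (Suc t) (P (Suc t)) (K (Suc t)) y" for y
      using P_bellman[of "Suc t" y] assms by simp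
    show "\<Phi> t S (K (Suc t)) y \<le> qf S y" for y
      unfolding S[of y] by (rule bellman_mono) (rule le)
  qed (rule r_nonneg, rule stage_cost_drift(1)[OF assms])
  then show ?thesis by (simp only: S)
qed

lemma optimal_drift:
  assumes t: "t \<ge> t\<^sub>0" and S: "optimal_value A B (Qb t) (Rb t) S k"
    and S': "optimal_value A B (Qb (Suc t)) (Rb (Suc t)) S' k'"
  shows "qf S x \<le> r t * qf S' x"
proof (rule bellman_comparison)
  show "power_stable (A - B ** k')"
    using closed_loop_stable[of "Suc t" S' k'] t optimal_value_nonneg[OF S'] optimal_value_attained[OF S'] by simp
  show "qf S y \<le> \<Phi> t S k' y" for y using S by (rule optimal_value_le)
  show "\<Phi> (Suc t) S' k' y \<le> qf S' y" for y using optimal_value_attained[OF S', of y] by simp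
qed (rule r_nonneg, rule stage_cost_drift(2)[OF t])

lemma optimal_le_value:
  assumes t: "t \<ge> t\<^sub>0" and S: "optimal_value A B (Qb t) (Rb t) S k"
  shows "qf S x \<le> qf (P t) x"
proof -
  have "qf S x \<le> 1 * qf (P t) x"
  proof (rule bellman_comparison[OF L_stable[OF t]])
    show "qf S y \<le> \<Phi> t S (K t) y" for y using S by (rule optimal_value_le)
    show "\<Phi> t (P t) (K t) y \<le> qf (P t) y" for y using P_bellman[OF t] by simp
  qed auto
  then show ?thesis by simp
qed

text \<open>If \<open>P t\<close> exceeds the optimal value by the factor \<open>1 + s\<close>, one improvement step shrinks \<open>s\<close> by
  the factor \<open>1 - \<mu> / \<nu>\<close>, because the immediate cost does not scale with \<open>s\<close> and is at least the fraction \<open>\<mu> / \<nu>\<close>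
  of the value.\<close>

lemma gap_contraction:
  assumes t: "t \<ge> t\<^sub>0" and S: "optimal_value A B (Qb t) (Rb t) S k" "\<And>x. qf S x \<le> \<nu> * (norm x)\<^sup>2"
    and S': "optimal_value A B (Qb (Suc t)) (Rb (Suc t)) S' k'"
    and s: "0 \<le> s" "\<And>x. qf (P t) x \<le> (1 + s) * qf S x"
  shows "qf (P (Suc t)) x \<le> (r t)\<^sup>2 * (1 + (1 - \<mu> / \<nu>) * s) * qf S' x"
proof -
  have \<nu>: "0 < \<nu>" using \<mu>_pos \<mu>_le_\<nu> by simp
  define \<eta> where "\<eta> = \<mu> / \<nu>"
  have \<eta>: "0 < \<eta>" "\<eta> \<le> 1" using \<mu>_pos \<mu>_le_\<nu> \<nu> by (auto simp: \<eta>_def)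
  have opt: "qf S x = \<Phi> t S k x" using S(1) by (rule optimal_value_attained)
  have "\<Phi> t (P t) (K (Suc t)) x \<le> \<Phi> t (P t) k x" by (rule K_minimizes[OF t])
  also have "\<dots> \<le> (1 + s) * \<Phi> t S k x - s * (qf (Qb t) x + qf (Rb t) (k *v x))"
    using s(2)[of "(A - B ** k) *v x"] by (simp add: bellman_def algebra_simps)
  also have "\<dots> \<le> (1 + s) * qf S x - s * (\<eta> * qf S x)"
  proof -
    have "\<eta> * qf S x \<le> \<eta> * (\<nu> * (norm x)\<^sup>2)" using S(2) \<eta> by (intro mult_left_mono) auto
    also have "\<dots> = \<mu> * (norm x)\<^sup>2" using \<nu> by (simp add: \<eta>_def)
    finally have "\<eta> * qf S x \<le> qf (Qb t) x + qf (Rb t) (k *v x)"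
      using Qb_bounds[OF t, of x] Rb_nonneg[OF t, of "k *v x"] by linarith
    then show ?thesis using s(1) opt by (simp add: mult_left_mono)
  qed
  also have "\<dots> = (1 + (1 - \<eta>) * s) * qf S x" by (simp add: algebra_simps)
  also have "\<dots> \<le> (1 + (1 - \<eta>) * s) * (r t * qf S' x)"
    using \<eta> s(1) by (intro mult_left_mono optimal_drift[OF t S(1) S']) auto
  finally have "r t * \<Phi> t (P t) (K (Suc t)) x \<le> r t * ((1 + (1 - \<eta>) * s) * (r t * qf S' x))"
    by (intro mult_left_mono r_nonneg)
  with value_step[OF t, of x] show ?thesis
    unfolding \<eta>_def by (simp add: power2_eq_square mult_ac)
qed

text \<open>The sequence \<open>D / t\<close> is stable under the recursion \<open>s \<mapsto> (1 + c / t)\<^sup>2 (1 + (1 - \<eta>) s) - 1\<close> for large \<open>t\<close>: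
  the drift contributes about \<open>3 c / t\<close> and the shift from \<open>D / t\<close> to \<open>D / (t + 1)\<close> about \<open>D / t\<^sup>2\<close>, both of
  which are paid by the contraction \<open>\<eta> D / t\<close> if \<open>D\<close> is a large multiple of \<open>c / \<eta>\<close>.\<close>

lemma gap_recursion:
  fixes T D c \<eta> :: real
  assumes "0 < T" "0 \<le> D" "1 \<le> c" "0 < \<eta>" "\<eta> \<le> 1" "c / T \<le> 1" "(3 * c + 1) / T \<le> \<eta> / 2" "6 * c / \<eta> \<le> D"
  shows "(1 + c / T)\<^sup>2 * (1 + (1 - \<eta>) * (D / T)) \<le> 1 + D / (T + 1)"
proof -
  define e where "e = c / T"
  define d where "d = D / T"
  have e: "0 \<le> e" "e \<le> 1" and d: "0 \<le> d" using assms by (auto simp: e_def d_def)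
  have sq: "(1 + e)\<^sup>2 \<le> 1 + 3 * e"
    using e mult_left_mono[of e 1 e] by (simp add: power2_eq_square algebra_simps)
  have "(1 + e)\<^sup>2 * (1 + (1 - \<eta>) * d) \<le> (1 + 3 * e) * (1 + (1 - \<eta>) * d)"
    using sq d assms by (intro mult_right_mono) auto
  also have "\<dots> \<le> 1 + 3 * e + (1 - \<eta>) * d + 3 * e * d"
  proof -
    have "3 * e * ((1 - \<eta>) * d) \<le> 3 * e * (1 * d)" using e d assms by (intro mult_left_mono mult_right_mono) auto
    then show ?thesis by (simp add: algebra_simps)
  qed
  also have "\<dots> \<le> 1 + d - d / T"
  proof -
    have "3 * e * d + d / T = (3 * c + 1) / T * d" by (simp add: e_def add_divide_distrib distrib_right)
    also have "\<dots> \<le> \<eta> / 2 * d" using assms d by (intro mult_right_mono) auto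
    finally have 1: "3 * e * d + d / T \<le> \<eta> / 2 * d" .
    have "6 * c \<le> \<eta> * D" using assms by (simp add: field_simps)
    then have "6 * c / T \<le> \<eta> * D / T" using assms by (intro divide_right_mono) auto
    then have "6 * e \<le> \<eta> * d" by (simp add: e_def d_def)
    then have "3 * e \<le> \<eta> / 2 * d" by simp
    moreover have "(1 - \<eta>) * d = d - (\<eta> / 2 * d + \<eta> / 2 * d)" by (simp add: algebra_simps)
    ultimately show ?thesis using 1 by linarith
  qed
  also have "1 + d - d / T \<le> 1 + D / (T + 1)"
  proof -
    have "D / (T + 1) - (d - d / T) = D / (T * T * (T + 1))"
      using assms by (simp add: d_def divide_simps) (simp add: algebra_simps)
    moreover have "0 \<le> D / (T * T * (T + 1))" using assms by simp
    ultimately show ?thesis by simp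
  qed
  finally show ?thesis by (simp add: e_def d_def)
qed

text \<open>Contraction against a drift of relative size \<open>1 / t\<close> leaves a gap of order \<open>1 / t\<close>. The constant \<open>D\<close> is
  chosen so large that the claim holds trivially at the starting time \<open>t\<^sub>1\<close>, where only
  \<open>\<mu> I \<le> Ps t\<^sub>1\<close> and \<open>P t\<^sub>1 \<le> \<nu> I\<close> are known.\<close>

lemma value_near_optimal:
  obtains Ps ks D t\<^sub>1 where "0 \<le> D" "t\<^sub>1 \<ge> t\<^sub>0" "\<sigma> / \<mu> / t\<^sub>1 \<le> 1"
    "\<And>t. t \<ge> t\<^sub>0 \<Longrightarrow> optimal_value A B (Qb t) (Rb t) (Ps t) (ks t)"
    "\<And>t x. t \<ge> t\<^sub>1 \<Longrightarrow> qf (P t) x \<le> (1 + D / real t) * qf (Ps t) x"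
proof -
  have "\<exists>S k. optimal_value A B (Qb t) (Rb t) S k \<and> (\<forall>x. qf S x \<le> \<nu> * (norm x)\<^sup>2)" if "t \<ge> t\<^sub>0" for t
  proof -
    have "transpose (Qb t) = Qb t" "transpose (Rb t) = Rb t"
      using running_average_symmetric[of Q] running_average_symmetric[of R] Q_sym R_sym by auto
    from optimal_value_exists[OF \<mu>_pos this conjunct1[OF Qb_bounds[OF that]] conjunct1[OF Rb_bounds[OF that]]
        P_sym[OF that] P_nonneg[OF that] P_upper[OF that] P_value[OF that]]
    obtain S k where "optimal_value A B (Qb t) (Rb t) S k" "\<And>x. qf S x \<le> \<nu> * (norm x)\<^sup>2"
      by metis
    then show ?thesis by auto
  qed
  then obtain Ps ks where Ps: "\<And>t. t \<ge> t\<^sub>0 \<Longrightarrow> optimal_value A B (Qb t) (Rb t) (Ps t) (ks t)"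
    "\<And>t x. t \<ge> t\<^sub>0 \<Longrightarrow> qf (Ps t) x \<le> \<nu> * (norm x)\<^sup>2" by metis
  have \<nu>: "0 < \<nu>" using \<mu>_pos \<mu>_le_\<nu> by simp
  define \<eta> where "\<eta> = \<mu> / \<nu>"
  define c where "c = \<sigma> / \<mu>"
  have \<eta>: "0 < \<eta>" "\<eta> \<le> 1" using \<mu>_pos \<mu>_le_\<nu> \<nu> by (auto simp: \<eta>_def)
  have c: "1 \<le> c" using \<mu>_pos \<mu>_le_\<sigma> by (simp add: c_def)
  \<comment> \<open>From \<open>n1\<close> on, both smallness conditions of the recursion hold.\<close>
  obtain n1 :: nat where n1: "c + 2 * (3 * c + 1) / \<eta> \<le> real n1" using real_arch_simple by blast
  define t\<^sub>1 where "t\<^sub>1 = max t\<^sub>0 n1"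
  define D where "D = max (6 * c / \<eta>) (real t\<^sub>1 * \<nu> / \<mu>)"
  have big: "c / T \<le> 1 \<and> (3 * c + 1) / T \<le> \<eta> / 2" if "real t\<^sub>1 \<le> T" for T
  proof -
    have T: "c + 2 * (3 * c + 1) / \<eta> \<le> T" using that n1 by (simp add: t\<^sub>1_def)
    have "0 \<le> 2 * (3 * c + 1) / \<eta>" using c \<eta> by simp
    then have "c \<le> T" "2 * (3 * c + 1) / \<eta> \<le> T" using T c by linarith+
    with c \<eta> show ?thesis by (simp add: field_simps)
  qed
  have D: "0 \<le> D" "6 * c / \<eta> \<le> D" using c \<eta> by (auto simp: D_def le_max_iff_disj)
  have t1: "t\<^sub>1 \<ge> t\<^sub>0" "1 \<le> t\<^sub>1" using t\<^sub>0_pos by (auto simp: t\<^sub>1_def)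
  have near: "\<forall>x. qf (P t) x \<le> (1 + D / real t) * qf (Ps t) x" if "t \<ge> t\<^sub>1" for t
    using that
  proof (induction t rule: dec_induct)
    case base
    show ?case
    proof
      fix x
      have nn: "0 \<le> qf (Ps t\<^sub>1) x" using Ps(1)[OF t1(1)] by (rule optimal_value_nonneg)
      have "\<mu> * (norm x)\<^sup>2 \<le> qf (Ps t\<^sub>1) x"
      proof -
        have "qf (Ps t\<^sub>1) x = \<Phi> t\<^sub>1 (Ps t\<^sub>1) (ks t\<^sub>1) x"
          using Ps(1)[OF t1(1)] by (rule optimal_value_attained)
        moreover have "0 \<le> qf (Ps t\<^sub>1) ((A - B ** ks t\<^sub>1) *v x)"
          using Ps(1)[OF t1(1)] by (rule optimal_value_nonneg)
        ultimately show ?thesis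
          using Qb_bounds[OF t1(1), of x] Rb_nonneg[OF t1(1), of "ks t\<^sub>1 *v x"]
          unfolding bellman_def by linarith
      qed
      then have "\<nu> / \<mu> * (\<mu> * (norm x)\<^sup>2) \<le> \<nu> / \<mu> * qf (Ps t\<^sub>1) x"
        using \<nu> \<mu>_pos by (intro mult_left_mono) auto
      then have "qf (P t\<^sub>1) x \<le> \<nu> / \<mu> * qf (Ps t\<^sub>1) x"
        using P_upper[OF t1(1), of x] \<mu>_pos by simp
      also have "\<nu> / \<mu> \<le> 1 + D / t\<^sub>1"
      proof -
        have "\<nu> / \<mu> = (real t\<^sub>1 * \<nu> / \<mu>) / real t\<^sub>1" using t1 by simp
        also have "\<dots> \<le> D / real t\<^sub>1" by (intro divide_right_mono) (auto simp: D_def)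
        finally show ?thesis by simp
      qed
      finally show "qf (P t\<^sub>1) x \<le> (1 + D / real t\<^sub>1) * qf (Ps t\<^sub>1) x" using nn by (simp add: mult_right_mono)
    qed
  next
    case (step t)
    then have t: "t \<ge> t\<^sub>0" "real t > 0" "real t\<^sub>1 \<le> real t" using t1 by auto
    have "0 \<le> D / real t" using D by simp
    show ?case
    proof
      fix x
      have "qf (P (Suc t)) x \<le> (r t)\<^sup>2 * (1 + (1 - \<mu> / \<nu>) * (D / t)) * qf (Ps (Suc t)) x"
        by (rule gap_contraction[OF t(1) Ps(1)[OF t(1)] Ps(2)[OF t(1)] Ps(1)])
          (use t step \<open>0 \<le> D / real t\<close> in auto)
      also have "\<dots> \<le> (1 + D / (real t + 1)) * qf (Ps (Suc t)) x"
      proof (rule mult_right_mono)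
        show "(r t)\<^sup>2 * (1 + (1 - \<mu> / \<nu>) * (D / t)) \<le> 1 + D / (real t + 1)"
          using gap_recursion[OF t(2) D(1) c \<eta>] big[OF t(3)] D(2) unfolding \<eta>_def c_def by blast
        show "0 \<le> qf (Ps (Suc t)) x" using optimal_value_nonneg[OF Ps(1)[of "Suc t"]] t by simp
      qed
      finally show "qf (P (Suc t)) x \<le> (1 + D / real (Suc t)) * qf (Ps (Suc t)) x"
        by (simp add: add.commute)
    qed
  qed
  have ratio: "\<sigma> / \<mu> / t\<^sub>1 \<le> 1" using big[of t\<^sub>1] by (simp add: c_def)
  show thesis by (rule that[OF D(1) t1(1) ratio Ps(1) near[rule_format]])
qed

text \<open>From above, \<open>P (t + 1)\<close> is compared with \<open>P t\<close> directly, since improvement decreases the value. A bound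
  from below has to pass through the optimal values, which move slowly and lie below \<open>P (t + 1)\<close>.\<close>

lemma value_drift:
  obtains c t\<^sub>1 where "0 \<le> c" "t\<^sub>1 \<ge> t\<^sub>0" 
    "\<And>t x. t \<ge> t\<^sub>1 \<Longrightarrow> \<bar>qf (P (Suc t)) x - qf (P t) x\<bar> \<le> c / real t * (norm x)\<^sup>2"
proof -
  obtain Ps ks D t\<^sub>1 where D: "0 \<le> D" and t1: "t\<^sub>1 \<ge> t\<^sub>0" "\<sigma> / \<mu> / t\<^sub>1 \<le> 1"
    and Ps: "\<And>t. t \<ge> t\<^sub>0 \<Longrightarrow> optimal_value A B (Qb t) (Rb t) (Ps t) (ks t)"
    and near: "\<And>t x. t \<ge> t\<^sub>1 \<Longrightarrow> qf (P t) x \<le> (1 + D / real t) * qf (Ps t) x"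
    by (rule value_near_optimal) (rule that)
  have \<nu>: "0 < \<nu>" using \<mu>_pos \<mu>_le_\<nu> by simp
  define a where "a = \<sigma> / \<mu>"
  have a: "0 \<le> a" using \<mu>_pos \<mu>_le_\<sigma> by (simp add: a_def)
  define c where "c = (2 * D + a) * \<nu>"
  have c: "0 \<le> c" using D a \<nu> by (simp add: c_def)
  have "\<bar>qf (P (Suc t)) x - qf (P t) x\<bar> \<le> c / real t * (norm x)\<^sup>2" if "t \<ge> t\<^sub>1" for t x
  proof -
    have t: "t \<ge> t\<^sub>0" "real t > 0" "real t\<^sub>1 \<le> real t" "real t\<^sub>1 > 0" using that t1 t\<^sub>0_pos by auto
    have "a / real t \<le> a / real t\<^sub>1" using a t by (intro divide_left_mono) auto
    then have at: "a / t \<le> 1" using t1(2) by (simp add: a_def)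
    have n: "0 \<le> (norm x)\<^sup>2" by simp
    have up: "qf (P (Suc t)) x - qf (P t) x \<le> a / t * (\<nu> * (norm x)\<^sup>2)"
    proof -
      have "qf (P (Suc t)) x \<le> r t * \<Phi> t (P t) (K (Suc t)) x" by (rule value_step[OF t(1)])
      also have "\<dots> \<le> r t * qf (P t) x"
        using K_minimizes[OF t(1), of x "K t"] P_bellman[OF t(1), of x] by (intro mult_left_mono r_nonneg) simp
      finally have "qf (P (Suc t)) x - qf (P t) x \<le> a / t * qf (P t) x" by (simp add: a_def algebra_simps)
      also have "\<dots> \<le> a / t * (\<nu> * (norm x)\<^sup>2)" using P_upper[OF t(1)] a t by (intro mult_left_mono) auto
      finally show ?thesis .
    qed
    have P': "0 \<le> qf (P (Suc t)) x" "qf (P (Suc t)) x \<le> \<nu> * (norm x)\<^sup>2"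
      using P_nonneg[of "Suc t" x] P_upper[of "Suc t" x] t by auto
    have low: "qf (P t) x - qf (P (Suc t)) x \<le> (2 * D + a) / t * (\<nu> * (norm x)\<^sup>2)"
    proof -
      have "qf (P t) x \<le> (1 + D / t) * qf (Ps t) x" by (rule near[OF that])
      also have "\<dots> \<le> (1 + D / t) * (r t * qf (P (Suc t)) x)"
      proof (intro mult_left_mono)
        have "qf (Ps t) x \<le> r t * qf (Ps (Suc t)) x"
          by (rule optimal_drift[OF t(1) Ps Ps]) (use t in auto)
        also have "\<dots> \<le> r t * qf (P (Suc t)) x"
          by (intro mult_left_mono r_nonneg optimal_le_value[OF _ Ps]) (use t in auto)
        finally show "qf (Ps t) x \<le> r t * qf (P (Suc t)) x" .
      qed (use D t in auto)
      also have "\<dots> = ((1 + D / t) * (1 + a / t)) * qf (P (Suc t)) x" by (simp add: a_def)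
      also have "\<dots> \<le> (1 + (2 * D + a) / t) * qf (P (Suc t)) x"
      proof (rule mult_right_mono)
        have "(1 + D / t) * (1 + a / t) = (1 + D / t + a / t) + D / t * (a / t)"
          by (simp add: algebra_simps)
        also have "\<dots> \<le> (1 + D / t + a / t) + D / t * 1"
          using at D t by (intro add_left_mono mult_left_mono) auto
        also have "\<dots> = 1 + (2 * D + a) / t" by (simp add: add_divide_distrib)
        finally show "(1 + D / t) * (1 + a / t) \<le> 1 + (2 * D + a) / t" .
      qed (use P' in auto)
      finally have "qf (P t) x - qf (P (Suc t)) x \<le> (2 * D + a) / t * qf (P (Suc t)) x"
        by (simp add: algebra_simps)
      also have "\<dots> \<le> (2 * D + a) / t * (\<nu> * (norm x)\<^sup>2)" using P' D a t by (intro mult_left_mono) auto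
      finally show ?thesis .
    qed
    have "a / t * (\<nu> * (norm x)\<^sup>2) \<le> (2 * D + a) / t * (\<nu> * (norm x)\<^sup>2)"
      using D t \<nu> by (intro mult_right_mono divide_right_mono) auto
    with up low show ?thesis by (simp add: c_def mult_ac)
  qed
  then show thesis by (rule that[OF c t1(1)])
qed

end


section \<open>Rates of change along the run\<close>

lemma transpose_diff: "transpose (X - Y) = transpose X - transpose Y"
  for X Y :: "real ^ 'n ^ 'm"
  by (simp add: transpose_def vec_eq_iff)

context value_tracking
begin

text \<open>The value \<open>P t\<close> contains the cost of the first control and the value of the next state, each of which is
  coercive.\<close>

lemma norm_K_le: "t \<ge> t\<^sub>0 \<Longrightarrow> norm (K t *v x) \<le> sqrt (\<nu> / \<mu>) * norm x"
proof -
  assume t: "t \<ge> t\<^sub>0"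
  have "\<mu> * (norm (K t *v x))\<^sup>2 \<le> \<nu> * (norm x)\<^sup>2"
    using P_upper[OF t, of x] P_bellman[OF t, of x] Rb_bounds[OF t, of "K t *v x"]
      P_nonneg[OF t, of "L t *v x"] Qb_nonneg[OF t, of x]
    unfolding bellman_def by linarith
  then have "(norm (K t *v x))\<^sup>2 \<le> \<nu> / \<mu> * (norm x)\<^sup>2" using \<mu>_pos by (simp add: field_simps)
  from real_sqrt_le_mono[OF this] show ?thesis
    by (simp only: real_sqrt_mult real_sqrt_abs abs_norm_cancel)
qed

lemma norm_L_le: "t \<ge> t\<^sub>0 \<Longrightarrow> (norm (L t *v x))\<^sup>2 \<le> \<nu> / \<mu> * (norm x)\<^sup>2"
proof -
  assume t: "t \<ge> t\<^sub>0"
  have "\<mu> * (norm (L t *v x))\<^sup>2 \<le> \<nu> * (norm x)\<^sup>2"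
    using P_upper[OF t, of x] P_bellman[OF t, of x] Rb_nonneg[OF t, of "K t *v x"]
      P_lower[OF t, of "L t *v x"] Qb_nonneg[OF t, of x]
    unfolding bellman_def by linarith
  then show ?thesis using \<mu>_pos by (simp add: field_simps)
qed

text \<open>Two consecutive policies solve linear equations \<open>H u = B\<^sup>T P A x\<close> whose coefficients differ by \<open>O(1 / t)\<close>
  and whose matrices \<open>H\<close> are uniformly coercive. The equation at time \<open>t\<close> determines the policy at time
  \<open>t + 1\<close>, which explains the shift of the index at the end.\<close>

lemma policy_drift:
  obtains c t\<^sub>1 where "0 \<le> c" "t\<^sub>1 \<ge> t\<^sub>0"
    "\<And>t x. t \<ge> t\<^sub>1 \<Longrightarrow> norm ((K (Suc t) - K t) *v x) \<le> c / real t * norm x"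
proof -
  obtain c1 t\<^sub>1 where c1: "0 \<le> c1" and t1: "t\<^sub>1 \<ge> t\<^sub>0"
    and dP: "\<And>t x. t \<ge> t\<^sub>1 \<Longrightarrow> \<bar>qf (P (Suc t)) x - qf (P t) x\<bar> \<le> c1 / real t * (norm x)\<^sup>2"
    by (rule value_drift) (rule that)
  define \<kappa> where "\<kappa> = sqrt (\<nu> / \<mu>)"
  define p where "p = (real CARD('n))\<^sup>2 * c1"
  define q where "q = (real CARD('m))\<^sup>2 * \<sigma>"
  define b where "b = norm (transpose B)"
  define c where "c = (b * (p * (norm A + norm B * \<kappa>)) + q * \<kappa>) / \<mu>"
  have \<nu>: "0 < \<nu>" using \<mu>_pos \<mu>_le_\<nu> by simp
  have \<kappa>: "0 \<le> \<kappa>" using \<mu>_pos \<nu> by (simp add: \<kappa>_def)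
  have c: "0 \<le> c" using c1 \<kappa> \<mu>_pos \<mu>_le_\<sigma> by (simp add: c_def p_def q_def b_def)
  have key: "norm ((K (Suc (Suc t)) - K (Suc t)) *v x) \<le> c / real t * norm x" if "t \<ge> t\<^sub>1" for t x
  proof -
    have t: "t \<ge> t\<^sub>0" "Suc t \<ge> t\<^sub>0" "real t > 0" "1 \<le> t" using that t1 t\<^sub>0_pos by auto
    define dP where "dP = P (Suc t) - P t"
    define dR where "dR = Rb (Suc t) - Rb t"
    define u where "u = K (Suc t) *v x"
    define u' where "u' = K (Suc (Suc t)) *v x"
    define H where "H s = transpose B ** P s ** B + Rb s" for s
    have Hu: "H t *v u = transpose B *v (P t *v (A *v x))"
      unfolding H_def u_def K_improved[OF t(1)]
      by (rule improved_policy_stationary[OF \<mu>_pos]) (use P_nonneg[OF t(1)] Rb_bounds[OF t(1)] in auto)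
    have Hu': "H (Suc t) *v u' = transpose B *v (P (Suc t) *v (A *v x))"
      unfolding H_def u'_def K_improved[OF t(2)]
      by (rule improved_policy_stationary[OF \<mu>_pos]) (use P_nonneg[OF t(2)] Rb_bounds[OF t(2)] in auto)
    have Rb_sym: "transpose (Rb s) = Rb s" for s by (rule running_average_symmetric) (rule R_sym)
    have nP: "norm dP \<le> p / t"
    proof -
      have "norm dP \<le> (real CARD('n))\<^sup>2 * (c1 / t)"
      proof (rule norm_le_of_qf_bound)
        show "transpose dP = dP" by (simp add: dP_def transpose_diff P_sym t)
        show "\<bar>qf dP y\<bar> \<le> c1 / t * (norm y)\<^sup>2" for y
          unfolding dP_def qf_diff by (rule dP[OF that])
      qed
      then show ?thesis by (simp add: p_def)
    qed
    have nR: "norm dR \<le> q / t"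
    proof -
      have "norm dR \<le> (real CARD('m))\<^sup>2 * (\<sigma> / t)"
      proof (rule norm_le_of_qf_bound)
        show "transpose dR = dR" unfolding dR_def transpose_diff Rb_sym ..
        show "\<bar>qf dR v\<bar> \<le> \<sigma> / t * (norm v)\<^sup>2" for v
          unfolding dR_def qf_diff by (rule running_average_drift(3)[OF \<mu>_pos \<mu>_le_\<sigma> t(4) R_bounds])
      qed
      then show ?thesis by (simp add: q_def)
    qed
    have nu: "norm u \<le> \<kappa> * norm x" unfolding u_def \<kappa>_def by (rule norm_K_le[OF t(2)])
    have exp: "H (Suc t) *v (u' - u) = transpose B *v (dP *v (A *v x - B *v u)) - dR *v u"
    proof -
      have "H (Suc t) *v (u' - u) = H (Suc t) *v u' - H t *v u - (H (Suc t) - H t) *v u"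
        by (simp add: matrix_vector_mult_diff_distrib matrix_vector_mult_diff_rdistrib)
      also have "(H (Suc t) - H t) *v u = transpose B *v (dP *v (B *v u)) + dR *v u"
        by (simp add: H_def dP_def dR_def matrix_vector_mult_diff_distrib matrix_vector_mult_diff_rdistrib
            matrix_vector_mult_add_rdistrib matrix_vector_mul_assoc[symmetric]
            del: transpose_matrix_vector running_average.simps)
      also have "H (Suc t) *v u' - H t *v u = transpose B *v (dP *v (A *v x))"
        unfolding Hu Hu' dP_def
        by (simp only: matrix_vector_mult_diff_distrib matrix_vector_mult_diff_rdistrib)
      finally show ?thesis
        by (simp add: matrix_vector_mult_diff_distrib algebra_simps del: transpose_matrix_vector)
    qed
    have "\<mu> * norm (u' - u) \<le> norm (H (Suc t) *v (u' - u))"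
      by (rule coercive_norm_le)
        (use P_nonneg[OF t(2)] Rb_bounds[OF t(2)] in \<open>auto simp: H_def qf_bellman_hessian add_increasing simp del: running_average.simps\<close>)
    also have "\<dots> \<le> b * (p / t * (norm A * norm x + norm B * (\<kappa> * norm x))) + q / t * (\<kappa> * norm x)"
    proof -
      have "norm (A *v x - B *v u) \<le> norm A * norm x + norm B * (\<kappa> * norm x)"
        using norm_triangle_ineq4[of "A *v x" "B *v u"] norm_matrix_vector_mult_le[of A x]
          norm_matrix_vector_mult_le[of B u] mult_left_mono[OF nu, of "norm B"] by simp
      then have "norm (dP *v (A *v x - B *v u)) \<le> p / t * (norm A * norm x + norm B * (\<kappa> * norm x))"
        by (rule order_trans[OF norm_matrix_vector_mult_le mult_mono[OF nP]])
          (use c1 in \<open>auto simp: p_def\<close>)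
      then have "norm (transpose B *v (dP *v (A *v x - B *v u)))
          \<le> b * (p / t * (norm A * norm x + norm B * (\<kappa> * norm x)))"
        unfolding b_def by (rule order_trans[OF norm_matrix_vector_mult_le mult_left_mono]) auto
      moreover have "norm (dR *v u) \<le> q / t * (\<kappa> * norm x)"
        by (rule order_trans[OF norm_matrix_vector_mult_le mult_mono[OF nR nu]])
          (use \<mu>_pos \<mu>_le_\<sigma> in \<open>auto simp: q_def\<close>)
      ultimately show ?thesis unfolding exp
        using norm_triangle_ineq4[of "transpose B *v (dP *v (A *v x - B *v u))" "dR *v u"] by linarith
    qed
    also have "\<dots> = \<mu> * (c / t * norm x)"
      using \<mu>_pos by (simp add: c_def algebra_simps add_divide_distrib)
    finally have "norm (u' - u) \<le> c / t * norm x" by (rule mult_left_le_imp_le[OF _ \<mu>_pos])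
    then show ?thesis by (simp add: u_def u'_def matrix_vector_mult_diff_rdistrib)
  qed
  have "norm ((K (Suc t) - K t) *v x) \<le> (2 * c) / real t * norm x" if t: "t \<ge> Suc t\<^sub>1" for t x
  proof -
    obtain s where s: "t = Suc s" "s \<ge> t\<^sub>1" "1 \<le> s" using t t1 t\<^sub>0_pos by (cases t) auto
    have "norm ((K (Suc t) - K t) *v x) \<le> c / real s * norm x" unfolding s by (rule key[OF s(2)])
    also have "\<dots> \<le> (2 * c) / real t * norm x"
    proof (rule mult_right_mono)
      have "c * real t \<le> c * (2 * real s)" using s c by (intro mult_left_mono) auto
      then show "c / real s \<le> 2 * c / real t" using s by (simp add: field_simps)
    qed simp
    finally show ?thesis .
  qed
  then show thesis using c t1 by (intro that[of "2 * c" "Suc t\<^sub>1"]) auto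
qed

text \<open>The loss of one improvement step is quadratic in the change of the policy.\<close>

lemma improvement_gap:
  obtains c t\<^sub>1 where "0 \<le> c" "t\<^sub>1 \<ge> t\<^sub>0"
    "\<And>t x. t \<ge> t\<^sub>1 \<Longrightarrow> qf (P t) x \<le> \<Phi> t (P t) (K (Suc t)) x + c / (real t)\<^sup>2 * (norm x)\<^sup>2"
proof -
  obtain c1 t\<^sub>1 where c1: "0 \<le> c1" and t1: "t\<^sub>1 \<ge> t\<^sub>0"
    and dK: "\<And>t x. t \<ge> t\<^sub>1 \<Longrightarrow> norm ((K (Suc t) - K t) *v x) \<le> c1 / real t * norm x"
    by (rule policy_drift) (rule that)
  have \<nu>: "0 < \<nu>" using \<mu>_pos \<mu>_le_\<nu> by simp
  define h where "h = \<nu> * (norm B)\<^sup>2 + \<sigma>"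
  have h: "0 \<le> h" using \<nu> \<mu>_pos \<mu>_le_\<sigma> by (simp add: h_def)
  have "qf (P t) x \<le> \<Phi> t (P t) (K (Suc t)) x + (h * c1\<^sup>2) / (real t)\<^sup>2 * (norm x)\<^sup>2"
    if "t \<ge> t\<^sub>1" for t x
  proof -
    have t: "t \<ge> t\<^sub>0" using that t1 by simp
    define v where "v = (K t - K (Suc t)) *v x"
    have "v = - ((K (Suc t) - K t) *v x)" by (simp add: v_def matrix_vector_mult_diff_rdistrib)
    then have nv: "norm v \<le> c1 / real t * norm x" using dK[OF that, of x] by simp
    have Rb_sym: "transpose (Rb t) = Rb t" by (rule running_average_symmetric) (rule R_sym)
    have "qf (P t) x = \<Phi> t (P t) (K (Suc t)) x + qf (transpose B ** P t ** B + Rb t) v"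
      unfolding P_bellman[OF t, of x] v_def K_improved[OF t]
      by (rule bellman_complete_square[OF \<mu>_pos P_sym[OF t] Rb_sym P_nonneg[OF t]])
        (use Rb_bounds[OF t] in auto)
    also have "qf (transpose B ** P t ** B + Rb t) v \<le> h * (norm v)\<^sup>2"
    proof -
      have "(norm (B *v v))\<^sup>2 \<le> (norm B * norm v)\<^sup>2"
        by (intro power_mono norm_matrix_vector_mult_le) auto
      then have "\<nu> * (norm (B *v v))\<^sup>2 \<le> \<nu> * ((norm B)\<^sup>2 * (norm v)\<^sup>2)"
        using \<nu> by (intro mult_left_mono) (auto simp: power_mult_distrib)
      then show ?thesis
        using P_upper[OF t, of "B *v v"] Rb_bounds[OF t, of v]
        unfolding qf_bellman_hessian h_def distrib_right mult.assoc by linarith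
    qed
    also have "\<dots> \<le> h * (c1 / real t * norm x)\<^sup>2"
      using nv h by (intro mult_left_mono power_mono) auto
    finally show ?thesis by (simp add: power_mult_distrib power_divide)
  qed
  then show thesis using h t1 by (intro that[of "h * c1\<^sup>2" t\<^sub>1]) auto
qed

lemma convergence_rates:
  obtains c t\<^sub>1 where "0 \<le> c" "t\<^sub>1 \<ge> t\<^sub>0"
    "\<And>t x. t \<ge> t\<^sub>1 \<Longrightarrow> \<bar>qf (P (Suc t)) x - qf (P t) x\<bar> \<le> c / real t * (norm x)\<^sup>2"
    "\<And>t x. t \<ge> t\<^sub>1 \<Longrightarrow> norm ((K (Suc t) - K t) *v x) \<le> c / real t * norm x"
    "\<And>t x. t \<ge> t\<^sub>1 \<Longrightarrow> qf (P t) x \<le> \<Phi> t (P t) (K (Suc t)) x + c / (real t)\<^sup>2 * (norm x)\<^sup>2"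
proof -
  obtain c1 t1 where 1: "0 \<le> c1" "t1 \<ge> t\<^sub>0"
    "\<And>t x. t \<ge> t1 \<Longrightarrow> \<bar>qf (P (Suc t)) x - qf (P t) x\<bar> \<le> c1 / real t * (norm x)\<^sup>2"
    by (rule value_drift) (rule that)
  obtain c2 t2 where 2: "0 \<le> c2" "t2 \<ge> t\<^sub>0"
    "\<And>t x. t \<ge> t2 \<Longrightarrow> norm ((K (Suc t) - K t) *v x) \<le> c2 / real t * norm x"
    by (rule policy_drift) (rule that)
  obtain c3 t3 where 3: "0 \<le> c3" "t3 \<ge> t\<^sub>0"
    "\<And>t x. t \<ge> t3 \<Longrightarrow> qf (P t) x \<le> \<Phi> t (P t) (K (Suc t)) x + c3 / (real t)\<^sup>2 * (norm x)\<^sup>2"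
    by (rule improvement_gap) (rule that)
  let ?c = "c1 + c2 + c3" and ?t = "max t1 (max t2 t3)"
  show thesis
  proof (rule that[of ?c ?t])
    fix t x assume t: "t \<ge> ?t"
    have "c1 / real t * (norm x)\<^sup>2 \<le> ?c / real t * (norm x)\<^sup>2" for x :: "real ^ 'n"
      using 1 2 3 by (intro mult_right_mono divide_right_mono) auto
    then show "\<bar>qf (P (Suc t)) x - qf (P t) x\<bar> \<le> ?c / real t * (norm x)\<^sup>2"
      using order_trans[OF 1(3)[of t x]] t by simp
    have "c2 / real t * norm x \<le> ?c / real t * norm x" for x :: "real ^ 'n"
      using 1 2 3 by (intro mult_right_mono divide_right_mono) auto
    then show "norm ((K (Suc t) - K t) *v x) \<le> ?c / real t * norm x"
      using order_trans[OF 2(3)[of t x]] t by simp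
    have "c3 / (real t)\<^sup>2 * (norm x)\<^sup>2 \<le> ?c / (real t)\<^sup>2 * (norm x)\<^sup>2"
      using 1 2 3 by (intro mult_right_mono divide_right_mono) auto
    then show "qf (P t) x \<le> \<Phi> t (P t) (K (Suc t)) x + ?c / (real t)\<^sup>2 * (norm x)\<^sup>2"
      using 3(3)[of t x] t by simp
  qed (use 1 2 3 in auto)
qed

end


section \<open>Cost of the run\<close>

text \<open>The mixed term is estimated by the weighted inequality between the arithmetic and the geometric mean.
  With a small weight this shows that a nonnegative form changes little between nearby points.\<close>

lemma qf_perturbation:
  fixes S :: "real ^ 'n ^ 'n"
  assumes S: "\<And>x. 0 \<le> qf S x" and "0 < \<epsilon>"
  shows "qf S a - qf S b \<le> \<epsilon> * qf S b + (1 + 1 / \<epsilon>) * qf S (a - b)"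
proof -
  define d where "d = a - b"
  have a: "a = b + d" by (simp add: d_def)
  define m where "m = b \<bullet> (S *v d) + d \<bullet> (S *v b)"
  have "qf S (\<epsilon> *\<^sub>R b - d) = \<epsilon>\<^sup>2 * qf S b - \<epsilon> * m + qf S d"
    by (simp add: qf_def m_def matrix_vector_mult_diff_distrib matrix_vector_mult_scaleR inner_diff_left
        inner_diff_right power2_eq_square algebra_simps)
  then have "\<epsilon> * m \<le> \<epsilon> * (\<epsilon> * qf S b + qf S d / \<epsilon>)"
    using S[of "\<epsilon> *\<^sub>R b - d"] assms(2) by (simp add: power2_eq_square distrib_left mult.assoc)
  then have "m \<le> \<epsilon> * qf S b + qf S d / \<epsilon>" by (rule mult_left_le_imp_le[OF _ assms(2)])
  moreover have "qf S a = qf S b + m + qf S d"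
    by (simp add: a qf_def m_def matrix_vector_right_distrib inner_add_left inner_add_right)
  ultimately show ?thesis by (simp add: d_def distrib_right)
qed

text \<open>Turns sums of \<open>1 / s\<close> into telescoping sums of logarithms.\<close>

lemma inverse_le_ln_diff:
  assumes "1 \<le> s"
  shows "1 / real s \<le> 2 * (ln (real (Suc s)) - ln (real s))"
proof -
  have s: "0 < real s" using assms by simp
  have "ln (real s / real (Suc s)) \<le> real s / real (Suc s) - 1"
    using s by (intro ln_le_minus_one) auto
  moreover have "real s / real (Suc s) - 1 = - (1 / real (Suc s))" by (simp add: field_simps)
  ultimately have "1 / real (Suc s) \<le> ln (real (Suc s)) - ln (real s)"
    using s by (simp add: ln_div)
  then have "2 * (1 / real (Suc s)) \<le> 2 * (ln (real (Suc s)) - ln (real s))"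
    by (rule mult_left_mono) simp
  moreover have "1 / real s \<le> 2 * (1 / real (Suc s))" using assms by (simp add: field_simps)
  ultimately show ?thesis by (rule order_trans[rotated])
qed

lemma sum_step: "(\<Sum>t=1..Suc T. f t) = (\<Sum>t=1..T. f t) + (f (Suc T) :: real)"
  by simp

text \<open>The second moments of the state along the run, as matrices with a given recursion.\<close>

locale controlled_moments = value_tracking A B Q R K P \<mu> \<sigma> \<nu> t\<^sub>0
  for A :: "real ^ 'n ^ 'n" and B :: "real ^ 'm ^ 'n" and Q R K P \<mu> \<sigma> \<nu> t\<^sub>0 +
  fixes X :: "nat \<Rightarrow> real ^ 'n ^ 'n" and W :: "real ^ 'n ^ 'n"
  assumes W_cone: "W \<in> moment_cone"
    and X_cone: "\<And>t. t \<ge> 1 \<Longrightarrow> X t \<in> moment_cone"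
    and X_step: "\<And>t. t \<ge> 1 \<Longrightarrow> X (Suc t) = (A - B ** K t) ** X t ** transpose (A - B ** K t) + W"
begin

lemma X_cone': "t \<ge> t\<^sub>0 \<Longrightarrow> X t \<in> moment_cone"
  using X_cone t\<^sub>0_pos by simp

lemma \<nu>_pos: "0 < \<nu>"
  using \<mu>_pos \<mu>_le_\<nu> by simp

lemma P_decrease:
  assumes "t \<ge> t\<^sub>0" "Y \<in> moment_cone"
  shows "pairing (P t) (L t ** Y ** transpose (L t)) \<le> pairing (P t) Y - \<mu> * trace Y"
proof -
  have "pairing (transpose (L t) ** P t ** L t) Y \<le> pairing (P t - \<mu> *\<^sub>R mat 1) Y"
  proof (rule pairing_mono[OF assms(2)])
    fix x show "qf (transpose (L t) ** P t ** L t) x \<le> qf (P t - \<mu> *\<^sub>R mat 1) x"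
      using P_bellman[OF assms(1), of x] Qb_bounds[OF assms(1), of x] Rb_nonneg[OF assms(1), of "K t *v x"]
      unfolding bellman_def qf_congruence qf_diff qf_scaleR qf_mat_1 by linarith
  qed
  then show ?thesis
    unfolding pairing_congruence pairing_diff_left pairing_scaleR_left by (simp add: pairing_def)
qed

text \<open>The pairing of \<open>P t\<close> with the moments is a Lyapunov function: a step of the closed loop multiplies it by
  \<open>1 - \<mu> / \<nu>\<close>, the noise adds a constant, and the change of \<open>P t\<close> costs half of the contraction.\<close>

lemma moments_bounded:
  obtains b t\<^sub>1 where "0 \<le> b" "t\<^sub>1 \<ge> t\<^sub>0" "\<And>t. t \<ge> t\<^sub>1 \<Longrightarrow> trace (X t) \<le> b"
proof -
  obtain c t\<^sub>1 where c: "0 \<le> c" and t1: "t\<^sub>1 \<ge> t\<^sub>0"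
    and dP: "\<And>t x. t \<ge> t\<^sub>1 \<Longrightarrow> \<bar>qf (P (Suc t)) x - qf (P t) x\<bar> \<le> c / real t * (norm x)\<^sup>2"
    by (rule value_drift) (rule that)
  define \<eta> where "\<eta> = \<mu> / \<nu>"
  have \<eta>: "0 < \<eta>" "\<eta> \<le> 1" using \<mu>_pos \<mu>_le_\<nu> \<nu>_pos by (auto simp: \<eta>_def)
  \<comment> \<open>From \<open>n1\<close> on, the relative change of \<open>P t\<close> is at most \<open>\<eta> / 2\<close>.\<close>
  obtain n1 :: nat where n1: "2 * c / (\<mu> * \<eta>) \<le> real n1" using real_arch_simple by blast
  define t2 where "t2 = max t\<^sub>1 n1"
  define v where "v t = pairing (P t) (X t)" for t
  define \<omega> where "\<omega> = \<nu> * trace W"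
  have \<omega>: "0 \<le> \<omega>" using trace_nonneg[OF W_cone] \<nu>_pos by (simp add: \<omega>_def)
  have v_step: "v (Suc t) \<le> (1 - \<eta> / 2) * v t + 2 * \<omega>" if "t \<ge> t2" for t
  proof -
    have t: "t \<ge> t\<^sub>0" "t \<ge> t\<^sub>1" "t \<ge> 1" "real t \<ge> real n1" "Suc t \<ge> t\<^sub>0"
      using that t1 t\<^sub>0_pos by (auto simp: t2_def)
    note Xt = X_cone[OF t(3)] X_cone'[OF t(5)]
    define w where "w = pairing (P t) (X (Suc t))"
    have small: "c / t \<le> \<eta> / 2 * \<mu>"
    proof -
      have "2 * c / (\<mu> * \<eta>) \<le> real t" using n1 t(4) by linarith
      then have "2 * c \<le> real t * (\<mu> * \<eta>)" using \<mu>_pos \<eta> by (simp add: field_simps)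
      then show ?thesis using t(3) by (simp add: field_simps)
    qed
    have w: "w \<le> v t - \<mu> * trace (X t) + \<omega>"
      unfolding w_def X_step[OF t(3)] pairing_add_right v_def \<omega>_def
      using P_decrease[OF t(1) Xt(1)] pairing_le_trace[OF W_cone P_upper[OF t(1)]] by linarith
    have "v t \<le> \<nu> * trace (X t)" unfolding v_def by (rule pairing_le_trace[OF Xt(1) P_upper[OF t(1)]])
    then have "\<eta> * v t \<le> \<eta> * (\<nu> * trace (X t))" using \<eta> by (intro mult_left_mono) auto
    also have "\<dots> = \<mu> * trace (X t)" using \<nu>_pos by (simp add: \<eta>_def)
    finally have w': "w \<le> (1 - \<eta>) * v t + \<omega>" using w by (simp add: algebra_simps)
    have v0: "0 \<le> v t" unfolding v_def by (rule pairing_nonneg[OF Xt(1) P_nonneg[OF t(1)]])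
    have w0: "0 \<le> w" unfolding w_def by (rule pairing_nonneg[OF Xt(2) P_nonneg[OF t(1)]])
    have "v (Suc t) - w = pairing (P (Suc t) - P t) (X (Suc t))"
      by (simp add: v_def w_def pairing_diff_left)
    also have "\<dots> \<le> c / t * trace (X (Suc t))"
      by (rule pairing_le_trace[OF Xt(2)]) (use dP[OF t(2)] in \<open>auto simp: qf_diff abs_le_iff\<close>)
    also have "\<dots> \<le> \<eta> / 2 * \<mu> * trace (X (Suc t))"
      using small trace_nonneg[OF Xt(2)] by (intro mult_right_mono) auto
    also have "\<dots> \<le> \<eta> / 2 * w"
      using trace_le_pairing[OF Xt(2) P_lower[OF t(1)]] \<eta> unfolding w_def mult.assoc
      by (intro mult_left_mono) auto
    finally have "v (Suc t) \<le> (1 + \<eta> / 2) * w" by (simp add: algebra_simps)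
    also have "\<dots> \<le> (1 + \<eta> / 2) * ((1 - \<eta>) * v t + \<omega>)" using w' \<eta> by (intro mult_left_mono) auto
    also have "\<dots> = (1 - \<eta> / 2 - \<eta> * \<eta> / 2) * v t + (1 + \<eta> / 2) * \<omega>" by (simp add: field_simps)
    also have "\<dots> \<le> (1 - \<eta> / 2) * v t + 2 * \<omega>"
      using v0 \<omega> \<eta> by (intro add_mono mult_right_mono) auto
    finally show ?thesis .
  qed
  \<comment> \<open>The fixed point of the recursion, raised to cover the initial value.\<close>
  define b where "b = v t2 + 4 * \<omega> / \<eta>"
  have t2: "t2 \<ge> t\<^sub>0" using t1 by (simp add: t2_def)
  have "0 \<le> v t2" unfolding v_def by (rule pairing_nonneg[OF X_cone'[OF t2] P_nonneg[OF t2]])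
  then have b: "0 \<le> b" "v t2 \<le> b" "4 * \<omega> / \<eta> \<le> b" using \<omega> \<eta> by (auto simp: b_def)
  have vb: "v t \<le> b" if "t \<ge> t2" for t
    using that
  proof (induction t rule: dec_induct)
    case (step t)
    have "(1 - \<eta> / 2) * v t \<le> (1 - \<eta> / 2) * b" using step \<eta> by (intro mult_left_mono) auto
    moreover have "2 * \<omega> \<le> \<eta> / 2 * b" using b(3) \<eta> by (simp add: field_simps)
    ultimately have "(1 - \<eta> / 2) * v t + 2 * \<omega> \<le> b" by (simp add: algebra_simps)
    with v_step[OF step(1)] show ?case by (rule order_trans)
  qed (rule b(2))
  have "trace (X t) \<le> b / \<mu>" if "t \<ge> t2" for t
  proof -
    have t: "t \<ge> t\<^sub>0" using that t2 by simp
    have "\<mu> * trace (X t) \<le> v t" unfolding v_def by (rule trace_le_pairing[OF X_cone'[OF t] P_lower[OF t]])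
    then show ?thesis using vb[OF that] \<mu>_pos by (simp add: field_simps)
  qed
  then show thesis using b \<mu>_pos t2 by (intro that[of "b / \<mu>" t2]) auto
qed

lemma trace_P_le: "t \<ge> t\<^sub>0 \<Longrightarrow> trace (P t) \<le> CARD('n) * \<nu>"
proof -
  assume t: "t \<ge> t\<^sub>0"
  have "trace (P t) \<le> (\<Sum>i\<in>(UNIV::'n set). \<nu>)"
    unfolding trace_eq_sum_qf by (intro sum_mono) (use P_upper[OF t, of "axis _ 1"] in simp)
  then show ?thesis by simp
qed

text \<open>The increments of the second moments obey the closed-loop recursion up to a perturbation by the
  change of the policy. They are dominated in the cone by a sequence \<open>Z\<close> that obeys the same recursion
  with an input of size \<open>1 / t\<close>, for which \<open>P t\<close> is a Lyapunov function; its traces telescope.\<close>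

lemma increments_dominated:
  obtains Z :: "nat \<Rightarrow> real ^ 'n ^ 'n" and y g t\<^sub>1 where "0 \<le> g" "t\<^sub>1 \<ge> t\<^sub>0"
    "\<And>t. t \<ge> t\<^sub>1 \<Longrightarrow> Z t + (X (Suc t) - X t) \<in> moment_cone"
    "\<And>t. t \<ge> t\<^sub>1 \<Longrightarrow> Z t - (X (Suc t) - X t) \<in> moment_cone"
    "\<And>t. t \<ge> t\<^sub>1 \<Longrightarrow> 0 \<le> y t \<and> trace (Z t) \<le> y t - y (Suc t) + g / real t"
proof -
  obtain c t1 where c: "0 \<le> c" and t1: "t1 \<ge> t\<^sub>0"
    and dP: "\<And>t x. t \<ge> t1 \<Longrightarrow> \<bar>qf (P (Suc t)) x - qf (P t) x\<bar> \<le> c / real t * (norm x)\<^sup>2"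
    and dK: "\<And>t x. t \<ge> t1 \<Longrightarrow> norm ((K (Suc t) - K t) *v x) \<le> c / real t * norm x"
    by (rule convergence_rates) (rule that)
  obtain b t2 where b: "0 \<le> b" "t2 \<ge> t\<^sub>0" "\<And>t. t \<ge> t2 \<Longrightarrow> trace (X t) \<le> b"
    by (rule moments_bounded) (rule that)
  \<comment> \<open>From \<open>n1\<close> on, half of the decrease \<open>\<mu> I\<close> of \<open>P t\<close> absorbs its drift.\<close>
  obtain n1 :: nat where n1: "2 * c / \<mu> \<le> real n1" using real_arch_simple by blast
  define t3 where "t3 = max (max t1 t2) n1"
  define e where "e = \<nu> / \<mu> + 2 * (norm B * c)\<^sup>2"
  define d where "d = CARD('n) * e * b"
  have e: "0 \<le> e" using \<mu>_pos \<nu>_pos by (simp add: e_def)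
  have d: "0 \<le> d" using e b by (simp add: d_def)
  have perturb: "\<bar>qf S (L (Suc t) *v x) - qf S (L t *v x)\<bar> \<le> CARD('n) * trace S * e / t * (norm x)\<^sup>2"
    if S: "\<And>x. 0 \<le> qf S x" and "t \<ge> t3" for S :: "real ^ 'n ^ 'n" and t x
  proof -
    have t: "t \<ge> t\<^sub>0" "Suc t \<ge> t\<^sub>0" "t \<ge> t1" "1 \<le> t" "1 \<le> real t"
      using that(2) t1 t\<^sub>0_pos by (auto simp: t3_def)
    define s where "s = CARD('n) * trace S"
    have s0: "0 \<le> s" unfolding s_def trace_eq_sum_qf using S by (intro mult_nonneg_nonneg sum_nonneg) auto
    have bd: "qf S z \<le> s * (norm z)\<^sup>2" for z unfolding s_def by (rule qf_le_trace[OF S])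
    have main: "qf S p - qf S q \<le> s * e / t * (norm x)\<^sup>2"
      if q: "(norm q)\<^sup>2 \<le> \<nu> / \<mu> * (norm x)\<^sup>2" and pq: "norm (p - q) \<le> norm B * c / t * norm x" for p q
    proof -
      \<comment> \<open>With weight \<open>1 / t\<close> both terms have order \<open>1 / t\<close>, as the points differ by \<open>O(1 / t)\<close>.\<close>
      have "qf S p - qf S q \<le> 1 / t * qf S q + (1 + 1 / (1 / t)) * qf S (p - q)"
        by (rule qf_perturbation[OF S]) (use t in auto)
      also have "\<dots> \<le> 1 / t * (s * (\<nu> / \<mu> * (norm x)\<^sup>2)) + (2 * t) * (s * (norm B * c / t * norm x)\<^sup>2)"
      proof (intro add_mono mult_mono)
        show "qf S q \<le> s * (\<nu> / \<mu> * (norm x)\<^sup>2)"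
          by (rule order_trans[OF bd mult_left_mono[OF q s0]])
        show "qf S (p - q) \<le> s * (norm B * c / t * norm x)\<^sup>2"
          by (rule order_trans[OF bd mult_left_mono[OF power_mono[OF pq] s0]]) simp
      qed (use t S in auto)
      also have "\<dots> = s * e / t * (norm x)\<^sup>2"
        using t by (simp add: e_def power_mult_distrib power_divide) (simp add: field_simps power2_eq_square)
      finally show ?thesis .
    qed
    have L: "L (Suc t) *v x - L t *v x = - (B *v ((K (Suc t) - K t) *v x))"
      by (simp add: matrix_vector_mult_diff_rdistrib matrix_vector_mult_diff_distrib matrix_vector_mul_assoc)
    have "norm (B *v ((K (Suc t) - K t) *v x)) \<le> norm B * (c / t * norm x)"
      by (rule order_trans[OF norm_matrix_vector_mult_le mult_left_mono[OF dK[OF t(3)]]]) simp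
    then have "norm (L (Suc t) *v x - L t *v x) \<le> norm B * c / t * norm x" unfolding L by simp
    moreover from this have "norm (L t *v x - L (Suc t) *v x) \<le> norm B * c / t * norm x"
      by (simp add: norm_minus_commute)
    ultimately show ?thesis
      using main[OF norm_L_le[OF t(1)]] main[OF norm_L_le[OF t(2)]] unfolding s_def by (simp add: abs_le_iff)
  qed
  define F where "F t = L (Suc t) ** X t ** transpose (L (Suc t)) - L t ** X t ** transpose (L t)" for t
  have F: "\<bar>pairing S (F t)\<bar> \<le> d / t * trace S" if S: "\<And>x. 0 \<le> qf S x" and "t \<ge> t3" for S t
  proof -
    have t: "t \<ge> t\<^sub>0" "t \<ge> t2" "1 \<le> t" using that(2) t1 t\<^sub>0_pos by (auto simp: t3_def)
    define M where "M = transpose (L (Suc t)) ** S ** L (Suc t) - transpose (L t) ** S ** L t"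
    define m where "m = CARD('n) * trace S * e / t"
    have "0 \<le> trace S" unfolding trace_eq_sum_qf by (intro sum_nonneg S)
    then have m: "0 \<le> m" using e by (simp add: m_def)
    have M: "\<bar>qf M x\<bar> \<le> m * (norm x)\<^sup>2" for x
      unfolding M_def qf_diff qf_congruence m_def by (rule perturb[OF S that(2)])
    have "pairing S (F t) = pairing M (X t)"
      by (simp only: F_def M_def pairing_diff_left pairing_diff_right pairing_congruence)
    moreover have "pairing M (X t) \<le> m * trace (X t)"
      by (rule pairing_le_trace[OF X_cone'[OF t(1)]]) (use M in \<open>auto simp: abs_le_iff\<close>)
    moreover have "(- m) * trace (X t) \<le> pairing M (X t)"
      by (rule trace_le_pairing[OF X_cone'[OF t(1)]]) (use M in \<open>auto simp: abs_le_iff minus_le_iff\<close>)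
    ultimately have "\<bar>pairing S (F t)\<bar> \<le> m * trace (X t)" by (simp add: abs_le_iff)
    also have "\<dots> \<le> m * b" by (rule mult_left_mono[OF b(3)[OF t(2)] m])
    finally show ?thesis by (simp add: m_def d_def mult_ac)
  qed
  \<comment> \<open>The sum of the first two moments dominates their difference in both directions.\<close>
  define Z' where "Z' = rec_nat (X (Suc t3) + X t3)
    (\<lambda>k z. L (Suc (t3 + k)) ** z ** transpose (L (Suc (t3 + k))) + (d / real (t3 + k)) *\<^sub>R mat 1)"
  define Z where "Z t = Z' (t - t3)" for t
  have Z0: "Z t3 = X (Suc t3) + X t3" by (simp add: Z_def Z'_def)
  have ZS: "Z (Suc t) = L (Suc t) ** Z t ** transpose (L (Suc t)) + (d / real t) *\<^sub>R mat 1" if "t \<ge> t3" for t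
    using that by (simp add: Z_def Z'_def Suc_diff_le)
  have t3: "t3 \<ge> t\<^sub>0" "1 \<le> t3" using t1 t\<^sub>0_pos by (auto simp: t3_def)
  have Fcone: "(d / real t) *\<^sub>R mat 1 + F t \<in> moment_cone" "(d / real t) *\<^sub>R mat 1 - F t \<in> moment_cone"
    if "t \<ge> t3" for t
    using F[OF _ that]
    by (auto simp: moment_cone_def pairing_add_right pairing_diff_right pairing_scaleR_right pairing_identity
        abs_le_iff) (smt (verit))+
  have dX: "X (Suc (Suc t)) - X (Suc t) = L (Suc t) ** (X (Suc t) - X t) ** transpose (L (Suc t)) + F t"
    if "t \<ge> t3" for t
  proof -
    have t: "1 \<le> t" "1 \<le> Suc t" using that t3 by auto
    have W: "W = X (Suc t) - L t ** X t ** transpose (L t)" by (simp add: X_step[OF t(1)])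
    show ?thesis
      unfolding matrix_mult_diff_middle F_def X_step[OF t(2)] W by simp
  qed
  have congr: "L (Suc t) ** U ** transpose (L (Suc t)) + I + (L (Suc t) ** V ** transpose (L (Suc t)) + G) \<in> moment_cone"
    if "U + V \<in> moment_cone" "I + G \<in> moment_cone" for t U V I G
  proof -
    have "L (Suc t) ** (U + V) ** transpose (L (Suc t)) + (I + G) \<in> moment_cone"
      by (intro moment_cone_add moment_cone_congruence that)
    then show ?thesis unfolding matrix_mult_add_middle by (simp add: algebra_simps)
  qed
  have dom: "Z t + (X (Suc t) - X t) \<in> moment_cone \<and> Z t - (X (Suc t) - X t) \<in> moment_cone" if "t \<ge> t3" for t
    using that
  proof (induction t rule: dec_induct)
    case base
    have "2 *\<^sub>R X (Suc t3) \<in> moment_cone" "2 *\<^sub>R X t3 \<in> moment_cone"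
      using t3 X_cone by (auto intro!: moment_cone_scaleR)
    then show ?case unfolding Z0 scaleR_2 by simp
  next
    case (step t)
    have neg: "- (L (Suc t) ** V ** transpose (L (Suc t)) + G) = L (Suc t) ** (- V) ** transpose (L (Suc t)) + (- G)"
      for V G by (simp add: matrix_matrix_mult_def vec_eq_iff sum_negf)
    define D where "D = X (Suc t) - X t"
    have IH: "Z t + D \<in> moment_cone" "Z t + (- D) \<in> moment_cone"
      using step(3) unfolding D_def[symmetric] by simp_all
    have I: "(d / real t) *\<^sub>R mat 1 + F t \<in> moment_cone" "(d / real t) *\<^sub>R mat 1 + (- F t) \<in> moment_cone"
      using Fcone[OF step(1)] by simp_all
    show ?case
      unfolding ZS[OF step(1)] dX[OF step(1)] D_def[symmetric]
      using congr[OF IH(1) I(1), of t] congr[OF IH(2) I(2), of t] unfolding neg[symmetric]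
      by (simp only: diff_conv_add_uminus simp_thms)
  qed
  have Zcone: "Z t \<in> moment_cone" if "t \<ge> t3" for t
  proof -
    have "(Z t + (X (Suc t) - X t)) + (Z t - (X (Suc t) - X t)) \<in> moment_cone"
      using dom[OF that] by (elim conjE) (rule moment_cone_add)
    also have "(Z t + (X (Suc t) - X t)) + (Z t - (X (Suc t) - X t)) = 2 *\<^sub>R Z t" by (simp add: scaleR_2)
    finally have "(1 / 2) *\<^sub>R (2 *\<^sub>R Z t) \<in> moment_cone" by (rule moment_cone_scaleR) simp
    then show ?thesis by simp
  qed
  define y where "y t = 2 / \<mu> * pairing (P t) (Z t)" for t
  have "0 \<le> y t \<and> trace (Z t) \<le> y t - y (Suc t) + (2 / \<mu> * (d * (CARD('n) * \<nu>))) / real t" if "t \<ge> t3" for t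
  proof
    have t: "t \<ge> t\<^sub>0" "Suc t \<ge> t\<^sub>0" "t \<ge> t1" "1 \<le> t" "real t \<ge> real n1"
      using that t1 t3 by (auto simp: t3_def)
    note Zt = Zcone[OF that]
    show "0 \<le> y t" unfolding y_def using \<mu>_pos pairing_nonneg[OF Zt P_nonneg[OF t(1)]] by simp
    have small: "c / t \<le> \<mu> / 2"
    proof -
      have "2 * c / \<mu> \<le> real t" using n1 t(5) by linarith
      then show ?thesis using t(4) \<mu>_pos by (simp add: field_simps)
    qed
    have "pairing (P (Suc t)) (Z (Suc t)) \<le> pairing (P (Suc t)) (Z t) - \<mu> * trace (Z t) + d / t * trace (P (Suc t))"
      unfolding ZS[OF that] pairing_add_right pairing_scaleR_right pairing_identity
      using P_decrease[OF t(2) Zt] by simp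
    moreover have "pairing (P (Suc t)) (Z t) - pairing (P t) (Z t) \<le> \<mu> / 2 * trace (Z t)"
    proof -
      have "pairing (P (Suc t) - P t) (Z t) \<le> c / t * trace (Z t)"
        by (rule pairing_le_trace[OF Zt]) (use dP[OF t(3)] in \<open>auto simp: qf_diff abs_le_iff\<close>)
      also have "\<dots> \<le> \<mu> / 2 * trace (Z t)" by (rule mult_right_mono[OF small trace_nonneg[OF Zt]])
      finally show ?thesis by (simp add: pairing_diff_left)
    qed
    moreover have "d / t * trace (P (Suc t)) \<le> d / t * (CARD('n) * \<nu>)"
      using trace_P_le[OF t(2)] d by (intro mult_left_mono) auto
    ultimately have "\<mu> / 2 * trace (Z t) \<le> pairing (P t) (Z t) - pairing (P (Suc t)) (Z (Suc t)) + d / t * (CARD('n) * \<nu>)"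
      by (simp add: algebra_simps)
    then have "2 / \<mu> * (\<mu> / 2 * trace (Z t))
        \<le> 2 / \<mu> * (pairing (P t) (Z t) - pairing (P (Suc t)) (Z (Suc t)) + d / t * (CARD('n) * \<nu>))"
      using \<mu>_pos by (intro mult_left_mono) auto
    then show "trace (Z t) \<le> y t - y (Suc t) + (2 / \<mu> * (d * (CARD('n) * \<nu>))) / real t"
      using \<mu>_pos unfolding y_def by (simp add: algebra_simps)
  qed
  moreover have "0 \<le> 2 / \<mu> * (d * (CARD('n) * \<nu>))" using \<mu>_pos d \<nu>_pos by simp
  ultimately show thesis using that[of "2 / \<mu> * (d * (CARD('n) * \<nu>))" t3 Z y] t3 dom by blast
qed

definition run_cost :: "nat \<Rightarrow> real" where
  "run_cost t = pairing (Q t + transpose (K t) ** R t ** K t) (X t)"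

text \<open>Since the running averages satisfy \<open>t Qb\<^sub>t = (t - 1) Qb\<^sub>t\<^sub>-\<^sub>1 + Q\<^sub>t\<close>, the stage cost at time \<open>t\<close> is the
  Bellman residual of \<open>N = t P\<^sub>t - (t - 1) P\<^sub>t\<^sub>-\<^sub>1\<close> up to \<open>t - 1\<close> times the loss of the last improvement step.
  The noise contribution of \<open>N\<close> telescopes, and the rest is controlled by the increments of the moments.\<close>

lemma run_cost_step:
  assumes s: "s \<ge> t\<^sub>0" "Suc s \<ge> t\<^sub>0"
    and gap: "\<And>x. qf (P s) x \<le> \<Phi> s (P s) (K (Suc s)) x + c / (real s)\<^sup>2 * (norm x)\<^sup>2"
  defines "N \<equiv> real (Suc s) *\<^sub>R P (Suc s) - real s *\<^sub>R P s"
  shows "run_cost (Suc s) \<le> real (Suc s) * pairing (P (Suc s)) W - real s * pairing (P s) W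
    - pairing N (X (Suc (Suc s)) - X (Suc s)) + c / real s * trace (X (Suc s))"
proof -
  have s1: "1 \<le> Suc s" "real s > 0" using s t\<^sub>0_pos by auto
  let ?X = "X (Suc s)" and ?L = "L (Suc s)" and ?K = "K (Suc s)"
  have form: "qf (Q (Suc s) + transpose ?K ** R (Suc s) ** ?K) x
      \<le> qf (N - transpose ?L ** N ** ?L + (c / s) *\<^sub>R mat 1) x" for x
  proof -
    have q: "real (Suc s) * qf (Qb (Suc s)) x = real s * qf (Qb s) x + qf (Q (Suc s)) x"
      using arg_cong[OF running_average_Suc[of s Q], of "\<lambda>S. qf S x"]
      by (simp only: qf_add qf_scaleR)
    have r: "real (Suc s) * qf (Rb (Suc s)) (?K *v x) = real s * qf (Rb s) (?K *v x) + qf (R (Suc s)) (?K *v x)"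
      using arg_cong[OF running_average_Suc[of s R], of "\<lambda>S. qf S (?K *v x)"]
      by (simp only: qf_add qf_scaleR)
    have v: "real (Suc s) * qf (P (Suc s)) x
        = real (Suc s) * qf (P (Suc s)) (?L *v x) + real (Suc s) * qf (Qb (Suc s)) x + real (Suc s) * qf (Rb (Suc s)) (?K *v x)"
      using P_bellman[OF s(2), of x] unfolding bellman_def by (simp only: distrib_left)
    have "real s * qf (P s) x \<le> real s * (\<Phi> s (P s) ?K x + c / (real s)\<^sup>2 * (norm x)\<^sup>2)"
      using gap by (intro mult_left_mono) auto
    also have "\<dots> = real s * qf (P s) (?L *v x) + real s * qf (Qb s) x + real s * qf (Rb s) (?K *v x) + c / s * (norm x)\<^sup>2"
      using s1 unfolding bellman_def by (simp add: distrib_left power2_eq_square)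
    finally show ?thesis
      using q r v unfolding N_def qf_add qf_diff qf_scaleR qf_congruence qf_mat_1 by linarith
  qed
  have X: "?X \<in> moment_cone" by (rule X_cone[OF s1(1)])
  have "run_cost (Suc s) \<le> pairing (N - transpose ?L ** N ** ?L + (c / s) *\<^sub>R mat 1) ?X"
    unfolding run_cost_def by (rule pairing_mono[OF X form])
  also have "\<dots> = pairing N ?X - pairing N (X (Suc (Suc s)) - W) + c / s * trace ?X"
  proof -
    have "X (Suc (Suc s)) - W = ?L ** ?X ** transpose ?L" by (simp add: X_step[OF s1(1)])
    then have "pairing N (X (Suc (Suc s)) - W) = pairing (transpose ?L ** N ** ?L) ?X"
      by (simp only: pairing_congruence)
    then show ?thesis by (simp add: pairing_add_left pairing_diff_left pairing_scaleR_left) (simp add: pairing_def)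
  qed
  finally show ?thesis
    by (simp add: N_def pairing_diff_right pairing_diff_left pairing_scaleR_left)
qed

text \<open>Summing the stage bounds: the terms \<open>t P\<^sub>t\<close> and the potential \<open>y\<close> of the dominating sequence telescope, and
  the remaining terms of order \<open>1 / t\<close> produce the logarithm.\<close>

theorem run_cost_upper:
  obtains C t\<^sub>1 where "0 \<le> C" "t\<^sub>1 \<ge> t\<^sub>0"
    "\<And>T. T \<ge> t\<^sub>1 \<Longrightarrow> (\<Sum>t=1..T. run_cost t) \<le> real T * pairing (P T) W + C * (1 + ln (real T))"
proof -
  obtain c t1 where c: "0 \<le> c" and t1: "t1 \<ge> t\<^sub>0"
    and dP: "\<And>t x. t \<ge> t1 \<Longrightarrow> \<bar>qf (P (Suc t)) x - qf (P t) x\<bar> \<le> c / real t * (norm x)\<^sup>2"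
    and gap: "\<And>t x. t \<ge> t1 \<Longrightarrow> qf (P t) x \<le> \<Phi> t (P t) (K (Suc t)) x + c / (real t)\<^sup>2 * (norm x)\<^sup>2"
    by (rule convergence_rates) (rule that)
  obtain b t2 where b: "0 \<le> b" "t2 \<ge> t\<^sub>0" "\<And>t. t \<ge> t2 \<Longrightarrow> trace (X t) \<le> b"
    by (rule moments_bounded) (rule that)
  obtain Z :: "nat \<Rightarrow> real ^ 'n ^ 'n" and y g t3 where g: "0 \<le> g" and t3: "t3 \<ge> t\<^sub>0"
    and dom: "\<And>t. t \<ge> t3 \<Longrightarrow> Z t + (X (Suc t) - X t) \<in> moment_cone"
      "\<And>t. t \<ge> t3 \<Longrightarrow> Z t - (X (Suc t) - X t) \<in> moment_cone"
    and Z: "\<And>t. t \<ge> t3 \<Longrightarrow> 0 \<le> y t \<and> trace (Z t) \<le> y t - y (Suc t) + g / real t"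
    by (rule increments_dominated) (rule that)
  define \<tau> where "\<tau> = max t1 (max t2 t3)"
  define n where "n = \<nu> + c"
  define h where "h = n * g + c * b"
  have n: "0 \<le> n" using \<nu>_pos c by (simp add: n_def)
  have h: "0 \<le> h" using n g c b by (simp add: h_def)
  have \<tau>: "\<tau> \<ge> t\<^sub>0" "1 \<le> \<tau>" using t1 t\<^sub>0_pos by (auto simp: \<tau>_def)
  have cost_step: "run_cost (Suc s) \<le> real (Suc s) * pairing (P (Suc s)) W - real s * pairing (P s) W
      + n * (y (Suc s) - y (Suc (Suc s))) + h / s" if "s \<ge> \<tau>" for s
  proof -
    have s: "s \<ge> t\<^sub>0" "Suc s \<ge> t\<^sub>0" "s \<ge> t1" "Suc s \<ge> t2" "Suc s \<ge> t3" "real s > 0"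
      using that \<tau> by (auto simp: \<tau>_def)
    define N where "N = real (Suc s) *\<^sub>R P (Suc s) - real s *\<^sub>R P s"
    define D where "D = X (Suc (Suc s)) - X (Suc s)"
    have N: "\<bar>qf N x\<bar> \<le> n * (norm x)\<^sup>2" for x
    proof -
      have "qf N x = qf (P (Suc s)) x + real s * (qf (P (Suc s)) x - qf (P s) x)"
        unfolding N_def qf_diff qf_scaleR of_nat_Suc by (simp add: algebra_simps)
      then have "\<bar>qf N x\<bar> \<le> \<bar>qf (P (Suc s)) x\<bar> + real s * \<bar>qf (P (Suc s)) x - qf (P s) x\<bar>"
        by (metis abs_mult abs_of_nat abs_triangle_ineq)
      also have "\<dots> \<le> \<nu> * (norm x)\<^sup>2 + real s * (c / real s * (norm x)\<^sup>2)"
        using P_upper[OF s(2)] P_nonneg[OF s(2)] dP[OF s(3)] by (intro add_mono mult_left_mono) auto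
      also have "\<dots> = n * (norm x)\<^sup>2" using s by (simp add: n_def distrib_right)
      finally show ?thesis .
    qed
    have "- pairing N D \<le> n * trace (Z (Suc s))"
    proof -
      have "0 \<le> pairing (n *\<^sub>R mat 1 + N) (Z (Suc s) + D)"
        using N by (intro pairing_nonneg dom(1)[OF s(5), folded D_def])
          (auto simp: qf_add qf_scaleR qf_mat_1 abs_le_iff, smt (verit))
      moreover have "0 \<le> pairing (n *\<^sub>R mat 1 - N) (Z (Suc s) - D)"
        using N by (intro pairing_nonneg dom(2)[OF s(5), folded D_def])
          (auto simp: qf_diff qf_scaleR qf_mat_1 abs_le_iff)
      ultimately show ?thesis by (simp add: pairing_linear) (simp add: pairing_def)
    qed
    also have "\<dots> \<le> n * (y (Suc s) - y (Suc (Suc s)) + g / real (Suc s))"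
      using Z[OF s(5)] n by (intro mult_left_mono) auto
    also have "\<dots> \<le> n * (y (Suc s) - y (Suc (Suc s))) + n * g / s"
    proof -
      have "n * (g / real (Suc s)) \<le> n * (g / real s)" using n g s by (intro mult_left_mono divide_left_mono) auto
      then show ?thesis by (simp add: distrib_left)
    qed
    finally have 1: "- pairing N D \<le> n * (y (Suc s) - y (Suc (Suc s))) + n * g / s" .
    have 2: "c / s * trace (X (Suc s)) \<le> c / s * b" using b(3)[OF s(4)] c by (intro mult_left_mono) auto
    have 3: "h / s = n * g / s + c / s * b" by (simp add: h_def add_divide_distrib)
    show ?thesis
      using run_cost_step[OF s(1,2) gap[OF s(3)], folded N_def D_def] 1 2 3 by linarith
  qed
  define C0 where "C0 = \<bar>\<Sum>t=1..\<tau>. run_cost t\<bar> + n * y (Suc \<tau>)"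
  have y0: "0 \<le> y t" if "t \<ge> \<tau>" for t using Z[of t] that by (simp add: \<tau>_def)
  have C0: "0 \<le> C0" using y0[of "Suc \<tau>"] n by (simp add: C0_def)
  have total: "(\<Sum>t=1..T. run_cost t) + n * y (Suc T) \<le> real T * pairing (P T) W + C0 + 2 * h * ln (real T)"
    if "T \<ge> \<tau>" for T
    using that
  proof (induction T rule: dec_induct)
    case base
    have "0 \<le> pairing (P \<tau>) W" by (rule pairing_nonneg[OF W_cone P_nonneg[OF \<tau>(1)]])
    then have "0 \<le> real \<tau> * pairing (P \<tau>) W" "0 \<le> 2 * h * ln (real \<tau>)" using h \<tau> by simp_all
    moreover have "(\<Sum>t=1..\<tau>. run_cost t) + n * y (Suc \<tau>) \<le> C0" by (simp add: C0_def)
    ultimately show ?case by linarith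
  next
    case (step s)
    have "h / s \<le> 2 * h * ln (real (Suc s)) - 2 * h * ln (real s)"
      using mult_left_mono[OF inverse_le_ln_diff[of s] h] \<tau> step(1) by (simp add: algebra_simps)
    moreover have "n * (y (Suc s) - y (Suc (Suc s))) = n * y (Suc s) - n * y (Suc (Suc s))"
      by (rule right_diff_distrib)
    ultimately show ?case
      using step(3) cost_step[OF step(1)] unfolding sum_step by linarith
  qed
  have "(\<Sum>t=1..T. run_cost t) \<le> real T * pairing (P T) W + (C0 + 2 * h) * (1 + ln (real T))"
    if "T \<ge> \<tau>" for T
  proof -
    have "0 \<le> n * y (Suc T)" using y0[of "Suc T"] n that by simp
    moreover have "0 \<le> ln (real T)" using that \<tau> by simp
    then have "0 \<le> C0 * ln (real T)" using C0 by simp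
    ultimately show ?thesis
      using total[OF that] h by (simp add: algebra_simps)
  qed
  then show thesis using C0 h \<tau> by (intro that[of "C0 + 2 * h" \<tau>]) auto
qed

end


section \<open>Lower bound for fixed policies\<close>

text \<open>Bookkeeping for a fixed policy: \<open>a j\<close>, \<open>c j\<close>, \<open>p j\<close> stand for the size, the average stage cost and
  the value of the noise injected \<open>j\<close> steps ago. The delayed start of the contributions costs
  \<open>\<sigma> (j + 1) a j\<close>; Abel summation charges this to the sum of the values and to the nonnegative Bellman
  defects \<open>p (j + 1) - p j + c j + e a j\<close>, which already occur with the larger weight \<open>T\<close>.\<close>

lemma delayed_cost_accounting:
  fixes a p c :: "nat \<Rightarrow> real"
  assumes "0 < \<mu>" "\<mu> \<le> \<sigma>" "0 \<le> e" "0 \<le> T" "0 \<le> \<nu>"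
    and ac: "\<And>j. \<mu> * a j \<le> c j" and a0: "\<And>j. 0 \<le> a j"
    and p0: "\<And>j. 0 \<le> p j" and pa: "\<And>j. p j \<le> \<nu> * a j"
    and defect: "\<And>j. 0 \<le> p (Suc j) - p j + c j + e * a j"
    and total: "(\<Sum>j<m. a j) \<le> S" and m: "\<sigma> / \<mu> * real m \<le> T"
  shows "T * p 0 - T * p m - T * e * S - \<sigma> / \<mu> * \<nu> * S \<le> (\<Sum>j<m. T * c j - real (Suc j) * \<sigma> * a j)"
proof -
  define d where "d j = p (Suc j) - p j + c j + e * a j" for j
  define D where "D = (\<Sum>j<m. d j)"
  have d: "0 \<le> d j" for j unfolding d_def by (rule defect)
  have D: "0 \<le> D" unfolding D_def by (intro sum_nonneg d)
  have c: "c j = p j - p (Suc j) + d j - e * a j" for j by (simp add: d_def)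
  have abel: "(\<Sum>j<m. real (Suc j) * (p j - p (Suc j))) = (\<Sum>j<m. p j) - real m * p m" for m
    by (induction m) (auto simp: algebra_simps)
  have "(\<Sum>j<m. real (Suc j) * \<sigma> * a j) \<le> (\<Sum>j<m. \<sigma> / \<mu> * (real (Suc j) * c j))"
  proof (rule sum_mono)
    fix j
    have "\<sigma> / \<mu> * real (Suc j) * (\<mu> * a j) \<le> \<sigma> / \<mu> * real (Suc j) * c j"
      using assms(1,2) by (intro mult_left_mono ac) auto
    then show "real (Suc j) * \<sigma> * a j \<le> \<sigma> / \<mu> * (real (Suc j) * c j)"
      using assms(1) by (simp add: mult_ac)
  qed
  also have "\<dots> = \<sigma> / \<mu> * (\<Sum>j<m. real (Suc j) * c j)" by (simp only: sum_distrib_left)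
  also have "\<dots> \<le> \<sigma> / \<mu> * (\<nu> * S + real m * D)"
  proof (rule mult_left_mono)
    show "(\<Sum>j<m. real (Suc j) * c j) \<le> \<nu> * S + real m * D"
    proof -
      have "(\<Sum>j<m. real (Suc j) * c j) \<le> (\<Sum>j<m. real (Suc j) * (p j - p (Suc j)) + real m * d j)"
      proof (rule sum_mono)
        fix j assume "j \<in> {..<m}"
        then have "real (Suc j) * d j \<le> real m * d j" using d by (intro mult_right_mono) auto
        moreover have "0 \<le> real (Suc j) * (e * a j)" using a0[of j] assms(3) by simp
        moreover have "real (Suc j) * c j
            = real (Suc j) * (p j - p (Suc j)) + real (Suc j) * d j - real (Suc j) * (e * a j)"
          unfolding c by (simp only: distrib_left right_diff_distrib)
        ultimately show "real (Suc j) * c j \<le> real (Suc j) * (p j - p (Suc j)) + real m * d j" by linarith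
      qed
      also have "\<dots> = (\<Sum>j<m. p j) - real m * p m + real m * D"
        unfolding sum.distrib abel D_def sum_distrib_left ..
      also have "(\<Sum>j<m. p j) \<le> (\<Sum>j<m. \<nu> * a j)" by (intro sum_mono pa)
      also have "\<dots> = \<nu> * (\<Sum>j<m. a j)" by (simp only: sum_distrib_left)
      also have "\<dots> \<le> \<nu> * S" using total assms(5) by (rule mult_left_mono)
      finally have "(\<Sum>j<m. real (Suc j) * c j) \<le> \<nu> * S - real m * p m + real m * D" by simp
      moreover have "0 \<le> real m * p m" using p0[of m] by simp
      ultimately show ?thesis by linarith
    qed
  qed (use assms(1,2) in simp)
  finally have 1: "(\<Sum>j<m. real (Suc j) * \<sigma> * a j) \<le> \<sigma> / \<mu> * (\<nu> * S + real m * D)" .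
  have "\<sigma> / \<mu> * (\<nu> * S + real m * D) = \<sigma> / \<mu> * \<nu> * S + \<sigma> / \<mu> * real m * D" by (simp add: distrib_left)
  also have "\<sigma> / \<mu> * real m * D \<le> T * D" by (rule mult_right_mono[OF m D])
  finally have 2: "(\<Sum>j<m. real (Suc j) * \<sigma> * a j) \<le> \<sigma> / \<mu> * \<nu> * S + T * D" using 1 by simp
  have "(\<Sum>j<m. c j) = (\<Sum>j<m. p j - p (Suc j)) + D - e * (\<Sum>j<m. a j)"
    unfolding c D_def by (simp only: sum.distrib sum_subtractf sum_distrib_left)
  also have "(\<Sum>j<m. p j - p (Suc j)) = p 0 - p m" by (rule sum_lessThan_telescope')
  finally have "p 0 - p m + D - e * S \<le> (\<Sum>j<m. c j)"
    using mult_left_mono[OF total assms(3)] by simp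
  from mult_left_mono[OF this assms(4)]
  have "T * p 0 - T * p m + T * D - T * e * S \<le> (\<Sum>j<m. T * c j)"
    by (simp only: sum_distrib_left right_diff_distrib distrib_left mult.assoc)
  with 2 show ?thesis unfolding sum_subtractf by linarith
qed

context value_tracking
begin

text \<open>Only the noise terms injected fewer than \<open>m\<close> steps ago are kept, where \<open>m\<close> is at most a fixed fraction of
  the horizon and the value remaining at age \<open>m\<close> is \<open>O(1 / T)\<close>. Such an \<open>m\<close> exists by averaging, unless the policy
  costs at least \<open>T \<nu> trace W\<close>, which exceeds the bound. Since no noise is followed beyond the age \<open>m\<close>, the
  constant is the same for all policies, however close to instability.\<close>

theorem fixed_policy_lower:
  assumes W: "W \<in> moment_cone"
  obtains C t\<^sub>1 where "0 \<le> C" "t\<^sub>1 \<ge> t\<^sub>0"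
    "\<forall>T\<ge>t\<^sub>1. \<forall>k X. X 1 \<in> moment_cone
      \<longrightarrow> (\<forall>t\<ge>1. X (Suc t) = (A - B ** k) ** X t ** transpose (A - B ** k) + W)
      \<longrightarrow> real T * pairing (P T) W - C \<le> (\<Sum>t=1..T. pairing (Q t + transpose k ** R t ** k) (X t))"
proof -
  obtain c t1 where c: "0 \<le> c" and t1: "t1 \<ge> t\<^sub>0"
    and gap: "\<And>t x. t \<ge> t1 \<Longrightarrow> qf (P t) x \<le> \<Phi> t (P t) (K (Suc t)) x + c / (real t)\<^sup>2 * (norm x)\<^sup>2"
    by (rule improvement_gap) (rule that)
  have \<nu>: "0 < \<nu>" using \<mu>_pos \<mu>_le_\<nu> by simp
  \<comment> \<open>The fraction \<open>\<epsilon>\<close> of the horizon is small enough for the delay costs to be absorbed by the defects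
      (\<open>\<mu> / \<sigma>\<close>) and for every kept noise term to be present during half of the horizon (\<open>1 / 2\<close>).\<close>
  define \<epsilon> where "\<epsilon> = min (1 / 2) (\<mu> / \<sigma>)"
  have \<epsilon>: "0 < \<epsilon>" using \<mu>_pos \<mu>_le_\<sigma> by (simp add: \<epsilon>_def)
  have \<epsilon>_le: "\<epsilon> \<le> 1 / 2" "\<epsilon> \<le> \<mu> / \<sigma>"
    unfolding \<epsilon>_def by (rule min.cobounded1, rule min.cobounded2)
  define C0 where "C0 = \<nu> * trace W"
  have C0: "0 \<le> C0" using \<nu> trace_nonneg[OF W] by (simp add: C0_def)
  define S where "S = 2 * C0 / \<mu>"
  have S: "0 \<le> S" using C0 \<mu>_pos by (simp add: S_def)
  define C where "C = 2 * \<nu> * S / \<epsilon> + c * S + \<sigma> / \<mu> * \<nu> * S"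
  have C: "0 \<le> C" unfolding C_def using \<nu> S c \<epsilon> \<mu>_pos \<mu>_le_\<sigma> by simp
  obtain n1 :: nat where n1: "1 / \<epsilon> \<le> real n1" using real_arch_simple by blast
  have main: "real T * pairing (P T) W - C \<le> (\<Sum>t=1..T. pairing (Q t + transpose k ** R t ** k) (X t))"
    if T: "T \<ge> max t1 n1" and X1: "X 1 \<in> moment_cone"
      and XS: "\<And>t. t \<ge> 1 \<Longrightarrow> X (Suc t) = (A - B ** k) ** X t ** transpose (A - B ** k) + W"
    for T k X
  proof -
    let ?L = "A - B ** k"
    have Tt: "T \<ge> t\<^sub>0" "T \<ge> t1" "1 \<le> T" "real n1 \<le> real T" using T t1 t\<^sub>0_pos by auto
    \<comment> \<open>\<open>G j\<close> is the second moment of noise of age \<open>j\<close>.\<close>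
    define G where "G j = ((\<lambda>Y. ?L ** Y ** transpose ?L) ^^ j) W" for j
    have G0: "G 0 = W" and GS: "G (Suc j) = ?L ** G j ** transpose ?L" for j by (simp_all add: G_def)
    have G: "G j \<in> moment_cone" for j
      by (induction j) (simp_all only: G0 GS W moment_cone_congruence)
    have zero: "?L ** 0 ** transpose ?L = 0" by (simp add: matrix_matrix_mult_def vec_eq_iff)
    have Lsum: "?L ** (\<Sum>j<s. G j) ** transpose ?L = (\<Sum>j<s. G (Suc j))" for s
      by (induction s) (simp_all only: sum.lessThan_Suc lessThan_0 sum.empty matrix_mult_add_middle zero GS)
    have XG: "\<exists>Y \<in> moment_cone. X (Suc s) = Y + (\<Sum>j<s. G j)" for s
    proof (induction s)
      case 0 then show ?case using X1 by simp
    next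
      case (Suc s)
      then obtain Y where Y: "Y \<in> moment_cone" "X (Suc s) = Y + (\<Sum>j<s. G j)" by blast
      have "X (Suc (Suc s)) = ?L ** Y ** transpose ?L + (W + (\<Sum>j<s. G (Suc j)))"
        using XS[of "Suc s"] unfolding Y(2) matrix_mult_add_middle Lsum by (simp add: add_ac)
      also have "W + (\<Sum>j<s. G (Suc j)) = (\<Sum>j<Suc s. G j)"
        unfolding sum.lessThan_Suc_shift G0 ..
      finally show ?case using moment_cone_congruence[OF Y(1)] by blast
    qed
    \<comment> \<open>All stage costs lie between \<open>\<mu> M\<^sub>0\<close> and \<open>\<sigma> M\<^sub>0\<close>.\<close>
    define M\<^sub>0 where "M\<^sub>0 = mat 1 + transpose k ** k"
    have M0: "qf M\<^sub>0 x = (norm x)\<^sup>2 + (norm (k *v x))\<^sup>2" for x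
      using qf_congruence[of k "mat 1" x] by (simp add: M\<^sub>0_def qf_add qf_mat_1)
    define a where "a j = pairing M\<^sub>0 (G j)" for j
    define q where "q t j = pairing (Q t + transpose k ** R t ** k) (G j)" for t j
    define cb where "cb j = pairing (Qb T + transpose k ** Rb T ** k) (G j)" for j
    define p where "p j = pairing (P T) (G j)" for j
    have tr: "trace (G j) \<le> a j" for j
      using trace_le_pairing[OF G, of 1 M\<^sub>0 j] by (simp add: a_def M0)
    have a0: "0 \<le> a j" for j using tr[of j] trace_nonneg[OF G[of j]] by simp
    have form: "qf (\<mu> *\<^sub>R M\<^sub>0) x \<le> qf (Q t + transpose k ** R t ** k) x \<and>
        qf (Q t + transpose k ** R t ** k) x \<le> qf (\<sigma> *\<^sub>R M\<^sub>0) x" if "t \<ge> 1" for t x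
      using Q_bounds[OF that, of x] R_bounds[OF that, of "k *v x"]
      by (simp add: qf_add qf_scaleR qf_congruence M0 distrib_left)
    have qlo: "\<mu> * a j \<le> q t j" and qup: "q t j \<le> \<sigma> * a j" if "t \<ge> 1" for t j
      unfolding a_def q_def pairing_scaleR_left[symmetric] using form[OF that] by (auto intro!: pairing_mono G)
    have q0: "0 \<le> q t j" if "t \<ge> 1" for t j
      using qlo[OF that, of j] a0[of j] \<mu>_pos by (smt (verit) mult_nonneg_nonneg)
    have cb: "real T * cb j = (\<Sum>t=1..T. q t j)" for j
    proof -
      have "real T * cb j = pairing (real T *\<^sub>R Qb T) (G j) + pairing (real T *\<^sub>R Rb T) (k ** G j ** transpose k)"
        by (simp only: cb_def pairing_add_left pairing_scaleR_left pairing_congruence[symmetric] distrib_left)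
      also have "\<dots> = (\<Sum>t=1..T. q t j)"
        unfolding running_average_sum pairing_sum_left q_def pairing_add_left pairing_congruence[symmetric] sum.distrib ..
      finally show ?thesis .
    qed
    have ac: "\<mu> * a j \<le> cb j" for j
    proof -
      have "(\<Sum>t=1..T. \<mu> * a j) \<le> (\<Sum>t=1..T. q t j)" by (intro sum_mono qlo) auto
      then have "real T * (\<mu> * a j) \<le> real T * cb j" unfolding cb by simp
      then show ?thesis by (rule mult_left_le_imp_le) (use Tt in simp)
    qed
    have p0: "0 \<le> p j" for j unfolding p_def by (rule pairing_nonneg[OF G P_nonneg[OF Tt(1)]])
    have pa: "p j \<le> \<nu> * a j" for j
      unfolding p_def
      by (rule order_trans[OF pairing_le_trace[OF G P_upper[OF Tt(1)]] mult_left_mono[OF tr]])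
        (use \<nu> in simp)
    define e where "e = c / (real T)\<^sup>2"
    have e: "0 \<le> e" using c by (simp add: e_def)
    have defect: "0 \<le> p (Suc j) - p j + cb j + e * a j" for j
    proof -
      have "p j \<le> pairing (transpose ?L ** P T ** ?L + (Qb T + transpose k ** Rb T ** k) + e *\<^sub>R mat 1) (G j)"
        unfolding p_def
      proof (rule pairing_mono[OF G])
        fix x
        show "qf (P T) x \<le> qf (transpose ?L ** P T ** ?L + (Qb T + transpose k ** Rb T ** k) + e *\<^sub>R mat 1) x"
          using gap[OF Tt(2), of x] K_minimizes[OF Tt(1), of x k]
          unfolding bellman_def qf_add qf_congruence qf_scaleR qf_mat_1 e_def by linarith
      qed
      also have "\<dots> = p (Suc j) + cb j + e * trace (G j)"
        by (simp add: pairing_add_left pairing_scaleR_left p_def cb_def GS pairing_congruence) (simp add: pairing_def)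
      finally show ?thesis using mult_left_mono[OF tr[of j] e] by linarith
    qed
    define J where "J = (\<Sum>t=1..T. pairing (Q t + transpose k ** R t ** k) (X t))"
    \<comment> \<open>\<open>I j\<close> is the cost up to time \<open>T\<close> of noise of age \<open>j\<close>, which is present from time \<open>j + 2\<close> on.\<close>
    define I where "I j = (\<Sum>t=1..T. if Suc j < t then q t j else 0)" for j
    have JI: "(\<Sum>j<m. I j) \<le> J" for m
    proof -
      have "(\<Sum>j<m. I j) = (\<Sum>t=1..T. \<Sum>j<m. if Suc j < t then q t j else 0)"
        unfolding I_def by (rule sum.swap)
      also have "\<dots> \<le> J"
        unfolding J_def
      proof (rule sum_mono)
        fix t assume t: "t \<in> {1..T}"
        then obtain s where s: "t = Suc s" by (cases t) auto
        have "(\<Sum>j<m. if Suc j < t then q t j else 0) = (\<Sum>j\<in>{..<m} \<inter> {j. Suc j < t}. q t j)"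
          by (simp add: sum.inter_restrict)
        also have "\<dots> \<le> (\<Sum>j<s. q t j)" using t by (intro sum_mono2 q0) (auto simp: s)
        also have "\<dots> = pairing (Q t + transpose k ** R t ** k) (\<Sum>j<s. G j)"
          by (simp only: q_def pairing_sum_right)
        also have "\<dots> \<le> pairing (Q t + transpose k ** R t ** k) (X t)"
        proof -
          obtain Y where Y: "Y \<in> moment_cone" "X (Suc s) = Y + (\<Sum>j<s. G j)" using XG by blast
          have "0 \<le> qf (Q t + transpose k ** R t ** k) x" for x
            using form[of t x] t \<mu>_pos by (simp add: qf_scaleR M0) (smt (verit) mult_nonneg_nonneg zero_le_power2)
          then show ?thesis unfolding s Y(2) pairing_add_right using pairing_nonneg[OF Y(1)] by (simp add: s)
        qed
        finally show "(\<Sum>j<m. if Suc j < t then q t j else 0) \<le> pairing (Q t + transpose k ** R t ** k) (X t)" .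
      qed
      finally show ?thesis .
    qed
    have Ilo: "real T * cb j - real (Suc j) * \<sigma> * a j \<le> I j" for j
    proof -
      have "(\<Sum>t=1..T. if Suc j < t then 0 else q t j) = (\<Sum>t\<in>{1..T} \<inter> {t. \<not> Suc j < t}. q t j)"
        by (simp add: sum.inter_restrict if_not_P) (rule sum.cong, auto)
      also have "\<dots> \<le> (\<Sum>t=1..Suc j. q t j)" by (intro sum_mono2 q0) auto
      also have "\<dots> \<le> (\<Sum>t=1..Suc j. \<sigma> * a j)" by (intro sum_mono qup) auto
      finally have "(\<Sum>t=1..T. if Suc j < t then 0 else q t j) \<le> real (Suc j) * (\<sigma> * a j)" by simp
      moreover have "(\<Sum>t=1..T. q t j) = I j + (\<Sum>t=1..T. if Suc j < t then 0 else q t j)"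
        unfolding I_def sum.distrib[symmetric] by (rule sum.cong) auto
      ultimately show ?thesis unfolding cb by (simp add: mult.assoc)
    qed
    have Ilo': "(real T - real (Suc j)) * (\<mu> * a j) \<le> I j" for j
    proof -
      have "(real T - real (Suc j)) * (\<mu> * a j) \<le> real (card {Suc (Suc j)..T}) * (\<mu> * a j)"
        using a0[of j] \<mu>_pos by (intro mult_right_mono) auto
      also have "\<dots> = (\<Sum>t\<in>{Suc (Suc j)..T}. \<mu> * a j)" by simp
      also have "\<dots> \<le> (\<Sum>t\<in>{Suc (Suc j)..T}. if Suc j < t then q t j else 0)" by (intro sum_mono) (auto intro: qlo)
      also have "\<dots> \<le> I j" unfolding I_def by (intro sum_mono2) (auto intro: q0)
      finally show ?thesis .
    qed
    have p0W: "p 0 = pairing (P T) W" by (simp add: p_def G0)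
    show ?thesis
    proof (cases "real T * C0 \<le> J")
      case True
      have "p 0 \<le> C0" unfolding p0W C0_def by (rule pairing_le_trace[OF W P_upper[OF Tt(1)]])
      then have "real T * p 0 \<le> real T * C0" by (rule mult_left_mono) simp
      then show ?thesis using True C unfolding p0W J_def by linarith
    next
      case False
      define M where "M = nat \<lfloor>\<epsilon> * real T\<rfloor>"
      have \<epsilon>T: "1 \<le> \<epsilon> * real T"
      proof -
        have "1 / \<epsilon> \<le> real T" using n1 Tt(4) by linarith
        then show ?thesis using \<epsilon> by (simp add: field_simps)
      qed
      have M: "1 \<le> M" "real M \<le> \<epsilon> * real T" "\<epsilon> * real T \<le> 2 * real M"
      proof -
        have fl: "1 \<le> \<lfloor>\<epsilon> * real T\<rfloor>" using \<epsilon>T by (simp add: le_floor_iff)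
        then have M: "real M = of_int \<lfloor>\<epsilon> * real T\<rfloor>" by (simp add: M_def)
        show "1 \<le> M" using fl unfolding M_def by linarith
        show "real M \<le> \<epsilon> * real T" unfolding M by (rule of_int_floor_le)
        have "\<epsilon> * real T < real M + 1" unfolding M using floor_correct[of "\<epsilon> * real T"] by simp
        then show "\<epsilon> * real T \<le> 2 * real M" using \<open>1 \<le> M\<close> by linarith
      qed
      have "\<epsilon> * real T \<le> 1 / 2 * real T" "\<epsilon> * real T \<le> \<mu> / \<sigma> * real T"
        using \<epsilon>_le by (intro mult_right_mono; simp)+
      then have M2: "2 * real M \<le> real T" "real M \<le> \<mu> / \<sigma> * real T" using M(2) by linarith+
      have MT: "\<sigma> / \<mu> * real M \<le> real T"
      proof -
        have "\<sigma> / \<mu> * real M \<le> \<sigma> / \<mu> * (\<mu> / \<sigma> * real T)"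
          using M2(2) \<mu>_pos \<mu>_le_\<sigma> by (intro mult_left_mono) auto
        then show ?thesis using \<mu>_pos \<mu>_le_\<sigma> by simp
      qed
      have aS: "(\<Sum>j<M. a j) \<le> S"
      proof -
        have "real T / 2 * (\<mu> * (\<Sum>j<M. a j)) = (\<Sum>j<M. real T / 2 * (\<mu> * a j))"
          by (simp only: sum_distrib_left)
        also have "\<dots> \<le> (\<Sum>j<M. I j)"
        proof (rule sum_mono)
          fix j assume "j \<in> {..<M}"
          then have "real (Suc j) \<le> real M" by (metis Suc_leI lessThan_iff of_nat_mono)
          then have "real T / 2 \<le> real T - real (Suc j)" using M2(1) by linarith
          then have "real T / 2 * (\<mu> * a j) \<le> (real T - real (Suc j)) * (\<mu> * a j)"
            using a0[of j] \<mu>_pos by (intro mult_right_mono) auto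
          then show "real T / 2 * (\<mu> * a j) \<le> I j" using Ilo'[of j] by linarith
        qed
        also have "\<dots> \<le> J" by (rule JI)
        also have "\<dots> \<le> real T / 2 * (2 * C0)" using False by simp
        finally have "\<mu> * (\<Sum>j<M. a j) \<le> 2 * C0" by (rule mult_left_le_imp_le) (use Tt in simp)
        then show ?thesis using \<mu>_pos by (simp add: S_def field_simps)
      qed
      have "\<exists>m<M. a m \<le> S / real M"
      proof (rule ccontr)
        assume "\<not> (\<exists>m<M. a m \<le> S / real M)"
        then have "(\<Sum>j<M. S / real M) < (\<Sum>j<M. a j)" using M(1)
          by (intro sum_strict_mono) (auto simp: not_le lessThan_empty_iff)
        then show False using aS M(1) by simp
      qed
      then obtain m where m: "m < M" "a m \<le> S / real M" by blast
      have am: "(\<Sum>j<m. a j) \<le> S"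
        using aS sum_mono2[of "{..<M}" "{..<m}" a] a0 m(1) by (simp add: subset_eq)
      have mT: "\<sigma> / \<mu> * real m \<le> real T"
      proof -
        have "\<sigma> / \<mu> * real m \<le> \<sigma> / \<mu> * real M" using m(1) \<mu>_pos \<mu>_le_\<sigma> by (intro mult_left_mono) auto
        then show ?thesis using MT by linarith
      qed
      have "real T * p 0 - real T * p m - real T * e * S - \<sigma> / \<mu> * \<nu> * S
          \<le> (\<Sum>j<m. real T * cb j - real (Suc j) * \<sigma> * a j)"
        by (rule delayed_cost_accounting[OF \<mu>_pos \<mu>_le_\<sigma> e _ _ ac a0 p0 pa defect am mT]) (use \<nu> in auto)
      also have "\<dots> \<le> (\<Sum>j<m. I j)" by (intro sum_mono Ilo)
      also have "\<dots> \<le> J" by (rule JI)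
      finally have fin: "real T * p 0 - real T * p m - real T * e * S - \<sigma> / \<mu> * \<nu> * S \<le> J" .
      have pm: "real T * p m \<le> 2 * \<nu> * S / \<epsilon>"
      proof -
        have "p m \<le> \<nu> * (S / real M)"
          by (rule order_trans[OF pa mult_left_mono[OF m(2)]]) (use \<nu> in simp)
        then have "\<epsilon> * real T * p m \<le> 2 * real M * (\<nu> * (S / real M))"
          by (rule mult_mono[OF M(3)]) (use p0[of m] in auto)
        also have "\<dots> = 2 * \<nu> * S" using M(1) by simp
        finally show ?thesis using \<epsilon> by (simp add: field_simps)
      qed
      have "real T * e \<le> c"
      proof -
        have "real T * e = c / real T" by (simp add: e_def power2_eq_square)
        also have "\<dots> \<le> c / 1" using c Tt(3) by (intro divide_left_mono) auto
        finally show ?thesis by simp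
      qed
      then have "real T * e * S \<le> c * S" using S by (intro mult_right_mono)
      with fin pm show ?thesis unfolding C_def p0W J_def by linarith
    qed
  qed
  show thesis
  proof (rule that[of C "max t1 n1", OF C])
    show "max t1 n1 \<ge> t\<^sub>0" using t1 by simp
  qed (intro allI impI main, auto)
qed

end


section \<open>Second moments\<close>

text \<open>A normal law of variance 0 is a point mass, which is treated separately.\<close>

lemma normal_law_moments:
  fixes Y :: "'s \<Rightarrow> real"
  assumes "prob_space M" and Y: "Y \<in> borel_measurable M" and law: "distr M borel Y = normal_law m v" and "0 \<le> v"
  shows "integrable M (\<lambda>s. (Y s)\<^sup>2)" and "(\<integral>s. Y s \<partial>M) = m"
    and "m = 0 \<Longrightarrow> (\<integral>s. (Y s)\<^sup>2 \<partial>M) = v"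
proof -
  have int: "integrable M (\<lambda>s. f (Y s)) \<longleftrightarrow> integrable (normal_law m v) f"
    and eq: "(\<integral>s. f (Y s) \<partial>M) = (\<integral>x. f x \<partial>normal_law m v)" if "f \<in> borel_measurable borel" for f :: "real \<Rightarrow> real"
    unfolding law[symmetric] using Y that by (simp_all add: integrable_distr_eq integral_distr)
  have "integrable (normal_law m v) (\<lambda>x. x\<^sup>2) \<and> (\<integral>x. x \<partial>normal_law m v) = m
      \<and> (m = 0 \<longrightarrow> (\<integral>x. x\<^sup>2 \<partial>normal_law m v) = v)"
  proof (cases "v = 0")
    case True
    then have law': "normal_law m v = return borel m" by (simp add: normal_law_def)
    have "integrable (return borel m) (\<lambda>x::real. x\<^sup>2)"
      by (rule integrableI_bounded) (simp_all add: nn_integral_return)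
    then show ?thesis using True unfolding law' by (simp add: integral_return)
  next
    case False
    then have v: "0 < v" "0 < sqrt v" using assms(4) by auto
    have law': "normal_law m v = density lborel (\<lambda>x. ennreal (normal_density m (sqrt v) x))"
      using False by (simp add: normal_law_def)
    have "integrable lborel (\<lambda>x. normal_density m (sqrt v) x * (x - m)^2
        + 2 * m * (normal_density m (sqrt v) x * x) - m\<^sup>2 * normal_density m (sqrt v) x)"
      using v by (intro Bochner_Integration.integrable_add Bochner_Integration.integrable_diff
          integrable_mult_right integrable_normal_moment integrable_normal_moment_nz_1 integrable_normal_density) auto
    also have "(\<lambda>x. normal_density m (sqrt v) x * (x - m)^2
        + 2 * m * (normal_density m (sqrt v) x * x) - m\<^sup>2 * normal_density m (sqrt v) x)
        = (\<lambda>x. normal_density m (sqrt v) x * x\<^sup>2)"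
      by (simp add: fun_eq_iff power2_eq_square algebra_simps)
    finally have "integrable lborel (\<lambda>x. normal_density m (sqrt v) x * x\<^sup>2)" .
    moreover have "(\<integral>x. normal_density m (sqrt v) x * x \<partial>lborel) = m"
      using v by (rule_tac integral_normal_moment_nz_1)
    moreover have "(\<integral>x. normal_density m (sqrt v) x * x\<^sup>2 \<partial>lborel) = v" if "m = 0"
      using integral_normal_moment_even[of "sqrt v" 0 1] v that by (simp add: power2_eq_square)
    ultimately show ?thesis
      unfolding law' by (auto simp: integrable_density integral_density)
  qed
  then have law_moments: "integrable (normal_law m v) (\<lambda>x. x\<^sup>2)" "(\<integral>x. x \<partial>normal_law m v) = m"
      "m = 0 \<Longrightarrow> (\<integral>x. x\<^sup>2 \<partial>normal_law m v) = v" by blast+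
  show "integrable M (\<lambda>s. (Y s)\<^sup>2)" by (subst int) (simp_all add: law_moments(1))
  show "(\<integral>s. Y s \<partial>M) = m" by (subst eq) (simp_all add: law_moments(2))
  show "(\<integral>s. (Y s)\<^sup>2 \<partial>M) = v" if "m = 0" by (subst eq) (simp_all add: law_moments(3)[OF that])
qed

definition square_integrable :: "'s measure \<Rightarrow> ('s \<Rightarrow> real ^ 'n) \<Rightarrow> bool" where
  "square_integrable M X \<longleftrightarrow> X \<in> borel_measurable M \<and> (\<forall>i. integrable M (\<lambda>s. (X s $ i)\<^sup>2))"

definition second_moment :: "'s measure \<Rightarrow> ('s \<Rightarrow> real ^ 'n) \<Rightarrow> real ^ 'n ^ 'n" where
  "second_moment M X = (\<chi> i j. \<integral>s. X s $ i * X s $ j \<partial>M)"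

definition uncorrelated :: "'s measure \<Rightarrow> ('s \<Rightarrow> real ^ 'n) \<Rightarrow> ('s \<Rightarrow> real ^ 'm) \<Rightarrow> bool" where
  "uncorrelated M X Y \<longleftrightarrow> (\<forall>i j. (\<integral>s. X s $ i * Y s $ j \<partial>M) = 0)"

lemma measurable_nth: "(\<lambda>x :: real ^ 'n. x $ i) \<in> borel_measurable borel"
  by (intro borel_measurable_continuous_onI continuous_intros)

lemma measurable_component: "X \<in> borel_measurable M \<Longrightarrow> (\<lambda>s. X s $ i) \<in> borel_measurable M"
  for X :: "'s \<Rightarrow> real ^ 'n"
  by (rule measurable_compose[OF _ measurable_nth])

lemma integrable_component_product:
  assumes "square_integrable M X" "square_integrable M Y"
  shows "integrable M (\<lambda>s. X s $ i * Y s $ j)"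
proof (rule Bochner_Integration.integrable_bound)
  show "integrable M (\<lambda>s. (X s $ i)\<^sup>2 + (Y s $ j)\<^sup>2)"
    using assms by (auto simp: square_integrable_def)
  show "(\<lambda>s. X s $ i * Y s $ j) \<in> borel_measurable M"
    using assms by (intro borel_measurable_times measurable_component) (auto simp: square_integrable_def)
  have "\<bar>x * y\<bar> \<le> x\<^sup>2 + y\<^sup>2" for x y :: real
  proof -
    have "2 * (\<bar>x\<bar> * \<bar>y\<bar>) \<le> x\<^sup>2 + y\<^sup>2" using sum_squares_bound[of "\<bar>x\<bar>" "\<bar>y\<bar>"] by (simp add: mult.assoc)
    moreover have "0 \<le> \<bar>x\<bar> * \<bar>y\<bar>" by simp
    ultimately show ?thesis unfolding abs_mult by linarith
  qed
  then show "AE s in M. norm (X s $ i * Y s $ j) \<le> norm ((X s $ i)\<^sup>2 + (Y s $ j)\<^sup>2)"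
    by (intro AE_I2) simp
qed

lemma pairing_second_moment:
  assumes "square_integrable M X"
  shows "pairing S (second_moment M X) = (\<integral>s. qf S (X s) \<partial>M)"
proof -
  have "(\<integral>s. qf S (X s) \<partial>M) = (\<Sum>i\<in>UNIV. \<Sum>j\<in>UNIV. (\<integral>s. X s $ i * X s $ j \<partial>M) * S $ i $ j)"
    unfolding qf_sum_entries using integrable_component_product[OF assms assms]
    by (simp add: Bochner_Integration.integral_sum)
  also have "\<dots> = (\<Sum>i\<in>UNIV. \<Sum>j\<in>UNIV. S $ i $ j * second_moment M X $ j $ i)"
    by (simp add: second_moment_def mult_ac)
  finally show ?thesis by (simp add: pairing_def trace_def matrix_matrix_mult_def)
qed

lemma second_moment_cone: "square_integrable M X \<Longrightarrow> second_moment M X \<in> moment_cone"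
  by (simp add: moment_cone_def pairing_second_moment integral_nonneg)

lemma measurable_matrix_vector_mult:
  fixes L :: "real ^ 'n ^ 'm"
  assumes "X \<in> borel_measurable M"
  shows "(\<lambda>s. L *v X s) \<in> borel_measurable M"
proof -
  have "(\<lambda>x. L *v x) \<in> borel_measurable borel"
    by (intro borel_measurable_continuous_onI continuous_on_matrix_vector_mult continuous_on_const continuous_on_id)
  with assms show ?thesis by (rule measurable_compose)
qed

lemma square_integrable_matrix_vector_mult:
  fixes L :: "real ^ 'n ^ 'm"
  assumes "square_integrable M X"
  shows "square_integrable M (\<lambda>s. L *v X s)"
proof -
  have "(\<lambda>s. ((L *v X s) $ i)\<^sup>2) = (\<lambda>s. \<Sum>k\<in>UNIV. \<Sum>l\<in>UNIV. L $ i $ k * L $ i $ l * (X s $ k * X s $ l))" for i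
    by (simp add: matrix_vector_mult_def power2_eq_square sum_product mult_ac)
  moreover have "integrable M (\<lambda>s. \<Sum>k\<in>UNIV. \<Sum>l\<in>UNIV. L $ i $ k * L $ i $ l * (X s $ k * X s $ l))" for i
    using integrable_component_product[OF assms assms] by (intro Bochner_Integration.integrable_sum integrable_mult_right)
  ultimately show ?thesis
    using assms measurable_matrix_vector_mult[of X M L] unfolding square_integrable_def by auto
qed

lemma square_integrable_add:
  assumes "square_integrable M X" "square_integrable M Y"
  shows "square_integrable M (\<lambda>s. X s + Y s)"
proof -
  have "integrable M (\<lambda>s. (X s $ i)\<^sup>2 + 2 * (X s $ i * Y s $ i) + (Y s $ i)\<^sup>2)" for i
    using assms integrable_component_product[OF assms] unfolding square_integrable_def
    by (intro Bochner_Integration.integrable_add integrable_mult_right) auto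
  then show ?thesis
    using assms unfolding square_integrable_def by (auto simp: power2_sum algebra_simps)
qed

lemma second_moment_matrix_vector_mult:
  fixes L :: "real ^ 'n ^ 'm"
  assumes "square_integrable M X"
  shows "second_moment M (\<lambda>s. L *v X s) = L ** second_moment M X ** transpose L"
proof -
  have "(\<integral>s. (L *v X s) $ i * (L *v X s) $ j \<partial>M)
      = (\<Sum>k\<in>UNIV. \<Sum>l\<in>UNIV. L $ i $ k * L $ j $ l * (\<integral>s. X s $ k * X s $ l \<partial>M))" for i j
  proof -
    have "(\<lambda>s. (L *v X s) $ i * (L *v X s) $ j)
        = (\<lambda>s. \<Sum>k\<in>UNIV. \<Sum>l\<in>UNIV. L $ i $ k * L $ j $ l * (X s $ k * X s $ l))"
      by (simp add: matrix_vector_mult_def sum_product mult_ac)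
    then show ?thesis
      using integrable_component_product[OF assms assms] by (simp add: Bochner_Integration.integral_sum)
  qed
  moreover have "(L ** second_moment M X ** transpose L) $ i $ j
      = (\<Sum>k\<in>UNIV. \<Sum>l\<in>UNIV. L $ i $ k * L $ j $ l * (\<integral>s. X s $ k * X s $ l \<partial>M))" for i j
    by (subst sum.swap) (simp add: matrix_matrix_mult_def transpose_def second_moment_def sum_distrib_left
        sum_distrib_right mult_ac)
  ultimately show ?thesis by (simp add: second_moment_def vec_eq_iff)
qed

lemma second_moment_add:
  assumes "square_integrable M X" "square_integrable M Y" "uncorrelated M X Y"
  shows "second_moment M (\<lambda>s. X s + Y s) = second_moment M X + second_moment M Y"
proof -
  note int = integrable_component_product[OF assms(1,1)] integrable_component_product[OF assms(1,2)]
    integrable_component_product[OF assms(2,2)] integrable_component_product[OF assms(2,1)]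
  have "(\<integral>s. (X s + Y s) $ i * (X s + Y s) $ j \<partial>M)
      = (\<integral>s. X s $ i * X s $ j + X s $ i * Y s $ j + X s $ j * Y s $ i + Y s $ i * Y s $ j \<partial>M)" for i j
    by (simp add: algebra_simps)
  also have "\<dots> i j = (\<integral>s. X s $ i * X s $ j \<partial>M) + (\<integral>s. Y s $ i * Y s $ j \<partial>M)" for i j
    using int assms(3) by (simp add: uncorrelated_def)
  finally show ?thesis by (simp add: second_moment_def vec_eq_iff)
qed

lemma uncorrelated_matrix_vector_mult:
  fixes L :: "real ^ 'n ^ 'm"
  assumes "square_integrable M X" "square_integrable M Y" "uncorrelated M X Y"
  shows "uncorrelated M (\<lambda>s. L *v X s) Y"
proof -
  have "(\<integral>s. (L *v X s) $ i * Y s $ j \<partial>M) = 0" for i j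
  proof -
    have "(\<lambda>s. (L *v X s) $ i * Y s $ j) = (\<lambda>s. \<Sum>k\<in>UNIV. L $ i $ k * (X s $ k * Y s $ j))"
      by (simp add: matrix_vector_mult_def sum_distrib_left mult_ac)
    then show ?thesis
      using integrable_component_product[OF assms(1,2)] assms(3)
      by (simp add: Bochner_Integration.integral_sum uncorrelated_def)
  qed
  then show ?thesis by (simp add: uncorrelated_def)
qed

lemma uncorrelated_add:
  assumes "square_integrable M X" "square_integrable M X'" "square_integrable M Y"
    and "uncorrelated M X Y" "uncorrelated M X' Y"
  shows "uncorrelated M (\<lambda>s. X s + X' s) Y"
  using assms integrable_component_product[OF assms(1,3)] integrable_component_product[OF assms(2,3)]
  by (simp add: uncorrelated_def distrib_right)

lemma gaussian_square_integrable:
  assumes "prob_space M" "gaussian_vector M X m S"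
  shows "square_integrable M X"
proof -
  have X: "X \<in> borel_measurable M" and S: "pos_semidef S"
    and law: "distr M borel (\<lambda>s. a \<bullet> X s) = normal_law (a \<bullet> m) (a \<bullet> (S *v a))" for a
    using assms(2) by (auto simp: gaussian_vector_def)
  have "integrable M (\<lambda>s. (axis i 1 \<bullet> X s)\<^sup>2)" for i
    by (rule normal_law_moments(1)[OF assms(1) _ law])
      (use X S in \<open>auto simp: pos_semidef_def\<close>)
  then show ?thesis using X by (simp add: square_integrable_def inner_axis')
qed

lemma gaussian_mean_component:
  assumes "prob_space M" "gaussian_vector M X 0 S"
  shows "(\<integral>s. X s $ i \<partial>M) = 0"
proof -
  have X: "X \<in> borel_measurable M" and S: "pos_semidef S"
    and law: "distr M borel (\<lambda>s. a \<bullet> X s) = normal_law (a \<bullet> 0) (a \<bullet> (S *v a))" for a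
    using assms(2) by (auto simp: gaussian_vector_def)
  have "(\<integral>s. axis i 1 \<bullet> X s \<partial>M) = axis i 1 \<bullet> (0 :: real ^ 'b)"
    by (rule normal_law_moments(2)[OF assms(1) _ law])
      (use X S in \<open>auto simp: pos_semidef_def\<close>)
  then show ?thesis by (simp add: inner_axis')
qed

text \<open>The covariance is known only through the variances of one-dimensional projections; polarization recovers
  its entries.\<close>

lemma gaussian_second_moment:
  fixes X :: "'s \<Rightarrow> real ^ 'n"
  assumes "prob_space M" "gaussian_vector M X 0 S"
  shows "second_moment M X = S"
proof -
  have X: "X \<in> borel_measurable M" and S: "transpose S = S" "\<And>x. 0 \<le> x \<bullet> (S *v x)"
    and law: "distr M borel (\<lambda>s. a \<bullet> X s) = normal_law (a \<bullet> 0) (a \<bullet> (S *v a))" for a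
    using assms(2) by (auto simp: gaussian_vector_def pos_semidef_def)
  have quad: "(\<integral>s. (a \<bullet> X s)\<^sup>2 \<partial>M) = qf S a" for a
    unfolding qf_def by (rule normal_law_moments(3)[OF assms(1) _ law]) (use X S in auto)
  note int = integrable_component_product[OF gaussian_square_integrable[OF assms] gaussian_square_integrable[OF assms]]
  have "(\<integral>s. X s $ i * X s $ j \<partial>M) = S $ i $ j" for i j
  proof -
    let ?p = "axis i 1 + axis j 1 :: real ^ 'n" and ?m = "axis i 1 + (- axis j 1) :: real ^ 'n"
    have int2: "integrable M (\<lambda>s. (?p \<bullet> X s)\<^sup>2)" "integrable M (\<lambda>s. (?m \<bullet> X s)\<^sup>2)"
      using int by (simp_all add: inner_add_left inner_axis' power2_eq_square algebra_simps)
    have "4 * (\<integral>s. X s $ i * X s $ j \<partial>M) = (\<integral>s. (?p \<bullet> X s)\<^sup>2 - (?m \<bullet> X s)\<^sup>2 \<partial>M)"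
      by (simp add: inner_add_left inner_axis' power2_eq_square algebra_simps flip: integral_mult_right_zero)
    also have "\<dots> = qf S ?p - qf S ?m" using int2 by (simp only: Bochner_Integration.integral_diff quad)
    also have "\<dots> = 4 * S $ i $ j"
      unfolding qf_add_right[OF S(1)]
      using qf_scaleR_right[of S "-1" "axis j 1"] inner_axis_matrix[of j S i]
        inner_matrix_sym[OF S(1), of "axis i 1" "axis j 1"] inner_axis_matrix[of i S j]
      by simp
    finally show ?thesis by simp
  qed
  then show ?thesis by (simp add: second_moment_def vec_eq_iff)
qed

lemma (in prob_space) square_integrable_imp_integrable_component:
  assumes "square_integrable M X"
  shows "integrable M (\<lambda>s. X s $ i)"
proof (rule Bochner_Integration.integrable_bound)
  show "integrable M (\<lambda>s. 1 + (X s $ i)\<^sup>2)" using assms by (auto simp: square_integrable_def)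
  show "(\<lambda>s. X s $ i) \<in> borel_measurable M"
    using assms by (intro measurable_component) (auto simp: square_integrable_def)
  have "\<bar>x\<bar> \<le> 1 + x\<^sup>2" for x :: real
    using sum_squares_bound[of "\<bar>x\<bar>" 1] by simp
  then show "AE s in M. norm (X s $ i) \<le> norm (1 + (X s $ i)\<^sup>2)" by (intro AE_I2) simp
qed

lemma (in prob_space) indep_uncorrelated:
  fixes Z :: "'i \<Rightarrow> 'a \<Rightarrow> real ^ 'n"
  assumes ind: "indep_vars (\<lambda>_. borel) Z UNIV" and "p \<noteq> q"
    and "square_integrable M (Z p)" "square_integrable M (Z q)" "\<And>i. (\<integral>s. Z q s $ i \<partial>M) = 0"
  shows "uncorrelated M (Z p) (Z q)"
  unfolding uncorrelated_def
proof (intro allI)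
  fix i j
  define f where "f r x = x $ (if r = p then i else j)" for r and x :: "real ^ 'n"
  have "indep_vars (\<lambda>_. borel) (\<lambda>r s. f r (Z r s)) {p, q}"
    by (rule indep_vars_compose2[OF indep_vars_subset[OF ind]])
      (simp_all add: f_def measurable_nth)
  then have "(\<integral>s. (\<Prod>r\<in>{p, q}. f r (Z r s)) \<partial>M) = (\<Prod>r\<in>{p, q}. \<integral>s. f r (Z r s) \<partial>M)"
    using assms(2-4)
    by (intro indep_vars_lebesgue_integral) (auto simp: f_def intro: square_integrable_imp_integrable_component)
  then show "(\<integral>s. Z p s $ i * Z q s $ j \<partial>M) = 0" using assms(2,5) by (simp add: f_def)
qed


section \<open>Costs of the controlled system\<close>

lemma state_Suc:
  "t \<ge> 1 \<Longrightarrow> state A B K x w (Suc t) = (A - B ** K t) *v state A B K x w t + w t"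
  by (simp add: matrix_vector_mult_diff_rdistrib matrix_vector_mul_assoc[symmetric] linear_neg)

text \<open>The probabilistic hypotheses on the initial state and the noise, with the former reduced to square
  integrability.\<close>

locale noisy_system = prob_space M for M :: "'s measure" +
  fixes A :: "real ^ 'n ^ 'n" and B :: "real ^ 'm ^ 'n" and W :: "real ^ 'n ^ 'n"
    and x1 :: "'s \<Rightarrow> real ^ 'n" and w :: "nat \<Rightarrow> 's \<Rightarrow> real ^ 'n"
  assumes x1: "square_integrable M x1"
    and noise: "\<And>t. t \<ge> 1 \<Longrightarrow> gaussian_vector M (w t) 0 W"
    and indep: "indep_vars (\<lambda>_. borel) (case_nat x1 (\<lambda>t. w (t + 1))) UNIV"
begin

abbreviation "trajectory K t s \<equiv> state A B K (x1 s) (\<lambda>i. w i s) t"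

lemma noise_square_integrable: "t \<ge> 1 \<Longrightarrow> square_integrable M (w t)"
  using gaussian_square_integrable[OF prob_space_axioms noise] .

lemma noise_second_moment: "t \<ge> 1 \<Longrightarrow> second_moment M (w t) = W"
  using gaussian_second_moment[OF prob_space_axioms noise] .

lemma noise_uncorrelated:
  assumes "r \<ge> 1"
  shows "uncorrelated M x1 (w r)" and "t \<ge> 1 \<Longrightarrow> t \<noteq> r \<Longrightarrow> uncorrelated M (w t) (w r)"
proof -
  let ?Z = "case_nat x1 (\<lambda>t. w (t + 1))"
  have Z: "?Z r = w r" using assms by (cases r) auto
  have mean: "(\<integral>s. ?Z r s $ i \<partial>M) = 0" for i
    unfolding Z by (rule gaussian_mean_component[OF prob_space_axioms noise[OF assms]])
  have sq: "square_integrable M (?Z r)" unfolding Z by (rule noise_square_integrable[OF assms])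
  show "uncorrelated M x1 (w r)"
    using indep_uncorrelated[OF indep, of 0 r, OF _ _ sq mean] x1 assms Z by simp
  show "uncorrelated M (w t) (w r)" if "t \<ge> 1" "t \<noteq> r"
  proof -
    have Zt: "?Z t = w t" using that by (cases t) auto
    show ?thesis
      using indep_uncorrelated[OF indep that(2) _ sq mean] noise_square_integrable[OF that(1)]
      unfolding Zt Z by blast
  qed
qed

text \<open>The state at time \<open>t\<close> is a linear function of the initial state and the noise before \<open>t\<close>, hence
  uncorrelated with the noise from \<open>t\<close> on.\<close>

lemma trajectory_moments:
  assumes "t \<ge> 1"
  shows "square_integrable M (trajectory K t) \<and> (\<forall>r\<ge>t. uncorrelated M (trajectory K t) (w r))"
  using assms
proof (induction t rule: dec_induct)
  case base
  then show ?case using x1 noise_uncorrelated(1) by simp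
next
  case (step t)
  have sq: "square_integrable M (trajectory K t)" and un: "uncorrelated M (trajectory K t) (w r)" if "r \<ge> t" for r
    using step(3) that by blast+
  note wt = noise_square_integrable[OF step(1)]
  have "square_integrable M (\<lambda>s. (A - B ** K t) *v trajectory K t s + w t s)"
    by (rule square_integrable_add[OF square_integrable_matrix_vector_mult[OF sq[OF order_refl]] wt])
  moreover have "uncorrelated M (\<lambda>s. (A - B ** K t) *v trajectory K t s + w t s) (w r)" if "r \<ge> Suc t" for r
  proof -
    have r: "r \<ge> 1" "r \<ge> t" "t \<noteq> r" using that step(1) by auto
    note wr = noise_square_integrable[OF r(1)]
    show ?thesis
      by (rule uncorrelated_add[OF square_integrable_matrix_vector_mult[OF sq[OF order_refl]] wt wr
            uncorrelated_matrix_vector_mult[OF sq[OF order_refl] wr un[OF r(2)]]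
            noise_uncorrelated(2)[OF r(1) step(1) r(3)]])
  qed
  ultimately show ?case unfolding state_Suc[OF step(1)] by blast
qed

lemma second_moment_step:
  assumes "t \<ge> 1"
  shows "second_moment M (trajectory K (Suc t))
    = (A - B ** K t) ** second_moment M (trajectory K t) ** transpose (A - B ** K t) + W"
proof -
  have sq: "square_integrable M (trajectory K t)" and un: "uncorrelated M (trajectory K t) (w t)"
    using trajectory_moments[OF assms] by blast+
  note wt = noise_square_integrable[OF assms]
  show ?thesis
    unfolding state_Suc[OF assms]
    by (simp only: second_moment_add[OF square_integrable_matrix_vector_mult[OF sq] wt
          uncorrelated_matrix_vector_mult[OF sq wt un]]
        second_moment_matrix_vector_mult[OF sq] noise_second_moment[OF assms])
qed

lemma stage_cost_eq_pairing:
  assumes "t \<ge> 1"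
  shows "stage_cost M A B x1 w Q R K t
    = pairing (Q t + transpose (K t) ** R t ** K t) (second_moment M (trajectory K t))"
proof -
  have neg: "qf S (- v) = qf S v" for S :: "real ^ 'm ^ 'm" and v
    using qf_scaleR_right[of S "-1" v] by simp
  have "stage_cost M A B x1 w Q R K t
      = (\<integral>s. qf (Q t) (trajectory K t s) + qf (R t) (- (K t *v trajectory K t s)) \<partial>M)"
    by (simp add: stage_cost_def Let_def qf_def)
  also have "\<dots> = (\<integral>s. qf (Q t + transpose (K t) ** R t ** K t) (trajectory K t s) \<partial>M)"
    by (simp only: neg qf_add qf_congruence)
  finally show ?thesis 
    by (simp only: pairing_second_moment[OF conjunct1[OF trajectory_moments[OF assms]]])
qed

end


section \<open>Logarithmic regret\<close>

text \<open>Stability passes from each policy to the next, through the reset as well: there \<open>P t\<close> is the value of a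
  policy that arises from \<open>K t\<close> by further improvement steps.\<close>

lemma online_riccati_update_stable:
  fixes A :: "real ^ 'n ^ 'n" and B :: "real ^ 'm ^ 'n"
  assumes \<mu>: "0 < \<mu>"
    and Q: "\<And>t. t \<ge> 1 \<Longrightarrow> transpose (Q t) = Q t" "\<And>t x. t \<ge> 1 \<Longrightarrow> \<mu> * (norm x)\<^sup>2 \<le> qf (Q t) x \<and> qf (Q t) x \<le> \<sigma> * (norm x)\<^sup>2"
    and R: "\<And>t. t \<ge> 1 \<Longrightarrow> transpose (R t) = R t" "\<And>t u. t \<ge> 1 \<Longrightarrow> \<mu> * (norm u)\<^sup>2 \<le> qf (R t) u \<and> qf (R t) u \<le> \<sigma> * (norm u)\<^sup>2"
    and run: "online_riccati_update A B Q R \<mu> \<sigma>' \<kappa> \<gamma> K P" and t: "t \<ge> 1"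
  shows "power_stable (A - B ** K t)" and "transpose (P t) = P t" and "\<mu> * (norm x)\<^sup>2 \<le> qf (P t) x"
proof -
  let ?Q = "running_average Q" and ?R = "running_average R"
  have Qs: "transpose (?Q t) = ?Q t" and Rs: "transpose (?R t) = ?R t" for t
    by (rule running_average_symmetric; use Q R in blast)+
  have Qc: "\<mu> * (norm x)\<^sup>2 \<le> qf (?Q t) x" if "t \<ge> 1" for t x
    using running_average_qf[of "\<mu> * (norm x)\<^sup>2" Q x "\<sigma> * (norm x)\<^sup>2", OF Q(2) that] by blast
  have Rc: "\<mu> * (norm u)\<^sup>2 \<le> qf (?R t) u" if "t \<ge> 1" for t u
    using running_average_qf[of "\<mu> * (norm u)\<^sup>2" R u "\<sigma> * (norm u)\<^sup>2", OF R(2) that] by blast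
  have pos: "0 \<le> \<mu> * (norm y)\<^sup>2" for y :: "real ^ 'k" using \<mu> by simp
  have R0: "0 \<le> qf (?R t) u" if "t \<ge> 1" for t u
    using Rc[OF that, of u] \<mu> by (smt (verit) mult_nonneg_nonneg zero_le_power2)
  have sol: "\<exists>k. power_stable (A - B ** k) \<and> solves_lyapunov A B (?Q t) (?R t) k (P t)"
    if t: "t \<ge> 1" and st: "power_stable (A - B ** K t)" for t
  proof (cases "t = reset_time B \<mu> \<sigma>' \<kappa> \<gamma>")
    case True
    then have "policy_iteration A B (?Q t) (?R t) (reset_tolerance B \<mu> \<sigma>' \<kappa> \<gamma>) (K t) (P t)"
      using run t unfolding online_riccati_update_def by auto
    from policy_iteration_stable[OF \<mu> Qs Qc[OF t] Rs Rc[OF t] this st] show ?thesis by blast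
  next
    case False
    then have "solves_lyapunov A B (?Q t) (?R t) (K t) (P t)"
      using run t unfolding online_riccati_update_def by auto
    with st show ?thesis by blast
  qed
  have val: "transpose (P t) = P t \<and> (\<forall>x. \<mu> * (norm x)\<^sup>2 \<le> qf (P t) x)"
    if t: "t \<ge> 1" "power_stable (A - B ** K t)" for t
  proof -
    obtain k where k: "power_stable (A - B ** k)" "solves_lyapunov A B (?Q t) (?R t) k (P t)"
      using sol[OF t] by blast
    show ?thesis using policy_value_coercive[OF \<mu> k Qs Rs Qc[OF t(1)] R0[OF t(1)]] by blast
  qed
  have "power_stable (A - B ** K t)" if "t \<ge> 1" for t
    using that
  proof (induction t rule: dec_induct)
    case base
    then show ?case
      using run spectral_radius_less_one_imp_power_stable
      unfolding online_riccati_update_def stable_policy_def by blast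
  next
    case (step t)
    obtain k where k: "power_stable (A - B ** k)" "solves_lyapunov A B (?Q t) (?R t) k (P t)"
      using sol[OF step(1,3)] by blast
    have P: "transpose (P t) = P t" "0 \<le> qf (P t) x" for x
      using val[OF step(1,3)] pos[of x] order_trans by blast+
    have "K (Suc t) = improved_policy A B (?R t) (P t)"
      using run step(1) unfolding online_riccati_update_def by simp
    then show ?case
      using improved_policy_power_stable[OF \<mu> P(1) Rs P(2) Rc[OF step(1)] Qc[OF step(1)] k(2)] by simp
  qed
  then show "power_stable (A - B ** K t)" and "transpose (P t) = P t" and "\<mu> * (norm x)\<^sup>2 \<le> qf (P t) x"
    using val t by blast+
qed

theorem theorem5p1:
  fixes A :: "real ^ 'n ^ 'n" and B :: "real ^ 'm ^ 'n" and W :: "real ^ 'n ^ 'n"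
    and Q :: "nat \<Rightarrow> real ^ 'n ^ 'n" and R :: "nat \<Rightarrow> real ^ 'm ^ 'm"
    and K :: "nat \<Rightarrow> real ^ 'n ^ 'm" and P :: "nat \<Rightarrow> real ^ 'n ^ 'n"
    and \<mu> \<sigma> \<nu> \<kappa> \<gamma> \<omega> :: real
    and M :: "'s measure" and x1 :: "'s \<Rightarrow> real ^ 'n" and w :: "nat \<Rightarrow> 's \<Rightarrow> real ^ 'n"
  assumes "prob_space M"
    and "\<exists>m S. gaussian_vector M x1 m S"
    and "\<And>t. t \<ge> 1 \<Longrightarrow> gaussian_vector M (w t) 0 W"
    and "prob_space.indep_vars M (\<lambda>_. borel) (case_nat x1 (\<lambda>t. w (t + 1))) UNIV"
    and "B \<noteq> 0"
    and "stabilizable A B"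
    and "0 < \<mu>" and "\<mu> < \<sigma>"
    and "\<And>t. t \<ge> 1 \<Longrightarrow> pos_def (Q t) \<and> \<mu> *\<^sub>R mat 1 \<preceq> Q t \<and> trace (Q t) \<le> \<sigma>"
    and "\<And>t. t \<ge> 1 \<Longrightarrow> pos_def (R t) \<and> \<mu> *\<^sub>R mat 1 \<preceq> R t \<and> trace (R t) \<le> \<sigma>"
    and "\<omega> = trace W"
    and "\<kappa> = sqrt (\<nu> / \<mu>)" and "\<gamma> = 1 / (2 * \<kappa> ^ 2)"
    and "online_riccati_update A B Q R \<mu> \<sigma> \<kappa> \<gamma> K P"
    and "\<And>t. t \<ge> 1 \<Longrightarrow> P t \<preceq> \<nu> *\<^sub>R mat 1"
  shows "\<exists>C>0. \<forall>T\<ge>2. regret M A B x1 w Q R K T \<le> C * ln (real T)"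
proof -
  \<comment> \<open>The trace of a nonnegative form bounds it up to the dimension, so \<open>b\<close> bounds all costs.\<close>
  define b where "b = (real CARD('n) + real CARD('m)) * \<sigma>"
  define t\<^sub>0 where "t\<^sub>0 = Suc (reset_time B \<mu> \<sigma> \<kappa> \<gamma>)"
  have \<sigma>: "0 < \<sigma>" using assms(7,8) by simp
  have "real CARD('n) * \<sigma> \<le> b" "real CARD('m) * \<sigma> \<le> b"
    unfolding b_def distrib_right using \<sigma> by simp_all
  moreover have "1 * \<sigma> \<le> real CARD('n) * \<sigma>" using \<sigma> by (intro mult_right_mono) (auto simp: Suc_le_eq)
  ultimately have b: "real CARD('n) * \<sigma> \<le> b" "real CARD('m) * \<sigma> \<le> b" "\<mu> \<le> b" using assms(8) by linarith+
  have Qs: "transpose (Q t) = Q t" and Rs: "transpose (R t) = R t" if "t \<ge> 1" for t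
    using assms(9,10)[OF that] by (auto simp: pos_def_def)
  have bounds: "\<mu> * (norm x)\<^sup>2 \<le> qf S x \<and> qf S x \<le> b * (norm x)\<^sup>2"
    if "\<mu> *\<^sub>R mat 1 \<preceq> S \<and> trace S \<le> \<sigma>" "real CARD('k) * \<sigma> \<le> b" for S :: "real ^ 'k ^ 'k" and x
  proof
    have lo: "\<mu> * (norm y)\<^sup>2 \<le> qf S y" for y
    proof -
      have "0 \<le> qf (S - \<mu> *\<^sub>R mat 1) y"
        using that(1) unfolding loewner_le_def pos_semidef_def qf_def by blast
      then show ?thesis by (simp add: qf_diff qf_scaleR qf_mat_1)
    qed
    show "\<mu> * (norm x)\<^sup>2 \<le> qf S x" by (rule lo)
    have "0 \<le> qf S y" for y
      using lo[of y] assms(7) by (smt (verit) mult_nonneg_nonneg zero_le_power2)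
    then have "qf S x \<le> real CARD('k) * trace S * (norm x)\<^sup>2" by (rule qf_le_trace)
    also have "\<dots> \<le> b * (norm x)\<^sup>2"
    proof (rule mult_right_mono)
      have "real CARD('k) * trace S \<le> real CARD('k) * \<sigma>" using that(1) by (intro mult_left_mono) auto
      then show "real CARD('k) * trace S \<le> b" using that(2) by linarith
    qed simp
    finally show "qf S x \<le> b * (norm x)\<^sup>2" .
  qed
  have Qb: "\<mu> * (norm x)\<^sup>2 \<le> qf (Q t) x \<and> qf (Q t) x \<le> b * (norm x)\<^sup>2" if "t \<ge> 1" for t x
    using bounds[of "Q t" x] assms(9)[OF that] b by blast
  have Rb: "\<mu> * (norm u)\<^sup>2 \<le> qf (R t) u \<and> qf (R t) u \<le> b * (norm u)\<^sup>2" if "t \<ge> 1" for t u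
    using bounds[of "R t" u] assms(10)[OF that] b by blast
  note stable = online_riccati_update_stable[OF assms(7) Qs Qb Rs Rb assms(14)]
  have value_tracking: "value_tracking A B Q R K P \<mu> b \<nu> t\<^sub>0"
  proof
    fix t x assume t: "t \<ge> t\<^sub>0"
    then have t1: "t \<ge> 1" "t \<noteq> reset_time B \<mu> \<sigma> \<kappa> \<gamma>" by (auto simp: t\<^sub>0_def)
    show "transpose (P t) = P t" "\<mu> * (norm x)\<^sup>2 \<le> qf (P t) x" using stable(2,3)[OF _ _ _ _ t1(1)] by auto
    have "0 \<le> qf (\<nu> *\<^sub>R mat 1 - P t) x"
      using assms(15)[OF t1(1)] unfolding loewner_le_def pos_semidef_def qf_def by blast
    then show "qf (P t) x \<le> \<nu> * (norm x)\<^sup>2" by (simp add: qf_diff qf_scaleR qf_mat_1)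
    show "solves_lyapunov A B (running_average Q t) (running_average R t) (K t) (P t)"
      using assms(14) t1 unfolding online_riccati_update_def by auto
    show "K (Suc t) = improved_policy A B (running_average R t) (P t)"
      using assms(14) t1 unfolding online_riccati_update_def by auto
  qed (use assms(7) b Qs Rs Qb Rb in \<open>auto simp: t\<^sub>0_def\<close>)
  have noisy: "noisy_system M W x1 w"
    unfolding noisy_system_def noisy_system_axioms_def
    using assms(1-4) gaussian_square_integrable[OF assms(1)] by blast
  interpret noisy_system M A B W x1 w by (rule noisy)
  define X where "X k t = second_moment M (trajectory k t)" for k t
  have cost: "stage_cost M A B x1 w Q R k t = pairing (Q t + transpose (k t) ** R t ** k t) (X k t)"
    if "t \<ge> 1" for k t unfolding X_def by (rule stage_cost_eq_pairing[OF that])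
  have moments_cone: "X k t \<in> moment_cone" if "t \<ge> 1" for k t
    unfolding X_def using second_moment_cone trajectory_moments[OF that] by blast
  have moments_step: "X k (Suc t) = (A - B ** k t) ** X k t ** transpose (A - B ** k t) + W" if "t \<ge> 1" for k t
    unfolding X_def by (rule second_moment_step[OF that])
  have W: "W \<in> moment_cone"
    using second_moment_cone[OF noise_square_integrable[of 1]] noise_second_moment[of 1] by simp
  interpret controlled_moments A B Q R K P \<mu> b \<nu> t\<^sub>0 "X K" W
    using value_tracking W moments_cone moments_step by (intro controlled_moments.intro controlled_moments_axioms.intro) auto
  have cost_nonneg: "0 \<le> stage_cost M A B x1 w Q R k t" if "t \<ge> 1" for k t
    unfolding cost[OF that]
  proof (rule pairing_nonneg[OF moments_cone[OF that]])
    fix x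
    have "0 \<le> \<mu> * (norm x)\<^sup>2" "0 \<le> \<mu> * (norm (k t *v x))\<^sup>2" using assms(7) by simp_all
    then show "0 \<le> qf (Q t + transpose (k t) ** R t ** k t) x"
      using Qb[OF that, of x] Rb[OF that, of "k t *v x"] unfolding qf_add qf_congruence by linarith
  qed
  have ne: "stable_policies A B \<noteq> {}"
    using assms(6) by (auto simp: stable_policies_def stabilizable_def)
  obtain C1 \<tau>1 where C1: "0 \<le> C1"
    and up: "\<And>T. T \<ge> \<tau>1 \<Longrightarrow> (\<Sum>t=1..T. run_cost t) \<le> real T * pairing (P T) W + C1 * (1 + ln (real T))"
    by (rule run_cost_upper) (rule that)
  obtain C2 \<tau>2 where C2: "0 \<le> C2" and "\<tau>2 \<ge> t\<^sub>0"
    and low: "\<forall>T\<ge>\<tau>2. \<forall>k X. X 1 \<in> moment_cone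
      \<longrightarrow> (\<forall>t\<ge>1. X (Suc t) = (A - B ** k) ** X t ** transpose (A - B ** k) + W)
      \<longrightarrow> real T * pairing (P T) W - C2 \<le> (\<Sum>t=1..T. pairing (Q t + transpose k ** R t ** k) (X t))"
    by (rule fixed_policy_lower[OF W]) (rule that)
  let ?J = "\<lambda>k T. \<Sum>t=1..T. stage_cost M A B x1 w Q R k t"
  define \<tau> where "\<tau> = max \<tau>1 \<tau>2"
  define C3 where "C3 = ?J K \<tau>"
  have C3: "0 \<le> C3" unfolding C3_def by (intro sum_nonneg cost_nonneg) auto
  have run: "?J K T = (\<Sum>t=1..T. run_cost t)" for T
    by (intro sum.cong) (auto simp: run_cost_def cost)
  have bound: "regret M A B x1 w Q R K T \<le> C1 + C2 + C3 + C1 * ln (real T)" if "T \<ge> 2" for T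
  proof (cases "T \<ge> \<tau>")
    case True
    have "real T * pairing (P T) W - C2 \<le> (INF k\<in>stable_policies A B. ?J (\<lambda>_. k) T)"
    proof (rule cINF_greatest[OF ne])
      fix k
      have "?J (\<lambda>_. k) T = (\<Sum>t=1..T. pairing (Q t + transpose k ** R t ** k) (X (\<lambda>_. k) t))"
        by (intro sum.cong) (auto simp: cost)
      then show "real T * pairing (P T) W - C2 \<le> ?J (\<lambda>_. k) T"
        using low[rule_format, of T "X (\<lambda>_. k)" k] True moments_cone moments_step by (simp add: \<tau>_def)
    qed
    moreover have "?J K T \<le> real T * pairing (P T) W + C1 * (1 + ln (real T))"
      unfolding run by (rule up) (use True in \<open>simp add: \<tau>_def\<close>)
    ultimately show ?thesis using C3 unfolding regret_def by (simp add: algebra_simps)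
  next
    case False
    have "0 \<le> (INF k\<in>stable_policies A B. ?J (\<lambda>_. k) T)"
      by (rule cINF_greatest[OF ne]) (intro sum_nonneg cost_nonneg, simp)
    moreover have "?J K T \<le> C3"
      unfolding C3_def using False by (intro sum_mono2 cost_nonneg) auto
    moreover have "0 \<le> C1 * ln (real T)" using C1 that by simp
    ultimately show ?thesis using C1 C2 unfolding regret_def by linarith
  qed
  \<comment> \<open>Constants are absorbed by \<open>ln T\<close>, as \<open>T \<ge> 2\<close>; the final summand makes \<open>C\<close> positive.\<close>
  define C where "C = (C1 + C2 + C3) / ln 2 + C1 + 1"
  have "0 < C" using C1 C2 C3 by (simp add: C_def add_nonneg_pos)
  moreover have "regret M A B x1 w Q R K T \<le> C * ln (real T)" if "T \<ge> 2" for T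
  proof -
    have ln: "ln 2 \<le> ln (real T)" "0 < ln (2 :: real)" using that by auto
    have "C1 + C2 + C3 = (C1 + C2 + C3) / ln 2 * ln 2" using ln by simp
    also have "\<dots> \<le> (C1 + C2 + C3) / ln 2 * ln (real T)"
      using C1 C2 C3 ln by (intro mult_left_mono) auto
    finally show ?thesis using bound[OF that] ln unfolding C_def distrib_right by linarith
  qed
  ultimately show ?thesis by blast
qed

end
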